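(* Let $F$ be a perfect field with $\mathrm{char}(F)\neq 2$, let $\overline{F}$ be an algebraic closure of $F$, let $g\geq 1$ be an integer, and let $f(x)=x^{2g+1}+a_1x^{2g}+a_2x^{2g-1}+\cdots+a_{2g}x+a_{2g+1}$ be an irreducible polynomial over $F$ with roots $e_1,e_2,\ldots,e_{2g+1}$ in $\overline{F}$. Let $C_f$ be the non-singular projective model over $F$ of the projective plane curve $y^2=f(x)$, let $J_f$ be the Jacobian variety of $C_f$, and let $\overline{J}_f=J_f\otimes_F\overline{F}$. Let $P_i$ ($1\le i\le 2g+1$) be the (non-singular) point of $C_f$ over $\overline{F}$ corresponding to the point $[e_i:0:1]$ of $y^2=f(x)$, and let $P_\infty$ be the point of $C_f$ corresponding to the point $[0:1:0]$ of $y^2=f(x)$, which is rational over $F$. Then the map sending $e_i$ to the class of the divisor $P_i-P_\infty$ in $\overline{J}_f$ is an injection of the set of roots $\{e_1,\ldots,e_{2g+1}\}$ into $\overline{J}_f$. Furthermore, the subgroup of $\overline{J}_f$ generated by the images of $P_1-P_\infty,\ P_2-P_\infty,\ \ldots,\ P_{2g+1}-P_\infty$ is $\overline{J}_f(2)\cong(\mathbb{Z}/2\mathbb{Z})^{\oplus 2g}$.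
   Context: The projective plane curve $y^2=f(x)$ is the closed curve in $\mathbb{P}^2_F$, with homogeneous coordinates $[X:Y:Z]$ and $x=X/Z$, $y=Y/Z$, given by $Z^{2g-1}Y^2=X^{2g+1}+a_1X^{2g}Z+a_2X^{2g-1}Z^2+\cdots+a_{2g}XZ^{2g}+a_{2g+1}Z^{2g+1}$. Points of $\overline{J}_f$ over $\overline{F}$ are identified with linear equivalence classes of degree-zero divisors on $C_f\otimes_F\overline{F}$. $\overline{J}_f(2)$ denotes the $2$-torsion subgroup of $\overline{J}_f$ (its points over $\overline{F}$ killed by $2$). *)

theory Defs
  imports
    "HOL-Algebra.Algebraic_Closure_Type"
    "HOL-Algebra.Free_Abelian_Groups"
    "HOL-Computational_Algebra.Computational_Algebra"
begin

definition perfect_field :: "'a::field itself \<Rightarrow> bool" where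
  "perfect_field _ \<longleftrightarrow> CHAR('a) = 0 \<or> surj (\<lambda>x::'a. x ^ CHAR('a))"

definition is_algebraic_closure :: "('a::field \<Rightarrow> 'b::alg_closed_field) \<Rightarrow> bool" where
  "is_algebraic_closure \<iota> \<longleftrightarrow>
     (\<forall>a b. \<iota> (a + b) = \<iota> a + \<iota> b) \<and> (\<forall>a b. \<iota> (a * b) = \<iota> a * \<iota> b) \<and> \<iota> 1 = 1 \<and>
     (\<forall>z. \<exists>p. p \<noteq> 0 \<and> poly (map_poly \<iota> p) z = 0)"


section \<open>The projective plane curve\<close>

text \<open>The equation in homogeneous coordinates \<open>[u:v:w]\<close>. For a polynomial of degree \<open>2g+1\<close> the exponent of \<open>w\<close> on the left is \<open>2g-1\<close>.\<close>

definition plane_eq :: "'r::comm_ring_1 poly \<Rightarrow> 'r \<times> 'r \<times> 'r \<Rightarrow> bool" where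
  "plane_eq f = (\<lambda>(u, v, w). w ^ (degree f - 2) * v ^ 2 =
     (\<Sum>i\<le>degree f. coeff f i * u ^ i * w ^ (degree f - i)))"

text \<open>A point of the projective plane is given by any triple of homogeneous coordinates; all notions
  below are invariant under rescaling the triple.\<close>

definition plane_curve :: "'b::field poly \<Rightarrow> ('b \<times> 'b \<times> 'b) set" where
  "plane_curve f = {p. p \<noteq> (0, 0, 0) \<and> plane_eq f p}"

text \<open>The homogeneous form of degree \<open>d\<close> in three variables in which \<open>u\<^sup>i v\<^sup>j w\<^sup>d\<^sup>-\<^sup>i\<^sup>-\<^sup>j\<close> has coefficient
  \<open>c i j\<close>, evaluated at a triple.\<close>

definition form :: "nat \<Rightarrow> (nat \<Rightarrow> nat \<Rightarrow> 'r::comm_ring_1) \<Rightarrow> 'r \<times> 'r \<times> 'r \<Rightarrow> 'r" where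
  "form d c = (\<lambda>(u, v, w). \<Sum>i\<le>d. \<Sum>j\<le>d-i. c i j * u ^ i * v ^ j * w ^ (d - i - j))"


section \<open>The function field\<close>

text \<open>In the following, \<open>f\<close> is a polynomial over an algebraically closed field \<open>'b\<close>. The function
  field of \<open>y\<^sup>2 = f(x)\<close> is realised as \<open>'b(x, y)\<close> inside an algebraic closure of the rational
  function field \<open>'b(x)\<close>. There are two choices for \<open>y\<close>, which differ by a sign.\<close>

type_synonym 'b ambient = "'b poly fract alg_closure"

definition const :: "'b::field \<Rightarrow> 'b ambient" where
  "const a = to_ac (to_fract [:a:])"

definition gen_x :: "'b::field ambient" where
  "gen_x = to_ac (to_fract [:0, 1:])"

definition gen_y :: "'b::field poly \<Rightarrow> 'b ambient" where
  "gen_y f = (SOME y. plane_eq (map_poly const f) (gen_x, y, 1))"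

text \<open>The value of a form at the generic point \<open>[x:y:1]\<close> of the curve. It vanishes iff the form
  vanishes identically on the curve.\<close>

definition form_gen :: "'b::field poly \<Rightarrow> nat \<Rightarrow> (nat \<Rightarrow> nat \<Rightarrow> 'b) \<Rightarrow> 'b ambient" where
  "form_gen f d G = form d (\<lambda>i j. const (G i j)) (gen_x, gen_y f, 1)"

text \<open>Rational functions on the curve that can be written with coefficients in \<open>k\<close>.\<close>

definition function_field :: "'b::field set \<Rightarrow> 'b poly \<Rightarrow> 'b ambient set" where
  "function_field k f = {form_gen f d G / form_gen f d H |d G H.
     (\<forall>i j. G i j \<in> k \<and> H i j \<in> k) \<and> form_gen f d H \<noteq> 0}"

definition local_ring :: "'b::field poly \<Rightarrow> 'b \<times> 'b \<times> 'b \<Rightarrow> 'b ambient set" where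
  "local_ring f p = {form_gen f d G / form_gen f d H |d G H. form d H p \<noteq> 0}"

definition local_max_ideal :: "'b::field poly \<Rightarrow> 'b \<times> 'b \<times> 'b \<Rightarrow> 'b ambient set" where
  "local_max_ideal f p =
     {form_gen f d G / form_gen f d H |d G H. form d H p \<noteq> 0 \<and> form d G p = 0}"


section \<open>The non-singular projective model\<close>

text \<open>The points over \<open>'b\<close> of the non-singular projective model of a curve are the discrete
  valuation rings of its function field that contain \<open>'b\<close>. Each ring is represented by its normalised
  valuation, with value \<open>0\<close> outside the nonzero elements of the function field.\<close>

definition points :: "'b::field poly \<Rightarrow> ('b ambient \<Rightarrow> int) set" where
  "points f = (let K = function_field UNIV f in
     {v. (\<forall>h. h \<notin> K - {0} \<longrightarrow> v h = 0) \<and>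
         (\<forall>h\<in>K - {0}. \<forall>h'\<in>K - {0}. v (h * h') = v h + v h') \<and>
         (\<forall>h\<in>K - {0}. \<forall>h'\<in>K - {0}. h + h' \<noteq> 0 \<longrightarrow> v (h + h') \<ge> min (v h) (v h')) \<and>
         (\<forall>a. a \<noteq> 0 \<longrightarrow> v (const a) = 0) \<and>
         (\<exists>t\<in>K - {0}. v t = 1)})"

definition val_ring :: "'b::field poly \<Rightarrow> ('b ambient \<Rightarrow> int) \<Rightarrow> 'b ambient set" where
  "val_ring f v = {h \<in> function_field UNIV f. h = 0 \<or> v h \<ge> 0}"

definition val_max_ideal :: "'b::field poly \<Rightarrow> ('b ambient \<Rightarrow> int) \<Rightarrow> 'b ambient set" where
  "val_max_ideal f v = {h \<in> function_field UNIV f. h = 0 \<or> v h > 0}"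

text \<open>The points of the model that the normalisation map sends to the point \<open>p\<close> of the plane curve:
  those whose valuation ring dominates the local ring at \<open>p\<close>.\<close>

definition points_over :: "'b::field poly \<Rightarrow> 'b \<times> 'b \<times> 'b \<Rightarrow> ('b ambient \<Rightarrow> int) set" where
  "points_over f p = {v \<in> points f. p \<in> plane_curve f \<and>
     local_ring f p \<subseteq> val_ring f v \<and> local_max_ideal f p \<subseteq> val_max_ideal f v}"

definition point_over :: "'b::field poly \<Rightarrow> 'b \<times> 'b \<times> 'b \<Rightarrow> ('b ambient \<Rightarrow> int)" where
  "point_over f p = (THE v. v \<in> points_over f p)"

text \<open>A point of a curve is non-singular iff its local ring is a discrete valuation ring.\<close>

definition nonsingular_at :: "'b::field poly \<Rightarrow> 'b \<times> 'b \<times> 'b \<Rightarrow> bool" where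
  "nonsingular_at f p \<longleftrightarrow> p \<in> plane_curve f \<and> (\<exists>v\<in>points f. local_ring f p = val_ring f v)"

text \<open>For a subfield \<open>k\<close> that contains the coefficients of \<open>f\<close>: the point below \<open>v\<close> on the model
  over \<open>k\<close>, given by the restriction of \<open>v\<close> to \<open>k(x, y)\<close>, has residue field \<open>k\<close>.\<close>

definition rational_over :: "'b::field set \<Rightarrow> 'b poly \<Rightarrow> ('b ambient \<Rightarrow> int) \<Rightarrow> bool" where
  "rational_over k f v \<longleftrightarrow>
     (\<forall>h \<in> val_ring f v \<inter> function_field k f. \<exists>a\<in>k. h - const a \<in> val_max_ideal f v)"


section \<open>Divisor classes\<close>

definition divisor_degree :: "('p \<Rightarrow>\<^sub>0 int) \<Rightarrow> int" where
  "divisor_degree D = (\<Sum>P\<in>Poly_Mapping.keys D. Poly_Mapping.lookup D P)"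

definition divisors0 :: "'b::field poly \<Rightarrow> (('b ambient \<Rightarrow> int) \<Rightarrow>\<^sub>0 int) monoid" where
  "divisors0 f = (free_Abelian_group (points f))
     \<lparr>carrier := {D \<in> carrier (free_Abelian_group (points f)). divisor_degree D = 0}\<rparr>"

text \<open>\<open>D\<close> is the divisor of the rational function \<open>h\<close>; the order of \<open>h\<close> at the point \<open>P\<close> is \<open>P h\<close>.\<close>

definition principal_divisors :: "'b::field poly \<Rightarrow> (('b ambient \<Rightarrow> int) \<Rightarrow>\<^sub>0 int) set" where
  "principal_divisors f = {D \<in> carrier (free_Abelian_group (points f)).
     \<exists>h \<in> function_field UNIV f - {0}. \<forall>P \<in> points f. Poly_Mapping.lookup D P = P h}"

text \<open>The group of geometric points of the Jacobian.\<close>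

definition jacobian :: "'b::field poly \<Rightarrow> (('b ambient \<Rightarrow> int) \<Rightarrow>\<^sub>0 int) set monoid" where
  "jacobian f = divisors0 f Mod principal_divisors f"

definition divisor_class ::
    "'b::field poly \<Rightarrow> (('b ambient \<Rightarrow> int) \<Rightarrow>\<^sub>0 int) \<Rightarrow> (('b ambient \<Rightarrow> int) \<Rightarrow>\<^sub>0 int) set" where
  "divisor_class f D = principal_divisors f #>\<^bsub>divisors0 f\<^esub> D"

definition two_torsion :: "('c, 'd) monoid_scheme \<Rightarrow> 'c set" where
  "two_torsion A = {c \<in> carrier A. c [^]\<^bsub>A\<^esub> (2::nat) = \<one>\<^bsub>A\<^esub>}"

definition root_class :: "'b::field poly \<Rightarrow> 'b \<Rightarrow> (('b ambient \<Rightarrow> int) \<Rightarrow>\<^sub>0 int) set" where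
  "root_class f e =
     divisor_class f (frag_of (point_over f (e, 0, 1)) - frag_of (point_over f (0, 1, 0)))"

end

theory Submission
  imports Defs
begin

text \<open>Let \<open>k\<close> be the algebraically closed field, \<open>K = k(x) + k(x) y\<close> the function field and \<open>\<sigma>\<close> the
  involution \<open>y \<mapsto> - y\<close>, with norm \<open>N(A + B y) = A\<^sup>2 - B\<^sup>2 f\<close>. The involution
  reduces every question about divisors to rational functions in \<open>x\<close>, which factor into linear
  polynomials.

  \<^bold>\<open>Points.\<close> A valuation of \<open>K\<close> restricts to a multiple of the order at some \<open>a\<close> or of the order at
  infinity on \<open>k(x)\<close> (\<open>point_cases\<close>). If that order is odd on \<open>f\<close>, which happens at the roots of \<open>f\<close>
  and at infinity, then \<open>A\<^sup>2\<close> and \<open>B\<^sup>2 f\<close> have values of different parity and cannot cancel. So the order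
  of the norm is a valuation of \<open>K\<close>, and the only one above the given order (\<open>ramified_point\<close>,
  \<open>ramified_unique\<close>). These are the points \<open>P\<^sub>i\<close> and \<open>P\<^sub>\<infinity>\<close>; comparison with the local rings of the plane
  curve gives the claims on singularities, on points of the normalisation and on rationality. Above
  any other \<open>a\<close> there are two points that \<open>\<sigma>\<close> exchanges (\<open>points_over_nonroot\<close>). Consequently
  \<open>div (x - a)\<close> has degree zero, and so has \<open>div h\<close>, because \<open>h\<close> and \<open>\<sigma>(h)\<close> have the same degree and
  their product is the norm (\<open>degree_function\<close>).

  \<^bold>\<open>Relations.\<close> We have \<open>2 (P\<^sub>i - P\<^sub>\<infinity>) = div (x - e\<^sub>i)\<close> and \<open>\<Sum>\<^sub>i (P\<^sub>i - P\<^sub>\<infinity>) = div y\<close>. Conversely, if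
  \<open>\<Sum>\<^sub>i n\<^sub>i (P\<^sub>i - P\<^sub>\<infinity>) = div h\<close>, then \<open>\<sigma>(h) / h\<close> has no zeros and poles and is constant, so \<open>h\<close> lies in
  \<open>k(x)\<close> or in \<open>k(x) y\<close>, and the \<open>n\<^sub>i\<close> are all even or all odd (\<open>combination_parity\<close>). This gives the
  injectivity and shows that the \<open>2g + 1\<close> classes satisfy, modulo \<open>2\<close>, a single relation.

  \<^bold>\<open>All of the two-torsion.\<close> Let \<open>2 D = div h\<close>. The norm of \<open>h\<close> has even order at every \<open>a\<close>, hence is
  a square \<open>r\<^sup>2\<close> in \<open>k(x)\<close>, and \<open>h / r\<close> has norm one. By Hilbert's Theorem 90, explicitly with
  \<open>u = 1 + h / r\<close>, we get \<open>h / r = u / \<sigma>(u)\<close>, which says that \<open>D - div u\<close> is invariant under \<open>\<sigma>\<close>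
  (\<open>two_torsion_divisor_class\<close>). An invariant divisor consists of the \<open>P\<^sub>i\<close>, \<open>P\<^sub>\<infinity>\<close> and of orbits of
  two points; such an orbit is equivalent to \<open>2 P\<^sub>\<infinity>\<close> through \<open>x - a\<close>
  (\<open>invariant_divisor_class\<close>).

  \<^bold>\<open>Separability.\<close> The roots \<open>e\<^sub>i\<close> are distinct because an irreducible polynomial over a perfect field
  has a nonzero derivative (\<open>simple_roots_if_perfect\<close>).\<close>


section \<open>Valuations on fields\<close>

locale field_subset =
  fixes K :: "'k::field set"
  assumes one_mem [simp, intro]: "1 \<in> K"
    and diff_mem [intro]: "h \<in> K \<Longrightarrow> h' \<in> K \<Longrightarrow> h - h' \<in> K"
    and mult_mem [intro]: "h \<in> K \<Longrightarrow> h' \<in> K \<Longrightarrow> h * h' \<in> K"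
    and inverse_mem [intro]: "h \<in> K \<Longrightarrow> inverse h \<in> K"
begin

lemma zero_mem [simp, intro]: "0 \<in> K"
  using diff_mem[of 1 1] by simp

lemma uminus_mem [intro]: "h \<in> K \<Longrightarrow> - h \<in> K"
  using diff_mem[of 0 h] by simp

lemma add_mem [intro]: "h \<in> K \<Longrightarrow> h' \<in> K \<Longrightarrow> h + h' \<in> K"
  using diff_mem[of h "- h'"] uminus_mem by auto

lemma divide_mem [intro]: "h \<in> K \<Longrightarrow> h' \<in> K \<Longrightarrow> h / h' \<in> K"
  by (auto simp: field_class.field_divide_inverse)

lemma power_mem [intro]: "h \<in> K \<Longrightarrow> h ^ n \<in> K" for n :: nat
  by (induction n) auto

lemma power_int_mem [intro]: "h \<in> K \<Longrightarrow> h powi n \<in> K"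
  by (auto simp: power_int_def)

lemma sum_mem [intro]: "(\<And>i. i \<in> I \<Longrightarrow> c i \<in> K) \<Longrightarrow> sum c I \<in> K"
  by (induction I rule: infinite_finite_induct) auto

lemma prod_mem [intro]: "(\<And>i. i \<in> I \<Longrightarrow> c i \<in> K) \<Longrightarrow> prod c I \<in> K"
  by (induction I rule: infinite_finite_induct) auto

end

text \<open>Zero has no value in \<open>\<int>\<close>, and \<open>v 0\<close> may be anything. Lower bounds on values are therefore
  expressed below by \<open>v_ge\<close>, which holds at zero.\<close>

locale valued_field = field_subset K for K :: "'k::field set" +
  fixes v :: "'k \<Rightarrow> int"
  assumes v_mult: "\<lbrakk>h \<in> K; h' \<in> K; h \<noteq> 0; h' \<noteq> 0\<rbrakk> \<Longrightarrow> v (h * h') = v h + v h'"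
    and v_add: "\<lbrakk>h \<in> K; h' \<in> K; h \<noteq> 0; h' \<noteq> 0; h + h' \<noteq> 0\<rbrakk> \<Longrightarrow> min (v h) (v h') \<le> v (h + h')"
begin

definition v_ge :: "int \<Rightarrow> 'k \<Rightarrow> bool" where
  "v_ge n h \<longleftrightarrow> h = 0 \<or> n \<le> v h"

lemma v_one [simp]: "v 1 = 0"
  using v_mult[of 1 1] by simp

lemma v_minus_one [simp]: "v (- 1) = 0"
  using v_mult[of "-1" "-1"] uminus_mem[of 1] by simp

lemma v_minus [simp]: "h \<in> K \<Longrightarrow> v (- h) = v h"
  using v_mult[of "-1" h] uminus_mem[of 1] by (cases "h = 0") auto

lemma v_inverse: "h \<in> K \<Longrightarrow> h \<noteq> 0 \<Longrightarrow> v (inverse h) = - v h"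
  using v_mult[of h "inverse h"] inverse_mem[of h] by auto

lemma v_divide: "\<lbrakk>h \<in> K; h' \<in> K; h \<noteq> 0; h' \<noteq> 0\<rbrakk> \<Longrightarrow> v (h / h') = v h - v h'"
  using v_mult[of h "inverse h'"] v_inverse[of h'] by (auto simp: field_class.field_divide_inverse)

lemma v_power: "h \<in> K \<Longrightarrow> h \<noteq> 0 \<Longrightarrow> v (h ^ n) = int n * v h"
proof (induction n)
  case (Suc n)
  then have "v (h * h ^ n) = v h + v (h ^ n)" by (intro v_mult) auto
  then show ?case using Suc by (simp add: algebra_simps)
qed simp

lemma v_power_int: "h \<in> K \<Longrightarrow> h \<noteq> 0 \<Longrightarrow> v (h powi n) = n * v h"
  by (auto simp: power_int_def v_power v_inverse power_mem inverse_mem)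

lemma v_prod: "(\<And>i. i \<in> I \<Longrightarrow> c i \<in> K \<and> c i \<noteq> 0) \<Longrightarrow> v (prod c I) = (\<Sum>i\<in>I. v (c i))"
proof (induction I rule: infinite_finite_induct)
  case (insert i I)
  then have "v (c i * prod c I) = v (c i) + v (prod c I)"
    by (intro v_mult) auto
  then show ?case using insert by auto
qed auto

lemma v_ge_0 [simp]: "v_ge n 0"
  by (simp add: v_ge_def)

lemma v_ge_add: "\<lbrakk>h \<in> K; h' \<in> K; v_ge n h; v_ge n h'\<rbrakk> \<Longrightarrow> v_ge n (h + h')"
  using v_add[of h h'] by (cases "h = 0"; cases "h' = 0"; cases "h + h' = 0") (auto simp: v_ge_def)

lemma v_ge_minus: "h \<in> K \<Longrightarrow> v_ge n (- h) \<longleftrightarrow> v_ge n h"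
  by (auto simp: v_ge_def)

lemma v_ge_diff: "\<lbrakk>h \<in> K; h' \<in> K; v_ge n h; v_ge n h'\<rbrakk> \<Longrightarrow> v_ge n (h - h')"
  using v_ge_add[of h "- h'"] v_ge_minus[of h'] uminus_mem by auto

lemma v_ge_sum: "(\<And>i. i \<in> I \<Longrightarrow> c i \<in> K \<and> v_ge n (c i)) \<Longrightarrow> v_ge n (sum c I)"
  by (induction I rule: infinite_finite_induct) (auto intro!: v_ge_add)

lemma v_ge_mult: "\<lbrakk>h \<in> K; h' \<in> K; v_ge n h; v_ge m h'\<rbrakk> \<Longrightarrow> v_ge (n + m) (h * h')"
  by (cases "h = 0"; cases "h' = 0") (auto simp: v_ge_def v_mult)

lemma v_ge_mono: "v_ge n h \<Longrightarrow> m \<le> n \<Longrightarrow> v_ge m h"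
  by (auto simp: v_ge_def)

text \<open>Cancellation needs equal values. Below, two terms are often known to have different values
  because these have different parity.\<close>

lemma v_add_dominant:
  assumes "h \<in> K" "h' \<in> K" "h \<noteq> 0" "v_ge (v h + 1) h'"
  shows "h + h' \<noteq> 0" "v (h + h') = v h"
proof -
  have "h + h' \<noteq> 0 \<and> v (h + h') = v h"
  proof (cases "h' = 0")
    case False
    then have lt: "v h < v h'" using assms by (auto simp: v_ge_def)
    have nz: "h + h' \<noteq> 0"
    proof
      assume "h + h' = 0"
      then have "h' = - h" by (simp add: eq_neg_iff_add_eq_0 add.commute)
      then show False using lt assms by simp
    qed
    have "v h \<le> v (h + h')"
      using v_add[of h h'] assms False nz lt by auto
    moreover have "v (h + h') \<le> v h"
      using v_add[of "h + h'" "- h'"] assms False nz lt uminus_mem[of h'] add_mem[of h h'] by auto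
    ultimately show ?thesis using nz by auto
  qed (use assms in auto)
  then show "h + h' \<noteq> 0" "v (h + h') = v h" by auto
qed

end


section \<open>Valuations of the rational function field\<close>

text \<open>This is meant for maps \<open>w\<close> that turn products into sums; the value then does not depend on
  the choice of numerator and denominator.\<close>

definition fract_val :: "('b::field poly \<Rightarrow> int) \<Rightarrow> 'b poly fract \<Rightarrow> int" where
  "fract_val w r = (let (p, q) = (SOME (p, q). q \<noteq> 0 \<and> r = to_fract p / to_fract q) in w p - w q)"

lemma fract_as_quotient:
  fixes r :: "'b::field poly fract"
  obtains p q where "q \<noteq> 0" "r = to_fract p / to_fract q"
  by (cases r) (metis Fract_conv_to_fract)

lemma fract_val_quotient:
  assumes w_mult: "\<And>p q. p \<noteq> 0 \<Longrightarrow> q \<noteq> 0 \<Longrightarrow> w (p * q) = w p + w q"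
    and "p \<noteq> 0" "q \<noteq> 0"
  shows "fract_val w (to_fract p / to_fract q) = w p - w q"
proof -
  define r where "r = to_fract p / to_fract q"
  obtain p' q' where pq': "(SOME (p, q). q \<noteq> 0 \<and> r = to_fract p / to_fract q) = (p', q')"
    by (cases "SOME (p, q). q \<noteq> 0 \<and> r = to_fract p / to_fract q")
  have "\<exists>z. case z of (p, q) \<Rightarrow> q \<noteq> 0 \<and> r = to_fract p / to_fract q"
    using assms r_def by auto
  then have "case (p', q') of (p, q) \<Rightarrow> q \<noteq> 0 \<and> r = to_fract p / to_fract q"
    unfolding pq'[symmetric] by (rule someI_ex)
  then have q': "q' \<noteq> 0" "to_fract p / to_fract q = to_fract p' / to_fract q'"
    by (auto simp: r_def)
  then have "to_fract p * to_fract q' = to_fract p' * to_fract q"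
    using assms by (simp add: field_simps)
  then have eq: "p * q' = p' * q"
    by (metis to_fract_eq_iff to_fract_mult)
  then have "p' \<noteq> 0" using assms q' by auto
  then have "w p + w q' = w p' + w q"
    using eq assms q' by (metis w_mult)
  then show ?thesis
    unfolding fract_val_def r_def[symmetric] pq' by simp
qed

lemma fract_val_to_fract:
  assumes w_mult: "\<And>p q. p \<noteq> 0 \<Longrightarrow> q \<noteq> 0 \<Longrightarrow> w (p * q) = w p + w q" and "p \<noteq> 0"
  shows "fract_val w (to_fract p) = w p"
proof -
  have "w 1 = 0" using w_mult[of 1 1] by simp
  then show ?thesis using fract_val_quotient[of w p 1] assms by simp
qed

lemma valued_field_fract_val:
  fixes w :: "'b::field poly \<Rightarrow> int"
  assumes w_mult: "\<And>p q. p \<noteq> 0 \<Longrightarrow> q \<noteq> 0 \<Longrightarrow> w (p * q) = w p + w q"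
    and w_add: "\<And>p q. p \<noteq> 0 \<Longrightarrow> q \<noteq> 0 \<Longrightarrow> p + q \<noteq> 0 \<Longrightarrow> min (w p) (w q) \<le> w (p + q)"
  shows "valued_field UNIV (fract_val w)"
proof unfold_locales
  fix r s :: "'b poly fract"
  assume rs: "r \<noteq> 0" "s \<noteq> 0"
  obtain p q p' q' where q: "q \<noteq> 0" "r = to_fract p / to_fract q"
    and q': "q' \<noteq> 0" "s = to_fract p' / to_fract q'"
    by (metis fract_as_quotient)
  have p: "p \<noteq> 0" "p' \<noteq> 0" using rs q q' by auto
  have vr: "fract_val w r = w p - w q" "fract_val w s = w p' - w q'"
    using q q' p fract_val_quotient[of w] w_mult by auto
  have "r * s = to_fract (p * p') / to_fract (q * q')"
    using q q' by simp
  then show "fract_val w (r * s) = fract_val w r + fract_val w s"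
    using fract_val_quotient[of w "p * p'" "q * q'"] p q q' w_mult vr by simp
  assume "r + s \<noteq> 0"
  have rs': "r + s = to_fract (p * q' + p' * q) / to_fract (q * q')"
    using q q' by (simp add: field_simps)
  then have nz: "p * q' + p' * q \<noteq> 0" using \<open>r + s \<noteq> 0\<close> by (metis to_fract_0 div_0)
  have "fract_val w (r + s) = w (p * q' + p' * q) - (w q + w q')"
    unfolding rs' using fract_val_quotient[of w "p * q' + p' * q" "q * q'"] w_mult nz q q' by simp
  moreover have "min (w p + w q') (w p' + w q) \<le> w (p * q' + p' * q)"
    using w_add[of "p * q'" "p' * q"] nz p q q' w_mult by simp
  ultimately show "min (fract_val w r) (fract_val w s) \<le> fract_val w (r + s)"
    using vr by auto
qed auto

abbreviation ratc :: "'b::field \<Rightarrow> 'b poly fract" where "ratc c \<equiv> to_fract [:c:]"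

abbreviation lin :: "'b::field \<Rightarrow> 'b poly fract" where "lin a \<equiv> to_fract [:- a, 1:]"

definition ord_at :: "'b::field \<Rightarrow> 'b poly fract \<Rightarrow> int" where
  "ord_at a = fract_val (\<lambda>p. int (Polynomial.order a p))"

definition ord_inf :: "'b::field poly fract \<Rightarrow> int" where
  "ord_inf = fract_val (\<lambda>p. - int (degree p))"

lemma order_add_ge:
  fixes p q :: "'b::field poly"
  assumes "p \<noteq> 0" "q \<noteq> 0" "p + q \<noteq> 0"
  shows "min (Polynomial.order a p) (Polynomial.order a q) \<le> Polynomial.order a (p + q)"
proof -
  let ?m = "min (Polynomial.order a p) (Polynomial.order a q)"
  have "[:- a, 1:] ^ ?m dvd p" "[:- a, 1:] ^ ?m dvd q"
    using assms by (meson order_1 min.cobounded1 min.cobounded2 power_le_dvd)+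
  then have "[:- a, 1:] ^ ?m dvd p + q" by simp
  then show ?thesis using assms order_divides by blast
qed

lemma valued_field_ord_at: "valued_field UNIV (ord_at a)"
  unfolding ord_at_def
proof (rule valued_field_fract_val)
  fix p q :: "'a poly"
  assume "p \<noteq> 0" "q \<noteq> 0" "p + q \<noteq> 0"
  then show "min (int (Polynomial.order a p)) (int (Polynomial.order a q))
      \<le> int (Polynomial.order a (p + q))"
    using order_add_ge[of p q a] by linarith
qed (simp add: order_mult)

lemma valued_field_ord_inf: "valued_field UNIV ord_inf"
  unfolding ord_inf_def
proof (rule valued_field_fract_val)
  fix p q :: "'a poly"
  show "min (- int (degree p)) (- int (degree q))
      \<le> - int (degree (p + q))"
    using degree_add_le_max[of p q] by linarith
qed (simp add: degree_mult_eq)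

interpretation ord_at: valued_field UNIV "ord_at a"
  by (rule valued_field_ord_at)

interpretation ord_inf: valued_field UNIV ord_inf
  by (rule valued_field_ord_inf)

lemma ord_at_to_fract: "p \<noteq> 0 \<Longrightarrow> ord_at a (to_fract p) = int (Polynomial.order a p)"
  unfolding ord_at_def by (rule fract_val_to_fract) (auto simp: order_mult)

lemma ord_inf_to_fract: "p \<noteq> 0 \<Longrightarrow> ord_inf (to_fract p) = - int (degree p)"
  unfolding ord_inf_def by (rule fract_val_to_fract) (auto simp: degree_mult_eq)

lemma ord_at_ratc [simp]: "c \<noteq> 0 \<Longrightarrow> ord_at a (ratc c) = 0"
  by (simp add: ord_at_to_fract order_0I)

lemma ord_inf_ratc [simp]: "c \<noteq> 0 \<Longrightarrow> ord_inf (ratc c) = 0"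
  by (simp add: ord_inf_to_fract)

lemma ord_at_lin [simp]: "ord_at a (lin b) = (if a = b then 1 else 0)"
  using order_power_n_n[of a 1] by (auto simp: ord_at_to_fract order_0I)

lemma ord_inf_lin [simp]: "ord_inf (lin b) = - 1"
  by (simp add: ord_inf_to_fract)

lemma ord_inf_X [simp]: "ord_inf (to_fract [:0, 1:]) = - 1"
  using ord_inf_lin[of 0] by simp

lemma ratc_2: "ratc 2 = (2 :: 'b::field poly fract)"
proof -
  have "ratc (1 + 1) = ratc 1 + (ratc 1 :: 'b poly fract)" by (simp flip: to_fract_add)
  then show ?thesis by (simp add: pCons_one)
qed

lemma poly_linear_induct [consumes 1, case_names const lin]:
  fixes p :: "'b::alg_closed_field poly"
  assumes "p \<noteq> 0"
    and const: "\<And>c. c \<noteq> 0 \<Longrightarrow> P [:c:]"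
    and lin: "\<And>a p. p \<noteq> 0 \<Longrightarrow> P p \<Longrightarrow> P ([:- a, 1:] * p)"
  shows "P p"
  using assms(1)
proof (induction "degree p" arbitrary: p)
  case 0
  then obtain c where "p = [:c:]" by (metis degree_eq_zeroE)
  then show ?case using const 0 by auto
next
  case (Suc n)
  obtain a where "poly p a = 0" using alg_closed_imp_poly_has_root[of p] Suc by auto
  then obtain q where q: "p = [:- a, 1:] * q" by (metis poly_eq_0_iff_dvd dvdE)
  then have "q \<noteq> 0" using Suc by auto
  moreover have "degree q = n" using Suc.hyps(2) \<open>q \<noteq> 0\<close> unfolding q
    by (subst (asm) degree_mult_eq) auto
  ultimately show ?case using Suc.hyps(1) lin q by auto
qed

text \<open>Constants and linear polynomials generate the multiplicative group, so a multiplicative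
  statement about rational functions has to be checked on them only.\<close>

lemma fract_linear_induct [consumes 1, case_names const lin mult inverse]:
  fixes r :: "'b::alg_closed_field poly fract"
  assumes "r \<noteq> 0"
    and const: "\<And>c. c \<noteq> 0 \<Longrightarrow> P (ratc c)"
    and lin: "\<And>a. P (lin a)"
    and mult: "\<And>r s. r \<noteq> 0 \<Longrightarrow> s \<noteq> 0 \<Longrightarrow> P r \<Longrightarrow> P s \<Longrightarrow> P (r * s)"
    and inv: "\<And>r. r \<noteq> 0 \<Longrightarrow> P r \<Longrightarrow> P (inverse r)"
  shows "P r"
proof -
  have poly: "P (to_fract p)" if "p \<noteq> 0" for p
    using that
  proof (induction p rule: poly_linear_induct)
    case (lin a p)
    then have "P (lin a * to_fract p)"
      by (intro mult assms(3)) auto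
    then show ?case by (simp only: to_fract_mult)
  qed (rule const)
  obtain p q where q: "q \<noteq> 0" "r = to_fract p / to_fract q" by (metis fract_as_quotient)
  then have "p \<noteq> 0" using assms(1) by auto
  then show ?thesis
    using mult[of "to_fract p" "inverse (to_fract q)"] inv[of "to_fract q"] poly q
    by (simp add: field_class.field_divide_inverse)
qed

lemma valued_field_fract_eqI:
  fixes v v' :: "'b::alg_closed_field poly fract \<Rightarrow> int"
  assumes "valued_field UNIV v" "valued_field UNIV v'"
    and "\<And>a. a \<noteq> 0 \<Longrightarrow> v (ratc a) = 0" "\<And>a. a \<noteq> 0 \<Longrightarrow> v' (ratc a) = 0"
    and "\<And>b. v (lin b) = c * v' (lin b)" and "r \<noteq> 0"
  shows "v r = c * v' r"
proof -
  interpret v: valued_field UNIV v by fact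
  interpret v': valued_field UNIV v' by fact
  show ?thesis using \<open>r \<noteq> 0\<close>
    by (induction r rule: fract_linear_induct)
      (simp_all add: assms v.v_mult v'.v_mult v.v_inverse v'.v_inverse algebra_simps)
qed

lemma fract_val_at_finite:
  fixes v :: "'b::alg_closed_field poly fract \<Rightarrow> int"
  assumes "valued_field UNIV v" and const: "\<And>a. a \<noteq> 0 \<Longrightarrow> v (ratc a) = 0"
    and pos: "v (lin a) > 0" and "r \<noteq> 0"
  shows "v r = v (lin a) * ord_at a r"
proof -
  interpret v: valued_field UNIV v by fact
  have "v (lin b) = 0" if "b \<noteq> a" for b
  proof -
    have "v (ratc (a - b) + lin a) = v (ratc (a - b))"
      by (rule v.v_add_dominant) (use that const pos in \<open>auto simp: v.v_ge_def\<close>)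
    moreover have "ratc (a - b) + lin a = lin b"
      by (simp flip: to_fract_add)
    ultimately show ?thesis using const that by simp
  qed
  then show ?thesis
    by (intro valued_field_fract_eqI[OF \<open>valued_field UNIV v\<close> valued_field_ord_at const _ _ \<open>r \<noteq> 0\<close>]) auto
qed

lemma fract_val_at_infinity:
  fixes v :: "'b::alg_closed_field poly fract \<Rightarrow> int"
  assumes "valued_field UNIV v" and const: "\<And>a. a \<noteq> 0 \<Longrightarrow> v (ratc a) = 0"
    and neg: "v (lin 0) < 0" and "r \<noteq> 0"
  shows "v r = - v (lin 0) * ord_inf r"
proof -
  interpret v: valued_field UNIV v by fact
  have "v (lin b) = v (lin 0)" for b
  proof (cases "b = 0")
    case False
    have "v (lin 0 + ratc (- b)) = v (lin 0)"
      by (rule v.v_add_dominant) (use False const[of "- b"] neg in \<open>auto simp: v.v_ge_def\<close>)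
    moreover have "lin 0 + ratc (- b) = lin b"
      by (simp flip: to_fract_add)
    ultimately show ?thesis by simp
  qed simp
  then show ?thesis
    by (intro valued_field_fract_eqI[OF \<open>valued_field UNIV v\<close> valued_field_ord_inf const _ _ \<open>r \<noteq> 0\<close>]) auto
qed

text \<open>Without finite poles the linear factors of the denominator cancel one after the other; a
  polynomial without a pole at infinity is constant.\<close>

lemma fract_const_if_ord_nonneg:
  fixes r :: "'b::alg_closed_field poly fract"
  assumes "\<And>a. ord_at.v_ge a 0 r" and "ord_inf.v_ge 0 r"
  shows "\<exists>c. r = ratc c"
proof (cases "r = 0")
  case True
  then have "r = ratc 0" by simp
  then show ?thesis by blast
next
  case False
  have *: "\<exists>p. s = to_fract p" if "q \<noteq> 0" "s * to_fract q = to_fract p" "\<And>a. ord_at a s \<ge> 0" "s \<noteq> 0"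
    for s :: "'b poly fract" and p q
    using that
  proof (induction q arbitrary: p rule: poly_linear_induct)
    case (const c)
    have "ratc c * ratc (inverse c) = 1"
      using const by (simp add: pCons_one flip: to_fract_mult)
    then have "s = (s * ratc c) * ratc (inverse c)" by (simp add: mult.assoc)
    also have "\<dots> = to_fract (p * [:inverse c:])"
      unfolding const(2) by (simp only: to_fract_mult)
    finally have "s = to_fract (p * [:inverse c:])" .
    then show ?case by blast
  next
    case (lin a q)
    have split: "to_fract p = s * (to_fract [:- a, 1:] * to_fract q)"
      using lin(3) by (simp only: to_fract_mult)
    also have "\<dots> \<noteq> 0" using lin by simp
    finally have "p \<noteq> 0" by simp
    have "ord_at a (to_fract p) = ord_at a s + (1 + ord_at a (to_fract q))"
      unfolding split using lin by (simp add: ord_at.v_mult)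
    moreover have "ord_at a (to_fract q) \<ge> 0" "ord_at a s \<ge> 0" using lin by (auto simp: ord_at_to_fract)
    ultimately have "ord_at a (to_fract p) > 0" by linarith
    then have "poly p a = 0" using \<open>p \<noteq> 0\<close> by (simp add: ord_at_to_fract order_root)
    then obtain p' where p': "p = [:- a, 1:] * p'" by (metis poly_eq_0_iff_dvd dvdE)
    have "to_fract [:- a, 1:] * (s * to_fract q) = to_fract [:- a, 1:] * to_fract p'"
      using split unfolding p' to_fract_mult by (simp only: ac_simps)
    then have "s * to_fract q = to_fract p'" by simp
    then show ?case using lin by blast
  qed
  obtain p q where q: "q \<noteq> 0" "r = to_fract p / to_fract q" by (metis fract_as_quotient)
  then obtain p' where p': "r = to_fract p'"
    using *[of q r p] assms(1) False by (auto simp: ord_at.v_ge_def)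
  then have "degree p' = 0"
    using assms(2) False by (auto simp: ord_inf_to_fract ord_inf.v_ge_def)
  then show ?thesis using p' by (metis degree_eq_zeroE)
qed

lemma poly_square_if_even_orders:
  fixes p :: "'b::alg_closed_field poly"
  assumes "\<And>a. even (Polynomial.order a p)"
  shows "\<exists>q. p = q ^ 2"
proof (cases "p = 0")
  case False
  then show ?thesis using assms
  proof (induction "degree p" arbitrary: p rule: less_induct)
    case less
    show ?case
    proof (cases "degree p = 0")
      case True
      then obtain c where c: "p = [:c:]" by (metis degree_eq_zeroE)
      obtain d where "d ^ 2 = c" using nth_root_exists[of 2 c] by auto
      then have "p = [:d:] ^ 2" using c by (simp add: power2_eq_square)
      then show ?thesis by blast
    next
      case False
      then obtain a where a: "poly p a = 0" using alg_closed_imp_poly_has_root[of p] by auto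
      let ?l = "[:- a, 1:]"
      have "2 \<le> Polynomial.order a p" using a less(2) less(3)[of a] order_root[of p a]
        by (auto elim!: evenE)
      then have "?l ^ 2 dvd p" using order_1 power_le_dvd by blast
      then obtain q where q: "p = ?l ^ 2 * q" by (elim dvdE)
      then have nz: "q \<noteq> 0" using less by auto
      have "even (Polynomial.order b q)" for b
      proof -
        have "Polynomial.order b p = Polynomial.order b (?l ^ 2) + Polynomial.order b q"
          unfolding q by (rule order_mult) (use nz in auto)
        moreover have "Polynomial.order b (?l ^ 2) = Polynomial.order b ?l + Polynomial.order b ?l"
          unfolding power2_eq_square by (rule order_mult) auto
        ultimately show ?thesis using less(3)[of b] by presburger
      qed
      moreover have "degree q < degree p"
        unfolding q using nz by (subst degree_mult_eq) (auto simp: degree_power_eq)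
      ultimately obtain s where "q = s ^ 2" using less(1) nz by blast
      then have "p = (?l * s) ^ 2" unfolding q by (simp only: power_mult_distrib)
      then show ?thesis by blast
    qed
  qed
qed (rule exI[of _ 0], simp)

text \<open>Up to the square \<open>q\<^sup>2\<close>, the quotient \<open>p / q\<close> is the polynomial \<open>p q\<close>.\<close>

lemma fract_square_if_even_orders:
  fixes r :: "'b::alg_closed_field poly fract"
  assumes "\<And>a. even (ord_at a r)" "r \<noteq> 0"
  shows "\<exists>s. r = s ^ 2"
proof -
  obtain p q where q: "q \<noteq> 0" "r = to_fract p / to_fract q" by (metis fract_as_quotient)
  then have p: "p \<noteq> 0" using assms by auto
  have "even (Polynomial.order a (p * q))" for a
  proof -
    have "ord_at a r = int (Polynomial.order a p) - int (Polynomial.order a q)"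
      using p q by (simp add: ord_at.v_divide ord_at_to_fract)
    then have "even (int (Polynomial.order a p) - int (Polynomial.order a q))"
      using assms(1)[of a] by simp
    then show ?thesis using p q by (simp add: order_mult)
  qed
  then obtain s where s: "p * q = s ^ 2" using poly_square_if_even_orders by blast
  have "r = to_fract (p * q) / to_fract q ^ 2" using q by (simp add: power2_eq_square)
  also have "\<dots> = (to_fract s / to_fract q) ^ 2" unfolding s by (simp add: power2_eq_square)
  finally show ?thesis by blast
qed

section \<open>The function field as a quadratic extension\<close>

lemma to_fract_power: "to_fract (p ^ n) = to_fract p ^ n"
  by (induction n) auto

lemma sum_const_gen_x:
  fixes p :: "'b::field poly"
  assumes "degree p \<le> n"
  shows "(\<Sum>i\<le>n. const (coeff p i) * gen_x ^ i) = to_ac (to_fract p)"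
proof -
  have "to_ac (to_fract p) = to_ac (to_fract (\<Sum>i\<le>n. Polynomial.monom (coeff p i) i))"
    using assms by (simp add: poly_as_sum_of_monoms')
  also have "\<dots> = (\<Sum>i\<le>n. to_ac (to_fract ([:coeff p i:] * [:0, 1:] ^ i)))"
    by (simp add: to_ac_sum monom_altdef)
  also have "\<dots> = (\<Sum>i\<le>n. const (coeff p i) * gen_x ^ i)"
    by (simp only: to_fract_mult to_fract_power to_ac_mult to_ac_power const_def gen_x_def)
  finally show ?thesis by simp
qed

lemma const_add: "const (a + b) = const a + const b"
  by (simp add: const_def flip: to_ac_add to_fract_add)

lemma const_mult: "const (a * b) = const a * const b"
  by (simp add: const_def flip: to_ac_mult to_fract_mult)

lemma const_0 [simp]: "const 0 = 0" and const_1 [simp]: "const 1 = 1"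
  by (simp_all add: const_def pCons_one)

lemma const_eq_0_iff [simp]: "const a = 0 \<longleftrightarrow> a = 0"
  by (simp add: const_def)

lemma form_affine: "form d c (u, v, 1) = (\<Sum>i\<le>d. \<Sum>j\<le>d-i. c i j * u ^ i * v ^ j)"
  by (simp add: form_def)

text \<open>The curve over the algebraic closure. That the roots are simple comes from the irreducibility of
  the polynomial over a perfect field.\<close>

locale odd_hyperelliptic =
  fixes f :: "'b::alg_closed_field poly"
  assumes two_neq_zero: "(2 :: 'b) \<noteq> 0"
    and degree_odd: "odd (degree f)"
    and degree_ge: "degree f \<ge> 3"
    and monic: "lead_coeff f = 1"
    and simple_roots: "poly f a = 0 \<Longrightarrow> Polynomial.order a f = 1"
begin

lemma f_neq_0 [simp]: "f \<noteq> 0"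
  using monic by auto

abbreviation F :: "'b poly fract" where "F \<equiv> to_fract f"

abbreviation y :: "'b ambient" where "y \<equiv> gen_y f"

lemma ord_inf_F: "ord_inf F = - int (degree f)"
  by (simp add: ord_inf_to_fract)

lemma ord_at_F: "ord_at a F = (if poly f a = 0 then 1 else 0)"
  using simple_roots[of a] order_root[of f a] by (auto simp: ord_at_to_fract)

text \<open>An ambient element satisfies the affine equation iff its square is \<open>f(x)\<close>; a root exists because
  the ambient field is algebraically closed.\<close>

lemma y_square: "y ^ 2 = to_ac F"
proof -
  have deg: "degree (map_poly const f) = degree f"
    using const_eq_0_iff monic by (intro degree_map_poly) auto
  have "plane_eq (map_poly const f) (gen_x, z, 1) \<longleftrightarrow> z ^ 2 = to_ac F" for z
    using sum_const_gen_x[of f "degree f"]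
    unfolding plane_eq_def deg by (simp add: coeff_map_poly)
  moreover have "\<exists>z. z ^ 2 = to_ac F" using nth_root_exists[of 2 "to_ac F"] by auto
  ultimately have "\<exists>z. plane_eq (map_poly const f) (gen_x, z, 1)" by blast
  then have "plane_eq (map_poly const f) (gen_x, y, 1)"
    unfolding gen_y_def by (rule someI_ex)
  then show ?thesis
    using \<open>\<And>z. plane_eq (map_poly const f) (gen_x, z, 1) \<longleftrightarrow> z ^ 2 = to_ac F\<close> by blast
qed

definition el :: "'b poly fract \<Rightarrow> 'b poly fract \<Rightarrow> 'b ambient" where
  "el A B = to_ac A + to_ac B * y"

definition K :: "'b ambient set" where
  "K = {el A B |A B. True}"

text \<open>The degree of \<open>f\<close> is odd, so \<open>f\<close> is not a square in the rational function field.\<close>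

lemma nonsquare: "A ^ 2 = B ^ 2 * F \<longleftrightarrow> A = 0 \<and> B = 0"
proof
  assume eq: "A ^ 2 = B ^ 2 * F"
  show "A = 0 \<and> B = 0"
  proof (rule ccontr)
    assume "\<not> (A = 0 \<and> B = 0)"
    then have "A \<noteq> 0" "B \<noteq> 0" using eq by auto
    then have "2 * ord_inf A = 2 * ord_inf B - int (degree f)"
      using arg_cong[OF eq, of ord_inf]
      by (simp add: ord_inf.v_mult ord_inf.v_power ord_inf_F)
    then have "even (int (degree f))" by presburger
    then show False using degree_odd by simp
  qed
qed auto

lemma norm_form_eq_0_iff: "A ^ 2 - B ^ 2 * F = 0 \<longleftrightarrow> A = 0 \<and> B = 0"
  using nonsquare[of A B] by auto

lemma el_mem [simp, intro]: "el A B \<in> K"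
  by (auto simp: K_def)

lemma K_cases [consumes 1, case_names el]:
  assumes "h \<in> K" obtains A B where "h = el A B"
  using assms by (auto simp: K_def)

lemma el_add: "el A B + el C D = el (A + C) (B + D)"
  by (simp add: el_def algebra_simps)

lemma el_diff: "el A B - el C D = el (A - C) (B - D)"
  by (simp add: el_def algebra_simps)

lemma el_mult: "el A B * el C D = el (A * C + B * D * F) (A * D + B * C)"
proof -
  have "el A B * el C D
      = to_ac A * to_ac C + to_ac B * to_ac D * y ^ 2 + (to_ac A * to_ac D + to_ac B * to_ac C) * y"
    by (simp add: el_def algebra_simps power2_eq_square)
  then show ?thesis by (simp add: y_square el_def)
qed

lemma to_ac_el: "to_ac A = el A 0"
  by (simp add: el_def)

lemma y_el: "y = el 0 1"
  by (simp add: el_def)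

lemma const_el: "const c = el (ratc c) 0"
  by (simp add: el_def const_def)

lemma to_ac_mem [simp, intro]: "to_ac A \<in> K"
  by (simp add: to_ac_el)

lemma y_mem [simp, intro]: "y \<in> K"
  by (subst y_el) blast

lemma const_mem [simp, intro]: "const c \<in> K"
  by (simp add: const_def)

lemma y_neq_0 [simp]: "y \<noteq> 0"
  using y_square by auto

lemma el_conj_mult: "el A B * el A (- B) = to_ac (A ^ 2 - B ^ 2 * F)"
  by (simp add: el_mult to_ac_el power2_eq_square)

lemma el_eq_0_iff [simp]: "el A B = 0 \<longleftrightarrow> A = 0 \<and> B = 0"
proof
  assume "el A B = 0"
  then have "to_ac (A ^ 2 - B ^ 2 * F) = 0" by (subst el_conj_mult[symmetric]) simp
  then show "A = 0 \<and> B = 0" using norm_form_eq_0_iff[of A B] by (simp only: to_ac_eq_0_iff)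
qed (simp add: el_def)

lemma el_eq_iff [simp]: "el A B = el C D \<longleftrightarrow> A = C \<and> B = D"
  using el_eq_0_iff[of "A - C" "B - D"] by (simp flip: el_diff)

lemma field_subset_K: "field_subset K"
proof
  show "1 \<in> K" using to_ac_mem[of 1] by simp
  show "inverse h \<in> K" if h: "h \<in> K" for h
  proof (cases "h = 0")
    case False
    obtain A B where AB: "h = el A B" using h by (cases rule: K_cases)
    define N where "N = A ^ 2 - B ^ 2 * F"
    have "N \<noteq> 0" unfolding N_def using False AB norm_form_eq_0_iff by auto
    have "h * (el A (- B) * to_ac (inverse N)) = to_ac N * to_ac (inverse N)"
      unfolding AB N_def by (simp only: mult.assoc[symmetric] el_conj_mult)
    also have "\<dots> = 1" using \<open>N \<noteq> 0\<close> by simp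
    finally have "inverse h = el A (- B) * to_ac (inverse N)" by (rule inverse_unique)
    then show ?thesis by (auto simp: el_mult to_ac_el simp del: to_ac_inverse)
  qed (use to_ac_mem[of 0] in simp)
qed (auto simp: el_diff el_mult elim!: K_cases)

sublocale K: field_subset K
  by (rule field_subset_K)


subsection \<open>The hyperelliptic involution\<close>

definition coords :: "'b ambient \<Rightarrow> 'b poly fract \<times> 'b poly fract" where
  "coords h = (THE (A, B). h = el A B)"

lemma coords_el [simp]: "coords (el A B) = (A, B)"
  by (auto simp: coords_def)

text \<open>Outside the function field the involution is the identity, so that composing a valuation
  with it keeps the value \<open>0\<close> there.\<close>

definition conj :: "'b ambient \<Rightarrow> 'b ambient" where
  "conj h = (if h \<in> K then el (fst (coords h)) (- snd (coords h)) else h)"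

definition norm :: "'b ambient \<Rightarrow> 'b poly fract" where
  "norm h = fst (coords h) ^ 2 - snd (coords h) ^ 2 * F"

lemma conj_el [simp]: "conj (el A B) = el A (- B)"
  by (simp add: conj_def)

lemma conj_to_ac [simp]: "conj (to_ac A) = to_ac A"
  by (simp add: to_ac_el)

lemma conj_0 [simp]: "conj 0 = 0" and conj_1 [simp]: "conj 1 = 1"
  using conj_to_ac[of 0] conj_to_ac[of 1] by simp_all

lemma conj_const [simp]: "conj (const c) = const c"
  by (simp add: const_def)

lemma conj_y [simp]: "conj y = - y"
  using conj_el[of 0 1] by (simp add: el_def)

lemma norm_el [simp]: "norm (el A B) = A ^ 2 - B ^ 2 * F"
  by (simp add: norm_def)

lemma conj_conj [simp]: "conj (conj h) = h"
  by (cases "h \<in> K") (auto simp: conj_def elim!: K_cases)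

lemma conj_mem_iff [simp]: "conj h \<in> K \<longleftrightarrow> h \<in> K"
  by (auto simp: conj_def)

lemma conj_eq_0_iff [simp]: "conj h = 0 \<longleftrightarrow> h = 0"
  by (metis conj_0 conj_conj)

lemma conj_mult: "h \<in> K \<Longrightarrow> h' \<in> K \<Longrightarrow> conj (h * h') = conj h * conj h'"
  by (auto simp: el_mult elim!: K_cases)

lemma conj_add: "h \<in> K \<Longrightarrow> h' \<in> K \<Longrightarrow> conj (h + h') = conj h + conj h'"
  by (auto simp: el_add elim!: K_cases)

lemma conj_diff: "h \<in> K \<Longrightarrow> h' \<in> K \<Longrightarrow> conj (h - h') = conj h - conj h'"
  by (auto simp: el_diff elim!: K_cases)

lemma mult_conj: "h \<in> K \<Longrightarrow> h * conj h = to_ac (norm h)"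
  by (auto simp: el_conj_mult elim!: K_cases simp del: to_ac_diff to_ac_mult to_ac_power)

lemma norm_eq_0_iff [simp]: "h \<in> K \<Longrightarrow> norm h = 0 \<longleftrightarrow> h = 0"
  by (auto simp: norm_form_eq_0_iff elim!: K_cases simp del: right_minus_eq)

lemma norm_mult: "h \<in> K \<Longrightarrow> h' \<in> K \<Longrightarrow> norm (h * h') = norm h * norm h'"
proof -
  assume h: "h \<in> K" "h' \<in> K"
  have "to_ac (norm (h * h')) = (h * conj h) * (h' * conj h')"
    using h by (simp add: conj_mult K.mult_mem ac_simps flip: mult_conj)
  then show ?thesis using h by (metis mult_conj to_ac_eq_iff to_ac_mult)
qed


subsection \<open>Forms on the curve\<close>

abbreviation pel :: "'b poly \<Rightarrow> 'b poly \<Rightarrow> 'b ambient" where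
  "pel P Q \<equiv> el (to_fract P) (to_fract Q)"

definition ev :: "'b \<Rightarrow> 'b \<Rightarrow> 'b poly \<Rightarrow> 'b poly \<Rightarrow> 'b" where
  "ev a b P Q = poly P a + poly Q a * b"

text \<open>Reduction modulo \<open>y\<^sup>2 = f(x)\<close> turns polynomials in \<open>x\<close> and \<open>y\<close> into \<open>P(x) + Q(x) y\<close>. The
  predicate says that such a reduction exists, with coefficients in \<open>k\<close>, for an element \<open>z\<close> of the
  function field that takes the values \<open>\<phi>\<close> at the affine points of the curve.\<close>

definition reducible_over :: "'b set \<Rightarrow> 'b ambient \<Rightarrow> ('b \<Rightarrow> 'b \<Rightarrow> 'b) \<Rightarrow> bool" where
  "reducible_over k z \<phi> \<longleftrightarrow> (\<exists>P Q. (\<forall>i. coeff P i \<in> k \<and> coeff Q i \<in> k) \<and>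
     z = pel P Q \<and> (\<forall>a b. b ^ 2 = poly f a \<longrightarrow> \<phi> a b = ev a b P Q))"

lemma reducible_overI:
  assumes "\<And>i. coeff P i \<in> k" "\<And>i. coeff Q i \<in> k" "z = pel P Q"
    and "\<And>a b. b ^ 2 = poly f a \<Longrightarrow> \<phi> a b = ev a b P Q"
  shows "reducible_over k z \<phi>"
  using assms unfolding reducible_over_def by blast

lemma reducible_overE:
  assumes "reducible_over k z \<phi>"
  obtains P Q where "\<And>i. coeff P i \<in> k" "\<And>i. coeff Q i \<in> k" "z = pel P Q"
    "\<And>a b. b ^ 2 = poly f a \<Longrightarrow> \<phi> a b = ev a b P Q"
proof -
  from assms obtain P Q where "(\<forall>i. coeff P i \<in> k \<and> coeff Q i \<in> k) \<and>
     z = pel P Q \<and> (\<forall>a b. b ^ 2 = poly f a \<longrightarrow> \<phi> a b = ev a b P Q)"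
    unfolding reducible_over_def by (elim exE)
  then show thesis by (intro that) auto
qed

lemma form_reduce:
  assumes k: "field_subset k" and fk: "\<And>i. coeff f i \<in> k"
    and G: "\<And>i j. G i j \<in> k"
  shows "reducible_over k (form_gen f d G) (\<lambda>a b. form d G (a, b, 1))"
proof -
  interpret k: field_subset k by fact
  let ?R = "reducible_over k"
  have const: "?R (const c) (\<lambda>a b. c)" if "c \<in> k" for c
    by (rule reducible_overI[of "[:c:]" _ 0])
      (use that in \<open>auto simp: coeff_pCons ev_def const_el split: nat.split\<close>)
  have x: "?R gen_x (\<lambda>a b. a)"
    by (rule reducible_overI[of "[:0, 1:]" _ 0])
      (auto simp: coeff_pCons ev_def gen_x_def to_ac_el split: nat.split)
  have y: "?R y (\<lambda>a b. b)"
    by (rule reducible_overI[of 0 _ 1])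
      (auto simp: ev_def y_el coeff_1)
  have add: "?R (z + z') (\<lambda>a b. \<phi> a b + \<phi>' a b)" if r: "?R z \<phi>" "?R z' \<phi>'" for z z' \<phi> \<phi>'
  proof -
    obtain P Q where PQ: "\<And>i. coeff P i \<in> k" "\<And>i. coeff Q i \<in> k" "z = pel P Q"
      "\<And>a b. b ^ 2 = poly f a \<Longrightarrow> \<phi> a b = ev a b P Q"
      by (rule reducible_overE[OF r(1)]) (rule that)
    obtain S T where ST: "\<And>i. coeff S i \<in> k" "\<And>i. coeff T i \<in> k" "z' = pel S T"
      "\<And>a b. b ^ 2 = poly f a \<Longrightarrow> \<phi>' a b = ev a b S T"
      by (rule reducible_overE[OF r(2)]) (rule that)
    show ?thesis
      by (rule reducible_overI[of "P + S" _ "Q + T"])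
        (use PQ ST in \<open>auto simp: el_add ev_def algebra_simps\<close>)
  qed
  have mult: "?R (z * z') (\<lambda>a b. \<phi> a b * \<phi>' a b)" if r: "?R z \<phi>" "?R z' \<phi>'" for z z' \<phi> \<phi>'
  proof -
    obtain P Q where PQ: "\<And>i. coeff P i \<in> k" "\<And>i. coeff Q i \<in> k" "z = pel P Q"
      "\<And>a b. b ^ 2 = poly f a \<Longrightarrow> \<phi> a b = ev a b P Q"
      by (rule reducible_overE[OF r(1)]) (rule that)
    obtain S T where ST: "\<And>i. coeff S i \<in> k" "\<And>i. coeff T i \<in> k" "z' = pel S T"
      "\<And>a b. b ^ 2 = poly f a \<Longrightarrow> \<phi>' a b = ev a b S T"
      by (rule reducible_overE[OF r(2)]) (rule that)
    have prod: "coeff (U * V) i \<in> k"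
      if "\<And>i. coeff U i \<in> k" "\<And>i. coeff V i \<in> k" for U V i
      using that by (auto simp: coeff_mult)
    show ?thesis
    proof (rule reducible_overI[of "P * S + Q * T * f" _ "P * T + Q * S"])
      show "coeff (P * S + Q * T * f) i \<in> k" for i
        using prod PQ ST fk by (auto simp del: coeff_mult)
      show "coeff (P * T + Q * S) i \<in> k" for i
        using prod PQ ST fk by auto
      show "z * z' = pel (P * S + Q * T * f) (P * T + Q * S)"
        using PQ(3) ST(3) by (simp add: el_mult)
      fix a b assume b: "b ^ 2 = poly f a"
      have "\<phi> a b * \<phi>' a b = poly P a * poly S a + poly Q a * poly T a * b ^ 2
          + (poly P a * poly T a + poly Q a * poly S a) * b"
        using PQ(4)[OF b] ST(4)[OF b] by (simp add: ev_def algebra_simps power2_eq_square)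
      then show "\<phi> a b * \<phi>' a b = ev a b (P * S + Q * T * f) (P * T + Q * S)"
        unfolding b by (simp add: ev_def)
    qed
  qed
  have power: "?R (z ^ n) (\<lambda>a b. \<phi> a b ^ n)" if "?R z \<phi>" for z \<phi> n
  proof (induction n)
    case 0 show ?case using const[of 1] by simp
  next
    case (Suc n) then show ?case using mult[OF that] by simp
  qed
  have sum: "?R (\<Sum>i\<in>I. z i) (\<lambda>a b. \<Sum>i\<in>I. \<phi> i a b)"
    if "finite I" "\<And>i. i \<in> I \<Longrightarrow> ?R (z i) (\<phi> i)" for I :: "nat set" and z \<phi>
    using that
  proof (induction I rule: finite_induct)
    case empty show ?case using const[of 0] by simp
  next
    case (insert i I) then show ?case using add[of "z i" "\<phi> i"] by simp
  qed
  show ?thesis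
    unfolding form_gen_def form_affine
    by (intro sum mult power x y const G) auto
qed

lemma sum_two_columns:
  fixes \<psi> :: "'a::zero \<Rightarrow> 'r::comm_ring_1" and c c' :: "nat \<Rightarrow> 'a"
  assumes "i \<le> d" "\<psi> 0 = 0" "c' d = 0"
  shows "(\<Sum>j\<le>d-i. \<psi> (if j = 0 then c i else if j = 1 then c' i else 0) * u ^ i * v ^ j)
    = \<psi> (c i) * u ^ i + \<psi> (c' i) * u ^ i * v"
proof (cases "i = d")
  case True then show ?thesis using assms by simp
next
  case False
  let ?t = "\<lambda>j. \<psi> (if j = 0 then c i else if j = 1 then c' i else 0) * u ^ i * v ^ j"
  have "{0, 1} \<subseteq> {..d-i}" using False assms by auto
  then have "(\<Sum>j\<le>d-i. ?t j) = (\<Sum>j\<in>{0, 1}. ?t j)"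
    by (intro sum.mono_neutral_right) (auto simp: assms)
  then show ?thesis by simp
qed

lemma form_of_pel:
  assumes d: "degree P < d" "degree Q < d"
  obtains G where "form_gen f d G = pel P Q" "\<And>a b. form d G (a, b, 1) = ev a b P Q"
proof -
  define G :: "nat \<Rightarrow> nat \<Rightarrow> 'b" where
    "G = (\<lambda>i j. if j = 0 then coeff P i else if j = 1 then coeff Q i else 0)"
  have Qd: "coeff Q d = 0" by (intro coeff_eq_0 d)
  have "form_gen f d G = (\<Sum>i\<le>d. const (coeff P i) * gen_x ^ i
      + const (coeff Q i) * gen_x ^ i * y)"
    unfolding form_gen_def form_affine G_def
    by (intro sum.cong refl sum_two_columns) (use Qd in auto)
  also have "\<dots> = pel P Q"
    using d by (simp add: sum.distrib el_def sum_const_gen_x flip: sum_distrib_right)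
  finally have 1: "form_gen f d G = pel P Q" .
  have "form d G (a, b, 1) = ev a b P Q" for a b
  proof -
    have "form d G (a, b, 1) = (\<Sum>i\<le>d. coeff P i * a ^ i + coeff Q i * a ^ i * b)"
      unfolding form_affine G_def
      by (intro sum.cong refl sum_two_columns[where \<psi> = "\<lambda>x. x"]) (use Qd in auto)
    moreover have "(\<Sum>i\<le>d. coeff U i * a ^ i) = poly U a"
      if "degree U < d" for U
      using arg_cong[OF poly_as_sum_of_monoms'[of U d], of "\<lambda>p. poly p a"] that
      by (simp add: poly_sum poly_monom)
    ultimately show ?thesis using d by (simp add: sum.distrib ev_def flip: sum_distrib_right)
  qed
  with 1 show ?thesis by (rule that)
qed

lemma field_subset_UNIV: "field_subset (UNIV :: 'b set)"
  by unfold_locales auto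

lemma form_pel:
  obtains P Q where "form_gen f d G = pel P Q"
    "\<And>a b. b ^ 2 = poly f a \<Longrightarrow> form d G (a, b, 1) = ev a b P Q"
  by (rule reducible_overE[OF form_reduce[OF field_subset_UNIV, of G d]]) auto

lemma K_as_pel_quotient:
  assumes "h \<in> K"
  obtains P Q S where "S \<noteq> 0" "h = pel P Q / pel S 0"
proof -
  obtain A B where AB: "h = el A B" using assms by (cases rule: K_cases)
  obtain p q p' q' where pq: "q \<noteq> 0" "A = to_fract p / to_fract q"
    "q' \<noteq> 0" "B = to_fract p' / to_fract q'"
    by (metis fract_as_quotient)
  have "h * pel (q * q') 0 = pel (p * q') (p' * q)"
    unfolding AB pq(2,4) by (simp add: el_mult pq)
  moreover have "pel (q * q') 0 \<noteq> 0" using pq by simp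
  ultimately have "h = pel (p * q') (p' * q) / pel (q * q') 0" by (simp add: nonzero_eq_divide_eq)
  then show ?thesis using that[of "q * q'" "p * q'" "p' * q"] pq by simp
qed

lemma function_field_eq: "function_field UNIV f = K"
proof (intro equalityI subsetI)
  fix h assume "h \<in> function_field UNIV f"
  then obtain d G H where "h = form_gen f d G / form_gen f d H"
    by (auto simp: function_field_def)
  then show "h \<in> K" using form_pel by (metis K.divide_mem el_mem)
next
  fix h assume "h \<in> K"
  then obtain P Q S where PQS: "S \<noteq> 0" "h = pel P Q / pel S 0" by (rule K_as_pel_quotient)
  define d where "d = Suc (max (max (degree P) (degree Q)) (degree S))"
  have d: "degree P < d" "degree Q < d" "degree S < d"
    "degree (0 :: 'b poly) < d" by (auto simp: d_def)
  obtain G where G: "form_gen f d G = pel P Q" by (rule form_of_pel[OF d(1,2)])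
  obtain H where H: "form_gen f d H = pel S 0" by (rule form_of_pel[OF d(3,4)])
  have "h = form_gen f d G / form_gen f d H" "form_gen f d H \<noteq> 0"
    unfolding G H using PQS by auto
  then show "h \<in> function_field UNIV f" unfolding function_field_def by blast
qed

section \<open>The points of the model\<close>

lemma points_iff:
  "v \<in> points f \<longleftrightarrow> (\<forall>h. h \<notin> K - {0} \<longrightarrow> v h = 0) \<and> valued_field K v \<and>
     (\<forall>a. a \<noteq> 0 \<longrightarrow> v (const a) = 0) \<and> (\<exists>t\<in>K - {0}. v t = 1)"
proof -
  have "valued_field K v \<longleftrightarrow> (\<forall>h\<in>K - {0}. \<forall>h'\<in>K - {0}. v (h * h') = v h + v h') \<and>
         (\<forall>h\<in>K - {0}. \<forall>h'\<in>K - {0}. h + h' \<noteq> 0 \<longrightarrow> v (h + h') \<ge> min (v h) (v h'))"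
    by (simp add: valued_field_def valued_field_axioms_def field_subset_K Ball_def) blast
  then show ?thesis by (auto simp: points_def function_field_eq Let_def)
qed

lemma point_valued_field: "v \<in> points f \<Longrightarrow> valued_field K v"
  by (simp add: points_iff)

lemma point_const: "v \<in> points f \<Longrightarrow> v (const a) = 0"
  by (cases "a = 0") (auto simp: points_iff)

lemma point_outside: "v \<in> points f \<Longrightarrow> h \<notin> K \<or> h = 0 \<Longrightarrow> v h = 0"
  by (auto simp: points_iff)

lemma point_normalised: "v \<in> points f \<Longrightarrow> \<exists>t\<in>K - {0}. v t = 1"
  by (simp add: points_iff)

lemma point_restrict: "v \<in> points f \<Longrightarrow> valued_field UNIV (\<lambda>r. v (to_ac r))"
proof -
  assume v: "v \<in> points f"
  interpret valued_field K v using v by (rule point_valued_field)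
  show ?thesis
  proof
    fix r s :: "'b poly fract"
    assume "r \<noteq> 0" "s \<noteq> 0"
    then show "v (to_ac (r * s)) = v (to_ac r) + v (to_ac s)" by (simp add: v_mult)
    assume "r + s \<noteq> 0"
    then have "to_ac r + to_ac s \<noteq> 0" by (metis to_ac_add to_ac_eq_0_iff)
    then show "min (v (to_ac r)) (v (to_ac s)) \<le> v (to_ac (r + s))"
      using v_add[of "to_ac r" "to_ac s"] \<open>r \<noteq> 0\<close> \<open>s \<noteq> 0\<close> by simp
  qed
qed

lemma point_ratc: "v \<in> points f \<Longrightarrow> v (to_ac (ratc a)) = 0"
  using point_const[of v a] by (simp add: const_def)

lemma point_at_finite:
  assumes "v \<in> points f" "v (to_ac (lin a)) > 0" "r \<noteq> 0"
  shows "v (to_ac r) = v (to_ac (lin a)) * ord_at a r"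
  by (rule fract_val_at_finite[OF point_restrict]) (use assms point_ratc in auto)

lemma point_at_infinity:
  assumes "v \<in> points f" "v (to_ac (lin 0)) < 0" "r \<noteq> 0"
  shows "v (to_ac r) = - v (to_ac (lin 0)) * ord_inf r"
  by (rule fract_val_at_infinity[OF point_restrict]) (use assms point_ratc in auto)

lemma point_y: "v \<in> points f \<Longrightarrow> 2 * v y = v (to_ac F)"
proof -
  assume v: "v \<in> points f"
  interpret valued_field K v using v by (rule point_valued_field)
  show ?thesis using v_power[of y 2] y_square by simp
qed

lemma point_conj: "v \<in> points f \<Longrightarrow> v \<circ> conj \<in> points f"
proof -
  assume v: "v \<in> points f"
  interpret valued_field K v using v by (rule point_valued_field)
  have "valued_field K (v \<circ> conj)"
  proof
    fix h h' assume h: "h \<in> K" "h' \<in> K" "h \<noteq> 0" "h' \<noteq> 0"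
    then show "(v \<circ> conj) (h * h') = (v \<circ> conj) h + (v \<circ> conj) h'"
      by (simp add: conj_mult v_mult)
    assume "h + h' \<noteq> 0"
    then have "conj h + conj h' \<noteq> 0" using h by (simp flip: conj_add)
    then show "min ((v \<circ> conj) h) ((v \<circ> conj) h') \<le> (v \<circ> conj) (h + h')"
      using h v_add[of "conj h" "conj h'"] by (simp add: conj_add)
  qed
  moreover obtain t where "t \<in> K - {0}" "v t = 1" using point_normalised[OF v] by blast
  then have "conj t \<in> K - {0}" "(v \<circ> conj) (conj t) = 1" by auto
  moreover have "(v \<circ> conj) h = 0" if "h \<notin> K - {0}" for h
    using that point_outside[OF v, of "conj h"] by auto
  moreover have "(v \<circ> conj) (const a) = 0" for a by (simp add: point_const[OF v])
  ultimately show ?thesis unfolding points_iff by blast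
qed

lemma point_norm:
  assumes "v \<in> points f" "h \<in> K" "h \<noteq> 0"
  shows "v h + v (conj h) = v (to_ac (norm h))"
proof -
  interpret valued_field K v using assms(1) by (rule point_valued_field)
  show ?thesis using assms by (simp add: v_mult flip: mult_conj)
qed

text \<open>A nontrivial valuation of the function field is nontrivial on rational functions, because
  every element is integral over them.\<close>

lemma point_cases:
  assumes v: "v \<in> points f"
  obtains "v (to_ac (lin 0)) < 0" | a where "v (to_ac (lin a)) > 0"
proof (rule ccontr)
  assume *: "\<not> thesis"
  interpret valued_field K v using v by (rule point_valued_field)
  interpret r: valued_field UNIV "\<lambda>r. v (to_ac r)" using v by (rule point_restrict)
  have lin0: "v (to_ac (lin 0)) \<ge> 0" using * that by force
  have "v (to_ac (lin a)) = 0" for a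
  proof -
    have "lin a = lin 0 + ratc (- a)" by (simp flip: to_fract_add)
    moreover have "r.v_ge 0 (lin 0)" "r.v_ge 0 (ratc (- a))"
      using lin0 point_ratc[OF v] by (auto simp: r.v_ge_def)
    ultimately have "r.v_ge 0 (lin a)" using r.v_ge_add by auto
    then have "v (to_ac (lin a)) \<ge> 0" by (auto simp: r.v_ge_def)
    moreover have "\<not> v (to_ac (lin a)) > 0" using * that by blast
    ultimately show ?thesis by simp
  qed
  then have lin: "v (to_ac (lin a)) = 0 * ord_inf (lin a)" for a by simp
  have "v (to_ac r) = 0 * ord_inf r" if "r \<noteq> 0" for r
    by (rule valued_field_fract_eqI[OF point_restrict[OF v] valued_field_ord_inf point_ratc[OF v]
          ord_inf_ratc lin that])
  then have zero: "v (to_ac r) = 0" for r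
    using point_outside[OF v, of 0] by (cases "r = 0") auto
  then have vy: "v y = 0" using point_y[OF v] by simp
  have nonneg: "v h \<ge> 0" if h: "h \<in> K" "h \<noteq> 0" for h
  proof -
    obtain A B where AB: "h = el A B" using h(1) by (rule K_cases)
    have "v_ge 0 (to_ac A)" "v_ge 0 (to_ac B)" "v_ge 0 y"
      using zero vy by (auto simp: v_ge_def)
    moreover from this have "v_ge (0 + 0) (to_ac B * y)"
      by (intro v_ge_mult to_ac_mem y_mem)
    ultimately have "v_ge 0 h" unfolding AB el_def by (intro v_ge_add K.mult_mem to_ac_mem y_mem) auto
    then show ?thesis using h by (simp add: v_ge_def)
  qed
  obtain t where t: "t \<in> K - {0}" "v t = 1" using point_normalised[OF v] by blast
  then show False using nonneg[of "inverse t"] v_inverse[of t] by auto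
qed


subsection \<open>Ramified points\<close>

text \<open>A valuation of the rational function field that is odd on \<open>f\<close> is ramified in the function
  field: in \<open>A\<^sup>2 - B\<^sup>2 f\<close> the two terms have different parity, so they cannot cancel, and composing
  with the norm gives a valuation.\<close>

definition ramified :: "('b poly fract \<Rightarrow> int) \<Rightarrow> 'b ambient \<Rightarrow> int" where
  "ramified w h = (if h \<in> K - {0} then w (norm h) else 0)"

context
  fixes w :: "'b poly fract \<Rightarrow> int"
  assumes w: "valued_field UNIV w" and odd: "odd (w F)"
    and w_const: "\<And>a. a \<noteq> 0 \<Longrightarrow> w (ratc a) = 0"
begin

interpretation w: valued_field UNIV w by (rule w)

lemma ramified_ge_iff:
  assumes "el A B \<noteq> 0"
  shows "n \<le> ramified w (el A B) \<longleftrightarrow> w.v_ge n (A ^ 2) \<and> w.v_ge n (B ^ 2 * F)"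
proof -
  have r: "ramified w (el A B) = w (A ^ 2 - B ^ 2 * F)"
    using assms by (simp add: ramified_def)
  show ?thesis
  proof (cases "A = 0 \<or> B = 0")
    case True
    then show ?thesis using assms r by (auto simp: w.v_ge_def)
  next
    case False
    then have "w (A ^ 2) = 2 * w A" "w (B ^ 2 * F) = 2 * w B + w F"
      by (simp_all add: w.v_mult w.v_power)
    then have "w (A ^ 2) \<noteq> w (B ^ 2 * F)" using odd by presburger
    then consider "w (A ^ 2) < w (B ^ 2 * F)" | "w (B ^ 2 * F) < w (A ^ 2)" by linarith
    then show ?thesis
    proof cases
      case 1
      have "w (A ^ 2 + - (B ^ 2 * F)) = w (A ^ 2)"
        by (rule w.v_add_dominant) (use False 1 in \<open>auto simp: w.v_ge_def\<close>)
      then show ?thesis using r 1 False by (auto simp: w.v_ge_def)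
    next
      case 2
      have "w (- (B ^ 2 * F) + A ^ 2) = w (- (B ^ 2 * F))"
        by (rule w.v_add_dominant) (use False 2 in \<open>auto simp: w.v_ge_def\<close>)
      then show ?thesis using r 2 False by (auto simp: w.v_ge_def)
    qed
  qed
qed

lemma valued_field_ramified: "valued_field K (ramified w)"
proof
  fix h h' assume h: "h \<in> K" "h' \<in> K" "h \<noteq> 0" "h' \<noteq> 0"
  then show "ramified w (h * h') = ramified w h + ramified w h'"
    using K.mult_mem[of h h'] by (simp add: ramified_def norm_mult w.v_mult)
  assume nz: "h + h' \<noteq> 0"
  obtain A B C D where el: "h = el A B" "h' = el C D" using h by (metis K_cases)
  let ?n = "min (ramified w h) (ramified w h')"
  have sq: "w.v_ge n (z ^ 2 * c) \<longleftrightarrow> z = 0 \<or> n \<le> 2 * w z + w c" if "c \<noteq> 0" for n z c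
    using that by (cases "z = 0") (auto simp: w.v_ge_def w.v_mult w.v_power)
  have sq_add: "w.v_ge n ((z + z') ^ 2 * c)" if "w.v_ge n (z ^ 2 * c)" "w.v_ge n (z' ^ 2 * c)" "c \<noteq> 0"
    for n z z' c
    using that w.v_add[of z z'] unfolding sq[OF \<open>c \<noteq> 0\<close>]
    by (cases "z = 0"; cases "z' = 0"; cases "z + z' = 0") auto
  have "w.v_ge ?n (A ^ 2)" "w.v_ge ?n (B ^ 2 * F)" "w.v_ge ?n (C ^ 2)" "w.v_ge ?n (D ^ 2 * F)"
    using ramified_ge_iff[of A B ?n] ramified_ge_iff[of C D ?n] h el by auto
  then have "w.v_ge ?n ((A + C) ^ 2)" "w.v_ge ?n ((B + D) ^ 2 * F)"
    using sq_add[of ?n A 1 C] sq_add[of ?n B F D] by auto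
  then show "?n \<le> ramified w (h + h')"
    using ramified_ge_iff[of "A + C" "B + D" ?n] nz unfolding el el_add by auto
qed

lemma ramified_point:
  assumes "t \<in> K - {0}" "w (norm t) = 1"
  shows "ramified w \<in> points f"
proof -
  have "ramified w (const a) = 0" if "a \<noteq> 0" for a
  proof -
    have "norm (const a) = ratc a ^ 2" by (simp add: const_el)
    then show ?thesis using that w_const by (simp add: ramified_def w.v_power)
  qed
  moreover have "ramified w t = 1" using assms by (simp add: ramified_def)
  moreover have "\<forall>h. h \<notin> K - {0} \<longrightarrow> ramified w h = 0" by (auto simp: ramified_def)
  ultimately show ?thesis using valued_field_ramified assms(1) unfolding points_iff by blast
qed

text \<open>Conversely an extension of a multiple of \<open>w\<close> is determined by \<open>2 v(y) = v(f)\<close>, and the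
  normalisation fixes the multiple to be \<open>2\<close>.\<close>

lemma ramified_unique:
  assumes v: "v \<in> points f" and "c > 0" and vw: "\<And>r. r \<noteq> 0 \<Longrightarrow> v (to_ac r) = c * w r"
    and t: "t \<in> K - {0}" "w (norm t) = 1"
  shows "v = ramified w"
proof -
  interpret valued_field K v using v by (rule point_valued_field)
  have vy: "2 * v y = c * w F" using point_y[OF v] vw by simp
  have *: "2 * v h = c * w (norm h)" if hK: "h \<in> K" "h \<noteq> 0" for h
  proof -
    obtain A B where h: "h = el A B" using hK(1) by (rule K_cases)
    have vA: "v (to_ac A) = c * w A" if "A \<noteq> 0" for A using vw that by simp
    have vB: "2 * v (to_ac B * y) = c * (2 * w B + w F)" if "B \<noteq> 0"
      using vy vw that by (simp add: v_mult algebra_simps)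
    show ?thesis
    proof (cases "A = 0 \<or> B = 0")
      case True
      then consider "A \<noteq> 0" "B = 0" | "A = 0" "B \<noteq> 0" using hK h by auto
      then show ?thesis
      proof cases
        case 1
        then have "h = to_ac A" "norm h = A ^ 2" using h by (simp_all add: to_ac_el)
        then show ?thesis using vA 1 by (simp add: w.v_power)
      next
        case 2
        then have "h = to_ac B * y" "norm h = - (B ^ 2 * F)"
          unfolding h by (simp_all only: norm_el) (simp_all add: el_def)
        then show ?thesis using vB 2 by (simp add: w.v_mult w.v_power)
      qed
    next
      case False
      have n: "w (A ^ 2) = 2 * w A" "w (B ^ 2 * F) = 2 * w B + w F"
        using False by (simp_all add: w.v_mult w.v_power)
      then have "w (A ^ 2) \<noteq> w (B ^ 2 * F)" using odd by presburger
      then consider "w (A ^ 2) < w (B ^ 2 * F)" | "w (B ^ 2 * F) < w (A ^ 2)" by linarith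
      then show ?thesis
      proof cases
        case 1
        have "w (A ^ 2 + - (B ^ 2 * F)) = w (A ^ 2)"
          by (rule w.v_add_dominant) (use False 1 in \<open>auto simp: w.v_ge_def\<close>)
        moreover have "v (to_ac A + to_ac B * y) = v (to_ac A)"
        proof (rule v_add_dominant)
          have "c * (2 * w A) < c * (2 * w B + w F)" using 1 n \<open>c > 0\<close> by simp
          then have "v (to_ac A) < v (to_ac B * y)" using vA[of A] vB False by auto
          then show "v_ge (v (to_ac A) + 1) (to_ac B * y)" by (simp add: v_ge_def)
        qed (use False in auto)
        ultimately show ?thesis using n vA[of A] False by (simp add: h el_def[symmetric])
      next
        case 2
        have "w (- (B ^ 2 * F) + A ^ 2) = w (- (B ^ 2 * F))"
          by (rule w.v_add_dominant) (use False 2 in \<open>auto simp: w.v_ge_def\<close>)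
        moreover have "v (to_ac B * y + to_ac A) = v (to_ac B * y)"
        proof (rule v_add_dominant)
          have "c * (2 * w A) > c * (2 * w B + w F)" using 2 n \<open>c > 0\<close> by simp
          then have "v (to_ac A) > v (to_ac B * y)" using vA[of A] vB False by auto
          then show "v_ge (v (to_ac B * y) + 1) (to_ac A)" by (simp add: v_ge_def)
        qed (use False in auto)
        ultimately show ?thesis using n vB False by (simp add: h el_def[symmetric] add.commute)
      qed
    qed
  qed
  obtain s where s: "s \<in> K - {0}" "v s = 1" using point_normalised[OF v] by blast
  have "even c" using *[of t] t by (metis Diff_iff dvd_triv_left mult.right_neutral singleton_iff)
  moreover have "c dvd 2" using *[of s] s by (metis Diff_iff dvd_triv_left mult.right_neutral singleton_iff)
  ultimately have "c = 2" using \<open>c > 0\<close> by (meson zdvd_antisym_nonneg less_imp_le zero_le_numeral)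
  show ?thesis
  proof
    fix h show "v h = ramified w h"
      using *[of h] \<open>c = 2\<close> point_outside[OF v, of h] by (auto simp: ramified_def)
  qed
qed

end

definition P_inf :: "'b ambient \<Rightarrow> int" where "P_inf = ramified ord_inf"

definition P_root :: "'b \<Rightarrow> 'b ambient \<Rightarrow> int" where "P_root a = ramified (ord_at a)"

text \<open>With \<open>deg f = 2m + 1\<close> the function \<open>x\<^sup>m / y = x\<^sup>m y / f\<close> has a simple zero at infinity.\<close>

lemma uniformizer_inf: "\<exists>t\<in>K - {0}. ord_inf (norm t) = 1"
proof -
  define m where "m = degree f div 2"
  let ?t = "el 0 (lin 0 ^ m / F)"
  have "2 * m + 1 = degree f" using degree_odd by (simp add: m_def)
  moreover have "norm ?t = - (lin 0 ^ (2 * m) / F)"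
    by (simp add: power2_eq_square mult_2 power_add)
  ultimately have "ord_inf (norm ?t) = 1"
    by (simp add: ord_inf.v_divide ord_inf.v_power ord_inf_F)
  then show ?thesis by (intro bexI[of _ ?t]) auto
qed

lemma uniformizer_root: "poly f a = 0 \<Longrightarrow> \<exists>t\<in>K - {0}. ord_at a (norm t) = 1"
  by (rule bexI[of _ y]) (auto simp: y_el ord_at_F)

lemma odd_ord_inf_F: "odd (ord_inf F)"
  using degree_odd by (simp add: ord_inf_F)

lemma P_inf_point: "P_inf \<in> points f"
  using uniformizer_inf ramified_point[OF valued_field_ord_inf odd_ord_inf_F]
  by (auto simp: P_inf_def)

lemma P_root_point: "poly f a = 0 \<Longrightarrow> P_root a \<in> points f"
  using uniformizer_root[of a] ramified_point[OF valued_field_ord_at[of a]]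
  by (auto simp: P_root_def ord_at_F)

lemma P_inf_unique:
  assumes "v \<in> points f" "v (to_ac (lin 0)) < 0"
  shows "v = P_inf"
proof -
  obtain t where "t \<in> K - {0}" "ord_inf (norm t) = 1" using uniformizer_inf by blast
  then show ?thesis
    unfolding P_inf_def
    by (intro ramified_unique[OF valued_field_ord_inf odd_ord_inf_F _ assms(1) _ point_at_infinity[OF assms]])
      (use assms in auto)
qed

lemma P_root_unique:
  assumes "v \<in> points f" "v (to_ac (lin a)) > 0" "poly f a = 0"
  shows "v = P_root a"
proof -
  obtain t where "t \<in> K - {0}" "ord_at a (norm t) = 1" using uniformizer_root[OF assms(3)] by blast
  then show ?thesis
    unfolding P_root_def
    by (intro ramified_unique[OF valued_field_ord_at _ _ assms(1) _ point_at_finite[OF assms(1,2)]])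
      (use assms in \<open>auto simp: ord_at_F\<close>)
qed

lemma P_inf_to_ac: "r \<noteq> 0 \<Longrightarrow> P_inf (to_ac r) = 2 * ord_inf r"
  by (simp add: P_inf_def ramified_def to_ac_el ord_inf.v_power)

lemma P_root_to_ac: "r \<noteq> 0 \<Longrightarrow> P_root a (to_ac r) = 2 * ord_at a r"
  by (simp add: P_root_def ramified_def to_ac_el ord_at.v_power)

lemma P_root_y: "poly f a = 0 \<Longrightarrow> P_root a y = 1"
  by (simp add: P_root_def ramified_def ord_at_F y_el)

lemma P_inf_y: "P_inf y = - int (degree f)"
  by (simp add: P_inf_def ramified_def ord_inf_F y_el)

lemma ramified_conj: "ramified w \<circ> conj = ramified w"
proof
  fix h show "(ramified w \<circ> conj) h = ramified w h"
    by (cases "h \<in> K") (auto simp: ramified_def elim!: K_cases)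
qed

lemma P_inf_conj: "P_inf \<circ> conj = P_inf" and P_root_conj: "P_root a \<circ> conj = P_root a"
  by (simp_all add: P_inf_def P_root_def ramified_conj)


subsection \<open>Unramified points\<close>

text \<open>The polynomial elements that do not vanish at an affine point \<open>(a, b)\<close>, and their quotients:
  the units of the local ring at that point.\<close>

definition local_units :: "'b \<Rightarrow> 'b \<Rightarrow> 'b ambient set" where
  "local_units a b = {pel P Q / pel S T |P Q S T. ev a b P Q \<noteq> 0 \<and> ev a b S T \<noteq> 0}"

text \<open>The function \<open>x - a\<close> on the curve.\<close>

abbreviation xm :: "'b \<Rightarrow> 'b ambient" where "xm a \<equiv> to_ac (lin a)"

lemma pel_mult: "pel P Q * pel S T = pel (P * S + Q * T * f) (P * T + Q * S)"
  by (simp add: el_mult)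

lemma ev_mult: "b ^ 2 = poly f a \<Longrightarrow> ev a b (P * S + Q * T * f) (P * T + Q * S) = ev a b P Q * ev a b S T"
  unfolding ev_def poly_add poly_mult by (drule sym) (simp add: algebra_simps power2_eq_square)

lemma ev_neq_0D: "ev a b P Q \<noteq> 0 \<Longrightarrow> pel P Q \<noteq> 0"
  by (auto simp: ev_def)

lemma local_unitsI: "ev a b P Q \<noteq> 0 \<Longrightarrow> ev a b S T \<noteq> 0 \<Longrightarrow> pel P Q / pel S T \<in> local_units a b"
  unfolding local_units_def by blast

lemma pel_1: "pel 1 0 = 1"
  by (simp add: el_def)

lemma ev_1 [simp]: "ev a b 1 0 = 1"
  by (simp add: ev_def)

lemma local_units_pel: "ev a b P Q \<noteq> 0 \<Longrightarrow> pel P Q \<in> local_units a b"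
  using local_unitsI[of a b P Q 1 0] pel_1 by simp

lemma local_unitsE:
  assumes "u \<in> local_units a b"
  obtains P Q S T where "u = pel P Q / pel S T" "ev a b P Q \<noteq> 0" "ev a b S T \<noteq> 0"
    "pel P Q \<noteq> 0" "pel S T \<noteq> 0"
  using assms ev_neq_0D unfolding local_units_def by blast

lemma local_units_mem: "u \<in> local_units a b \<Longrightarrow> u \<in> K \<and> u \<noteq> 0"
  by (elim local_unitsE) (simp add: K.divide_mem)

lemma local_units_inverse: "u \<in> local_units a b \<Longrightarrow> inverse u \<in> local_units a b"
  by (elim local_unitsE) (simp add: local_unitsI)

lemma local_units_mult:
  assumes b: "b ^ 2 = poly f a" and u: "u \<in> local_units a b" "u' \<in> local_units a b"
  shows "u * u' \<in> local_units a b"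
proof -
  obtain P Q S T where 1: "u = pel P Q / pel S T" "ev a b P Q \<noteq> 0" "ev a b S T \<noteq> 0"
    using u(1) by (rule local_unitsE)
  obtain P' Q' S' T' where 2: "u' = pel P' Q' / pel S' T'" "ev a b P' Q' \<noteq> 0" "ev a b S' T' \<noteq> 0"
    using u(2) by (rule local_unitsE)
  have "u * u' = (pel P Q * pel P' Q') / (pel S T * pel S' T')" using 1 2 by simp
  then show ?thesis
    unfolding pel_mult using 1 2 by (simp only:) (intro local_unitsI, simp_all add: ev_mult[OF b])
qed

lemma xm_pel: "xm a ^ n = pel ([:- a, 1:] ^ n) 0"
  by (simp only: to_ac_el[symmetric] to_fract_power to_ac_power to_fract_0)

context
  fixes a b :: 'b
  assumes b: "b ^ 2 = poly f a" and b_neq_0: "b \<noteq> 0"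
begin

text \<open>If \<open>P + Q y\<close> vanishes at \<open>(a, b)\<close> but not both \<open>P\<close> and \<open>Q\<close> vanish at \<open>a\<close>, then its conjugate
  does not vanish there, and the norm, a polynomial in \<open>x\<close>, shows the power of \<open>x - a\<close>.\<close>

lemma pel_decompose:
  assumes "pel P Q \<noteq> 0"
  shows "\<exists>n. \<exists>u\<in>local_units a b. pel P Q = xm a ^ n * u"
  using assms
proof (induction "degree P + degree Q" arbitrary: P Q rule: less_induct)
  case less
  consider "ev a b P Q \<noteq> 0" | "ev a b P (- Q) \<noteq> 0" "ev a b P Q = 0" | "ev a b P Q = 0" "ev a b P (- Q) = 0"
    by blast
  then show ?case
  proof cases
    case 1
    then show ?thesis using local_units_pel by (intro exI[of _ 0]) auto
  next
    case 2
    define N where "N = P ^ 2 - Q ^ 2 * f"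
    have N: "pel P Q * pel P (- Q) = pel N 0"
      by (simp add: N_def pel_mult power2_eq_square el_mult)
    have c: "pel P (- Q) \<noteq> 0" using 2 by (intro ev_neq_0D)
    then have "pel N 0 \<noteq> 0" using less.prems unfolding N[symmetric] by simp
    then have "N \<noteq> 0" by simp
    then obtain M where M: "N = [:- a, 1:] ^ Polynomial.order a N * M" "\<not> [:- a, 1:] dvd M"
      using order_decomp by blast
    then have M0: "ev a b M 0 \<noteq> 0" by (simp add: ev_def poly_eq_0_iff_dvd)
    have "pel N 0 = xm a ^ Polynomial.order a N * pel M 0"
      unfolding xm_pel pel_mult using M(1) by simp
    then have "pel P Q = xm a ^ Polynomial.order a N * (pel M 0 / pel P (- Q))"
      using N c by (simp add: nonzero_eq_divide_eq)
    then show ?thesis using local_unitsI[OF M0] 2 by blast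
  next
    case 3
    have "2 * poly P a = ev a b P Q + ev a b P (- Q)" "2 * (poly Q a * b) = ev a b P Q - ev a b P (- Q)"
      by (simp_all add: ev_def)
    then have "poly P a = 0" "poly Q a = 0" using 3 b_neq_0 two_neq_zero by auto
    then obtain P' Q' where PQ': "P = [:- a, 1:] * P'" "Q = [:- a, 1:] * Q'"
      by (metis poly_eq_0_iff_dvd dvdE)
    have eq: "pel P Q = xm a ^ 1 * pel P' Q'"
      unfolding xm_pel pel_mult PQ' by simp
    then have nz: "pel P' Q' \<noteq> 0" using less.prems by auto
    have deg: "degree ([:- a, 1:] * R) = (if R = 0 then 0 else Suc (degree R))" for R :: "'b poly"
      by (simp add: degree_mult_eq del: mult_pCons_left)
    have "degree P' + degree Q' < degree P + degree Q"
      using nz unfolding PQ' deg by auto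
    then obtain n u where "u \<in> local_units a b" "pel P' Q' = xm a ^ n * u"
      using less.hyps nz by blast
    then have "pel P Q = xm a ^ Suc n * u" using eq by simp
    then show ?thesis using \<open>u \<in> local_units a b\<close> by blast
  qed
qed

lemma xm_power_not_unit: "n > 0 \<Longrightarrow> xm a ^ n \<notin> local_units a b"
proof
  assume n: "n > 0" and "xm a ^ n \<in> local_units a b"
  then obtain P Q S T where u: "xm a ^ n = pel P Q / pel S T" "ev a b P Q \<noteq> 0" "ev a b S T \<noteq> 0"
    "pel S T \<noteq> 0"
    by (elim local_unitsE)
  then have "pel P Q = pel ([:- a, 1:] ^ n) 0 * pel S T"
    unfolding xm_pel by (simp add: field_simps)
  also have "\<dots> = pel ([:- a, 1:] ^ n * S) ([:- a, 1:] ^ n * T)"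
    unfolding pel_mult by simp
  finally have "P = [:- a, 1:] ^ n * S" "Q = [:- a, 1:] ^ n * T"
    by (simp_all only: el_eq_iff to_fract_eq_iff)
  then have "ev a b P Q = 0" using n by (simp add: ev_def zero_power)
  then show False using u by simp
qed

lemma xm_neq_0 [simp]: "xm a \<noteq> 0"
  by simp

lemma decompose:
  assumes "h \<in> K" "h \<noteq> 0"
  shows "\<exists>n. \<exists>u\<in>local_units a b. h = xm a powi n * u"
proof -
  obtain P Q S where h: "S \<noteq> 0" "h = pel P Q / pel S 0" using assms(1) by (rule K_as_pel_quotient)
  then have "pel P Q \<noteq> 0" "pel S 0 \<noteq> 0" using assms(2) by auto
  then obtain n m u u' where u: "u \<in> local_units a b" "pel P Q = xm a ^ n * u"
    "u' \<in> local_units a b" "pel S 0 = xm a ^ m * u'"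
    using pel_decompose by metis
  then have "h = xm a powi (int n - int m) * (u * inverse u')"
    unfolding h(2) by (simp add: power_int_diff field_class.field_divide_inverse)
  then show ?thesis using u local_units_mult[OF b] local_units_inverse by blast
qed

lemma decompose_unique:
  assumes eq: "xm a powi n * u = xm a powi m * u'" and u: "u \<in> local_units a b" "u' \<in> local_units a b"
  shows "n = m"
proof -
  have *: "\<not> n < m" if eq: "xm a powi n * u = xm a powi m * u'" and u: "u \<in> local_units a b" "u' \<in> local_units a b"
    for n m u u'
  proof
    assume "n < m"
    have nz: "u' \<noteq> 0" "xm a powi n \<noteq> 0" using local_units_mem u by auto
    then have "u / u' = xm a powi m / xm a powi n" using eq by (simp add: field_simps)
    also have "\<dots> = xm a powi (m - n)" by (simp add: power_int_diff)
    also have "\<dots> = xm a ^ nat (m - n)" using \<open>n < m\<close> by (simp add: power_int_def)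
    finally have "xm a ^ nat (m - n) = u * inverse u'" by (simp add: field_class.field_divide_inverse)
    also have "\<dots> \<in> local_units a b" using u local_units_mult[OF b] local_units_inverse by blast
    finally show False using xm_power_not_unit \<open>n < m\<close> by simp
  qed
  show ?thesis using *[OF eq u] *[OF eq[symmetric] u(2,1)] by linarith
qed

text \<open>The point over \<open>(a, b)\<close> when \<open>f(a) \<noteq> 0\<close>: here \<open>x - a\<close> is a uniformizer, and the value of a
  function is the exponent that remains after splitting off a unit of the local ring.\<close>

definition P_unram :: "'b ambient \<Rightarrow> int" where
  "P_unram h = (if h \<in> K - {0} then (THE n. \<exists>u\<in>local_units a b. h = xm a powi n * u) else 0)"

lemma P_unram_eq: "u \<in> local_units a b \<Longrightarrow> P_unram (xm a powi n * u) = n"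
proof -
  assume u: "u \<in> local_units a b"
  then have "xm a powi n * u \<in> K - {0}" using local_units_mem by (auto intro: K.mult_mem K.power_int_mem)
  moreover have "(THE m. \<exists>u'\<in>local_units a b. xm a powi n * u = xm a powi m * u') = n"
    by (rule the_equality) (use u decompose_unique in blast)+
  ultimately show ?thesis by (simp add: P_unram_def)
qed

text \<open>After clearing denominators the sum is a polynomial element, and polynomial elements have no
  negative power of \<open>x - a\<close>.\<close>

lemma unit_add_ge:
  assumes u: "u \<in> local_units a b" "u' \<in> local_units a b" and nz: "u + xm a ^ k * u' \<noteq> 0"
  shows "\<exists>n. \<exists>u''\<in>local_units a b. u + xm a ^ k * u' = xm a ^ n * u''"
proof -
  obtain P Q S T where 1: "u = pel P Q / pel S T" "ev a b P Q \<noteq> 0" "ev a b S T \<noteq> 0" "pel S T \<noteq> 0"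
    using u(1) by (elim local_unitsE)
  obtain P' Q' S' T' where 2: "u' = pel P' Q' / pel S' T'" "ev a b P' Q' \<noteq> 0" "ev a b S' T' \<noteq> 0" "pel S' T' \<noteq> 0"
    using u(2) by (elim local_unitsE)
  have D: "pel S T * pel S' T' \<in> local_units a b"
    using local_units_mult[OF b] local_units_pel 1 2 by blast
  have frac: "(p / s + x * (p' / s')) * (s * s') = p * s' + x * p' * s" if "s \<noteq> 0" "s' \<noteq> 0"
    for p s x p' s' :: "'b ambient" using that by (simp add: field_simps)
  have eq: "(u + xm a ^ k * u') * (pel S T * pel S' T') = pel P Q * pel S' T' + xm a ^ k * pel P' Q' * pel S T"
    unfolding 1(1) 2(1) using 1(4) 2(4) by (rule frac)
  have "\<exists>M N. pel P Q * pel S' T' + xm a ^ k * pel P' Q' * pel S T = pel M N"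
    unfolding xm_pel pel_mult el_add to_fract_add[symmetric] by blast
  then obtain M N where MN: "(u + xm a ^ k * u') * (pel S T * pel S' T') = pel M N"
    using eq by auto
  moreover have "pel M N \<noteq> 0" using nz 1(4) 2(4) by (simp flip: MN)
  then obtain n w where "w \<in> local_units a b" "pel M N = xm a ^ n * w" using pel_decompose by blast
  ultimately have "u + xm a ^ k * u' = xm a ^ n * (w * inverse (pel S T * pel S' T'))"
    using 1(4) 2(4) by (simp add: field_simps)
  then show ?thesis
    using \<open>w \<in> local_units a b\<close> D local_units_mult[OF b] local_units_inverse by blast
qed

lemma P_unram_add:
  assumes h: "h \<in> K" "h' \<in> K" "h \<noteq> 0" "h' \<noteq> 0" "h + h' \<noteq> 0" and le: "P_unram h \<le> P_unram h'"
  shows "P_unram h \<le> P_unram (h + h')"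
proof -
  obtain n u m u' where u: "u \<in> local_units a b" "h = xm a powi n * u"
    "u' \<in> local_units a b" "h' = xm a powi m * u'" using decompose h by metis
  then have nm: "n \<le> m" "P_unram h = n" using le P_unram_eq by auto
  have "xm a powi m = xm a powi (n + (m - n))" by simp
  also have "\<dots> = xm a powi n * xm a powi (m - n)" by (subst power_int_add) auto
  also have "xm a powi (m - n) = xm a ^ nat (m - n)" using nm by (simp add: power_int_def)
  finally have sum: "h + h' = xm a powi n * (u + xm a ^ nat (m - n) * u')"
    unfolding u by (simp add: algebra_simps)
  then have "u + xm a ^ nat (m - n) * u' \<noteq> 0" using h by auto
  then obtain k u'' where "u'' \<in> local_units a b" "u + xm a ^ nat (m - n) * u' = xm a ^ k * u''"
    using unit_add_ge u by blast
  then have "h + h' = xm a powi (n + int k) * u''"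
    unfolding sum by (simp add: power_int_add)
  then show ?thesis using P_unram_eq \<open>u'' \<in> local_units a b\<close> nm by simp
qed

lemma P_unram_point: "P_unram \<in> points f"
proof -
  have "valued_field K P_unram"
  proof
    fix h h' assume h: "h \<in> K" "h' \<in> K" "h \<noteq> 0" "h' \<noteq> 0"
    obtain n u m u' where u: "u \<in> local_units a b" "h = xm a powi n * u"
      "u' \<in> local_units a b" "h' = xm a powi m * u'" using decompose h by metis
    have "xm a powi (n + m) = xm a powi n * xm a powi m" by (rule power_int_add) simp
    then have "h * h' = xm a powi (n + m) * (u * u')" using u by (simp only: ac_simps)
    then have "P_unram (h * h') = n + m"
      using u local_units_mult[OF b] P_unram_eq by (simp only:)
    then show "P_unram (h * h') = P_unram h + P_unram h'"
      using u P_unram_eq by simp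
    assume "h + h' \<noteq> 0"
    then show "min (P_unram h) (P_unram h') \<le> P_unram (h + h')"
      using P_unram_add[of h h'] P_unram_add[of h' h] h
      by (cases "P_unram h \<le> P_unram h'") (auto simp: add.commute)
  qed
  moreover have "P_unram (const c) = 0" if "c \<noteq> 0" for c
  proof -
    have "const c = pel [:c:] 0" by (simp add: const_el)
    then have "const c \<in> local_units a b" using that local_units_pel[of a b "[:c:]" 0] by (simp add: ev_def)
    then show ?thesis using P_unram_eq[of "const c" 0] by simp
  qed
  moreover have "P_unram (xm a) = 1"
    using P_unram_eq[of 1 1] local_units_pel[of a b 1 0] pel_1 by simp
  moreover have "\<forall>h. h \<notin> K - {0} \<longrightarrow> P_unram h = 0" by (auto simp: P_unram_def)
  ultimately show ?thesis unfolding points_iff by (metis DiffI xm_neq_0 singletonD to_ac_mem)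
qed

lemma P_unram_xm: "P_unram (xm a) = 1"
  using P_unram_eq[of 1 1] local_units_pel[of a b 1 0] pel_1 by simp

end

text \<open>The difference \<open>P(x) + Q(x) y - P(a) - Q(a) b\<close> equals
  \<open>(P(x) - P(a)) + (Q(x) - Q(a)) y + Q(a) (y - b)\<close>, in which every term has positive value.\<close>

lemma point_residue:
  assumes v: "v \<in> points f" and x: "v (xm a) > 0" and y: "y = const b \<or> v (y - const b) > 0"
  shows "valued_field.v_ge v 1 (pel P Q - const (ev a b P Q))"
proof -
  interpret valued_field K v using v by (rule point_valued_field)
  have poly: "v_ge 1 (to_ac (to_fract p))" if "poly p a = 0" for p
  proof (cases "p = 0")
    case False
    then have "ord_at a (to_fract p) \<ge> 1" using that order_root[of p a] by (simp add: ord_at_to_fract Suc_leI)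
    then have "1 * 1 \<le> v (xm a) * ord_at a (to_fract p)" using x by (intro mult_mono) auto
    then show ?thesis using False point_at_finite[OF v x, of "to_fract p"] by (simp add: v_ge_def)
  qed simp
  have yb: "v_ge 1 (y - const b)" using y by (auto simp: v_ge_def)
  have cst: "v_ge 0 (const c)" for c using point_const[OF v] by (simp add: v_ge_def)
  have y0: "v_ge 0 y" using v_ge_add[OF _ _ v_ge_mono[OF yb, of 0] cst[of b]] by auto
  have "v_ge (1 + 0) (to_ac (to_fract (Q - [:poly Q a:])) * y)"
    by (intro v_ge_mult y0 poly to_ac_mem y_mem) simp
  moreover have "v_ge (0 + 1) (const (poly Q a) * (y - const b))"
    by (intro v_ge_mult yb cst const_mem K.diff_mem y_mem)
  ultimately have "v_ge 1 (to_ac (to_fract (P - [:poly P a:])) + (to_ac (to_fract (Q - [:poly Q a:])) * y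
    + const (poly Q a) * (y - const b)))"
    by (intro v_ge_add poly K.add_mem K.mult_mem K.diff_mem to_ac_mem y_mem const_mem) auto
  moreover have "pel P Q - const (ev a b P Q) = to_ac (to_fract (P - [:poly P a:]))
      + (to_ac (to_fract (Q - [:poly Q a:])) * y + const (poly Q a) * (y - const b))"
    unfolding ev_def const_add const_mult el_def to_fract_diff to_ac_diff const_def[symmetric]
    by (simp add: algebra_simps)
  ultimately show ?thesis by simp
qed

lemma point_pel:
  assumes v: "v \<in> points f" and x: "v (xm a) > 0" and y: "y = const b \<or> v (y - const b) > 0"
  shows "valued_field.v_ge v 0 (pel P Q)"
    and "ev a b P Q = 0 \<Longrightarrow> valued_field.v_ge v 1 (pel P Q)"
    and "ev a b P Q \<noteq> 0 \<Longrightarrow> v (pel P Q) = 0"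
proof -
  interpret valued_field K v using v by (rule point_valued_field)
  let ?c = "const (ev a b P Q)"
  have 1: "v_ge 1 (pel P Q - ?c)" using assms by (rule point_residue)
  have "v_ge 0 ?c" using point_const[OF v] by (simp add: v_ge_def)
  then have "v_ge 0 (?c + (pel P Q - ?c))"
    by (intro v_ge_add v_ge_mono[OF 1] const_mem el_mem K.diff_mem) auto
  then show "v_ge 0 (pel P Q)" by simp
  show "v_ge 1 (pel P Q)" if "ev a b P Q = 0" using 1 that by simp
  show "v (pel P Q) = 0" if "ev a b P Q \<noteq> 0"
  proof -
    have "v (?c + (pel P Q - ?c)) = v ?c"
      by (rule v_add_dominant) (use 1 that point_const[OF v] in auto)
    then show ?thesis using point_const[OF v] by simp
  qed
qed

lemma point_local_unit:
  assumes v: "v \<in> points f" and "v (xm a) > 0" "y = const b \<or> v (y - const b) > 0"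
    and u: "u \<in> local_units a b"
  shows "v u = 0"
proof -
  interpret valued_field K v using v by (rule point_valued_field)
  obtain P Q S T where "u = pel P Q / pel S T" "ev a b P Q \<noteq> 0" "ev a b S T \<noteq> 0"
    "pel P Q \<noteq> 0" "pel S T \<noteq> 0"
    using u by (rule local_unitsE)
  then show ?thesis using point_pel(3)[OF assms(1-3)] by (simp add: v_divide)
qed

text \<open>The product \<open>(y - b) (y + b) = f(x) - f(a)\<close> is divisible by \<open>x - a\<close>.\<close>

lemma point_over_y:
  assumes v: "v \<in> points f" and x: "v (xm a) > 0" and b: "b ^ 2 = poly f a"
  shows "y - const b \<noteq> 0" "y + const b \<noteq> 0" "v (y - const b) > 0 \<or> v (y + const b) > 0"
proof -
  interpret valued_field K v using v by (rule point_valued_field)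
  have "y - const b = el (- ratc b) 1" "y + const b = el (ratc b) 1"
    by (simp_all add: el_def const_def)
  then show nz: "y - const b \<noteq> 0" "y + const b \<noteq> 0" by auto
  let ?p = "f - [:poly f a:]"
  have "(y - const b) * (y + const b) = y ^ 2 - const (b ^ 2)"
    by (simp add: algebra_simps power2_eq_square const_mult)
  then have prod: "(y - const b) * (y + const b) = to_ac (to_fract ?p)"
    by (simp add: y_square b const_def)
  moreover have "?p \<noteq> 0" using degree_ge by (metis degree_pCons_0 eq_iff_diff_eq_0 not_numeral_le_zero)
  moreover have "ord_at a (to_fract ?p) > 0" using \<open>?p \<noteq> 0\<close> order_root[of ?p a]
    by (simp add: ord_at_to_fract del: to_fract_diff)
  ultimately have "v ((y - const b) * (y + const b)) > 0"
    using point_at_finite[OF v x, of "to_fract ?p"] x by simp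
  then have "v (y - const b) + v (y + const b) > 0"
    using nz by (subst (asm) v_mult) (auto intro: K.diff_mem K.add_mem)
  then show "v (y - const b) > 0 \<or> v (y + const b) > 0" by linarith
qed

lemma point_unramified_unique:
  assumes v: "v \<in> points f" and x: "v (xm a) > 0" and b: "b ^ 2 = poly f a" "b \<noteq> 0"
    and y: "v (y - const b) > 0"
  shows "v = P_unram a b"
proof
  interpret valued_field K v using v by (rule point_valued_field)
  have *: "v (xm a powi n * u) = n * v (xm a)" if "u \<in> local_units a b" for n u
    using point_local_unit[OF v x _ that] y local_units_mem[OF that]
    by (subst v_mult) (auto intro: K.power_int_mem simp: v_power_int)
  obtain t where t: "t \<in> K - {0}" "v t = 1" using point_normalised[OF v] by blast
  then obtain n u where "u \<in> local_units a b" "t = xm a powi n * u" using decompose[OF b, of t] by auto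
  then have "n * v (xm a) = 1" using * t by simp
  then have X1: "v (xm a) = 1" using x by (auto simp: zmult_eq_1_iff)
  fix h show "v h = P_unram a b h"
  proof (cases "h \<in> K - {0}")
    case True
    then obtain n u where "u \<in> local_units a b" "h = xm a powi n * u" using decompose[OF b, of h] by auto
    then show ?thesis using * X1 P_unram_eq[OF b] by simp
  next
    case False
    then show ?thesis using point_outside[OF v, of h] by (auto simp: P_unram_def[OF b])
  qed
qed

text \<open>The two square roots \<open>\<plusminus>b\<close> of \<open>f(a)\<close> give two points, which the involution exchanges. They
  differ because \<open>2b\<close> is a nonzero constant and cannot have positive value.\<close>

lemma points_over_nonroot:
  assumes "poly f a \<noteq> 0"
  obtains Q where "Q \<in> points f" "Q \<circ> conj \<noteq> Q" "Q (xm a) = 1"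
    "\<And>v. v \<in> points f \<Longrightarrow> v (xm a) > 0 \<Longrightarrow> v = Q \<or> v = Q \<circ> conj"
proof -
  obtain b where b: "b ^ 2 = poly f a" using nth_root_exists[of 2 "poly f a"] by auto
  then have b0: "b \<noteq> 0" using assms by auto
  let ?Q = "P_unram a b"
  note Q = P_unram_point[OF b b0] P_unram_xm[OF b b0]
  have *: "v = ?Q \<or> v \<circ> conj = ?Q" if v: "v \<in> points f" "v (xm a) > 0" for v
  proof -
    consider "v (y - const b) > 0" | "v (y + const b) > 0" using point_over_y[OF v b] by blast
    then show ?thesis
    proof cases
      case 1
      then show ?thesis using point_unramified_unique[OF v b b0] by blast
    next
      case 2
      interpret valued_field K v using v(1) by (rule point_valued_field)
      have "conj (y - const b) = - (y + const b)" by (simp add: conj_diff)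
      then have "(v \<circ> conj) (y - const b) > 0"
        using 2 v_minus[of "y + const b"] K.add_mem[of y "const b"] by simp
      then show ?thesis
        using point_unramified_unique[OF point_conj[OF v(1)] _ b b0] v(2) by simp
    qed
  qed
  have "?Q \<circ> conj \<noteq> ?Q"
  proof
    assume eq: "?Q \<circ> conj = ?Q"
    interpret valued_field K ?Q using Q(1) by (rule point_valued_field)
    have yK: "y + const b \<in> K" "y - const b \<in> K" by auto
    moreover have "conj (y - const b) = - (y + const b)" by (simp add: conj_diff)
    ultimately have "?Q (y - const b) = ?Q (y + const b)"
      using fun_cong[OF eq, of "y - const b"] v_minus[of "y + const b"] by simp
    moreover have "?Q (xm a) > 0" using Q(2) by simp
    ultimately have "v_ge 1 (y - const b)" "v_ge 1 (y + const b)"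
      using point_over_y[OF Q(1) _ b] by (auto simp: v_ge_def)
    then have "v_ge 1 ((y + const b) - (y - const b))"
      by (intro v_ge_diff[OF yK])
    moreover have "(y + const b) - (y - const b) = const (b + b)"
      unfolding const_add by (simp add: algebra_simps)
    moreover have "b + b \<noteq> 0" using b0 two_neq_zero by (simp flip: mult_2)
    ultimately show False using point_const[OF Q(1)] by (simp add: v_ge_def)
  qed
  moreover have "v = ?Q \<or> v = ?Q \<circ> conj" if "v \<in> points f" "v (xm a) > 0" for v
  proof -
    have "(v \<circ> conj) \<circ> conj = v" by (simp add: fun_eq_iff)
    then show ?thesis using *[OF that] by auto
  qed
  ultimately show ?thesis using that[of ?Q] Q by blast
qed

section \<open>The special points of the plane curve\<close>

lemma affine_point_iff: "(a, b, 1) \<in> plane_curve f \<longleftrightarrow> b ^ 2 = poly f a"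
  by (simp add: plane_curve_def plane_eq_def poly_altdef)

lemma forms_of_pels:
  obtains d G H where "form_gen f d G = pel P Q" "\<And>a b. form d G (a, b, 1) = ev a b P Q"
    "form_gen f d H = pel S T" "\<And>a b. form d H (a, b, 1) = ev a b S T"
proof -
  define d where "d = Suc (max (max (degree P) (degree Q))
    (max (degree S) (degree T)))"
  have d: "degree P < d" "degree Q < d" "degree S < d"
    "degree T < d" by (auto simp: d_def)
  obtain G where G: "form_gen f d G = pel P Q" "\<And>a b. form d G (a, b, 1) = ev a b P Q"
    using form_of_pel[OF d(1,2)] by blast
  obtain H where H: "form_gen f d H = pel S T" "\<And>a b. form d H (a, b, 1) = ev a b S T"
    using form_of_pel[OF d(3,4)] by blast
  show thesis by (rule that[OF G H])
qed

lemma local_ring_affine: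
  assumes b: "b ^ 2 = poly f a"
  shows "local_ring f (a, b, 1) = {pel P Q / pel S T |P Q S T. ev a b S T \<noteq> 0}"
proof (intro equalityI subsetI)
  fix h assume "h \<in> local_ring f (a, b, 1)"
  then obtain d G H where h: "h = form_gen f d G / form_gen f d H" "form d H (a, b, 1) \<noteq> 0"
    by (auto simp: local_ring_def)
  obtain P Q where G: "form_gen f d G = pel P Q" by (rule form_pel)
  obtain S T where H: "form_gen f d H = pel S T"
    "\<And>a b. b ^ 2 = poly f a \<Longrightarrow> form d H (a, b, 1) = ev a b S T" using form_pel by blast
  show "h \<in> {pel P Q / pel S T |P Q S T. ev a b S T \<noteq> 0}"
    using h H(2)[OF b] unfolding G H(1) by auto
next
  fix h assume "h \<in> {pel P Q / pel S T |P Q S T. ev a b S T \<noteq> 0}"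
  then obtain P Q S T where h: "h = pel P Q / pel S T" "ev a b S T \<noteq> 0" by blast
  obtain d G H where G: "form_gen f d G = pel P Q" and H: "form_gen f d H = pel S T"
    "\<And>a b. form d H (a, b, 1) = ev a b S T" using forms_of_pels[of P Q S T] by metis
  have "h = form_gen f d G / form_gen f d H" "form d H (a, b, 1) \<noteq> 0"
    unfolding G H using h by auto
  then show "h \<in> local_ring f (a, b, 1)" unfolding local_ring_def by blast
qed

lemma local_max_ideal_affine:
  assumes b: "b ^ 2 = poly f a"
  shows "local_max_ideal f (a, b, 1) = {pel P Q / pel S T |P Q S T. ev a b S T \<noteq> 0 \<and> ev a b P Q = 0}"
proof (intro equalityI subsetI)
  fix h assume "h \<in> local_max_ideal f (a, b, 1)"
  then obtain d G H where h: "h = form_gen f d G / form_gen f d H" "form d H (a, b, 1) \<noteq> 0"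
    "form d G (a, b, 1) = 0"
    by (auto simp: local_max_ideal_def)
  obtain P Q where G: "form_gen f d G = pel P Q"
    "\<And>a b. b ^ 2 = poly f a \<Longrightarrow> form d G (a, b, 1) = ev a b P Q" using form_pel by blast
  obtain S T where H: "form_gen f d H = pel S T"
    "\<And>a b. b ^ 2 = poly f a \<Longrightarrow> form d H (a, b, 1) = ev a b S T" using form_pel by blast
  show "h \<in> {pel P Q / pel S T |P Q S T. ev a b S T \<noteq> 0 \<and> ev a b P Q = 0}"
    using h H(2)[OF b] G(2)[OF b] unfolding G(1) H(1) by auto
next
  fix h assume "h \<in> {pel P Q / pel S T |P Q S T. ev a b S T \<noteq> 0 \<and> ev a b P Q = 0}"
  then obtain P Q S T where h: "h = pel P Q / pel S T" "ev a b S T \<noteq> 0" "ev a b P Q = 0" by blast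
  obtain d G H where G: "form_gen f d G = pel P Q" "\<And>a b. form d G (a, b, 1) = ev a b P Q"
    and H: "form_gen f d H = pel S T" "\<And>a b. form d H (a, b, 1) = ev a b S T"
    using forms_of_pels[of P Q S T] by metis
  have "h = form_gen f d G / form_gen f d H" "form d H (a, b, 1) \<noteq> 0" "form d G (a, b, 1) = 0"
    unfolding G H using h by auto
  then show "h \<in> local_max_ideal f (a, b, 1)" unfolding local_max_ideal_def by blast
qed

lemma local_ringI:
  "b ^ 2 = poly f a \<Longrightarrow> ev a b S T \<noteq> 0 \<Longrightarrow> pel P Q / pel S T \<in> local_ring f (a, b, 1)"
  unfolding local_ring_affine by blast

lemma local_max_idealI:
  "b ^ 2 = poly f a \<Longrightarrow> ev a b S T \<noteq> 0 \<Longrightarrow> ev a b P Q = 0 \<Longrightarrow> pel P Q / pel S T \<in> local_max_ideal f (a, b, 1)"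
  unfolding local_max_ideal_affine by blast

lemma val_ring_iff: "h \<in> val_ring f v \<longleftrightarrow> h \<in> K \<and> (h = 0 \<or> v h \<ge> 0)"
  by (simp add: val_ring_def function_field_eq)

lemma val_max_ideal_iff: "h \<in> val_max_ideal f v \<longleftrightarrow> h \<in> K \<and> (h = 0 \<or> v h > 0)"
  by (simp add: val_max_ideal_def function_field_eq)

text \<open>The function \<open>x - a\<close> lies in the maximal ideal of the local ring, and above a root of \<open>f\<close> only
  the ramified point gives it a positive value.\<close>

lemma points_over_root:
  assumes a: "poly f a = 0"
  shows "points_over f (a, 0, 1) = {P_root a}"
proof (intro equalityI subsetI)
  fix v assume "v \<in> points_over f (a, 0, 1)"
  then have v: "v \<in> points f" and max: "local_max_ideal f (a, 0, 1) \<subseteq> val_max_ideal f v"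
    by (auto simp: points_over_def)
  have "xm a = pel [:- a, 1:] 0 / pel 1 0" unfolding pel_1 by (simp add: to_ac_el)
  also have "\<dots> \<in> local_max_ideal f (a, 0, 1)"
    using a by (intro local_max_idealI) (auto simp: ev_def)
  finally have "xm a \<in> local_max_ideal f (a, 0, 1)" .
  then have "v (xm a) > 0" using max by (auto simp: val_max_ideal_iff)
  then show "v \<in> {P_root a}" using P_root_unique[OF v _ a] by simp
next
  fix v assume "v \<in> {P_root a}"
  then have v: "v \<in> points f" "v (xm a) > 0" and y: "y = const 0 \<or> v (y - const 0) > 0"
    using P_root_point[OF a] P_root_y[OF a] P_root_to_ac[of "lin a" a] by simp_all
  interpret valued_field K v using v(1) by (rule point_valued_field)
  note pel = point_pel[OF v y]
  have "pel P Q / pel S T \<in> val_ring f v" if "ev a 0 S T \<noteq> 0" for P Q S T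
    using pel(1)[of P Q] pel(3)[OF that] ev_neq_0D[OF that]
    by (cases "pel P Q = 0") (auto simp: val_ring_iff v_ge_def v_divide K.divide_mem simp del: el_eq_0_iff)
  moreover have "pel P Q / pel S T \<in> val_max_ideal f v" if "ev a 0 S T \<noteq> 0" "ev a 0 P Q = 0" for P Q S T
    using pel(2)[OF that(2)] pel(3)[OF that(1)] ev_neq_0D[OF that(1)]
    by (cases "pel P Q = 0") (auto simp: val_max_ideal_iff v_ge_def v_divide K.divide_mem simp del: el_eq_0_iff)
  ultimately show "v \<in> points_over f (a, 0, 1)"
    using v a local_ring_affine[of 0 a] local_max_ideal_affine[of 0 a] affine_point_iff[of a 0]
    by (auto simp: points_over_def)
qed

lemma fract_regular:
  assumes "ord_at.v_ge a 0 r"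
  obtains p q where "r = to_fract p / to_fract q" "poly q a \<noteq> 0"
proof (cases "r = 0")
  case True
  then show ?thesis using that[of 0 1] by simp
next
  case False
  obtain p q where q: "q \<noteq> 0" "r = to_fract p / to_fract q" by (rule fract_as_quotient)
  then have p: "p \<noteq> 0" using False by auto
  let ?l = "[:- a, 1:]" and ?n = "Polynomial.order a q"
  have "?n \<le> Polynomial.order a p"
    using assms p q False by (simp add: ord_at.v_ge_def ord_at.v_divide ord_at_to_fract)
  then have "?l ^ ?n dvd p" using order_1 power_le_dvd by blast
  then obtain p' where p': "p = ?l ^ ?n * p'" by (elim dvdE)
  obtain q' where q': "q = ?l ^ ?n * q'" "\<not> ?l dvd q'" using order_decomp[OF q(1)] by blast
  have "to_fract p / to_fract q = to_fract p' / to_fract q'"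
    by (subst p', subst q'(1)) (simp only: to_fract_mult mult_divide_mult_cancel_left to_fract_eq_0_iff
      power_eq_0_iff pCons_eq_0_iff one_neq_zero simp_thms if_True if_False)
  then show ?thesis using that[of p' q'] q q' by (auto simp: poly_eq_0_iff_dvd)
qed

text \<open>For \<open>h = A + B y\<close> the parities of \<open>2 ord A\<close> and \<open>2 ord B + 1\<close> differ. If \<open>h\<close> has no pole, then
  neither has \<open>A\<close> or \<open>B\<close>, and both have denominators that do not vanish at the point.\<close>

lemma nonsingular_root:
  assumes a: "poly f a = 0"
  shows "nonsingular_at f (a, 0, 1)"
proof -
  have "P_root a \<in> points_over f (a, 0, 1)" using points_over_root[OF a] by simp
  then have sub: "local_ring f (a, 0, 1) \<subseteq> val_ring f (P_root a)" by (simp add: points_over_def)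
  have "h \<in> local_ring f (a, 0, 1)" if "h \<in> val_ring f (P_root a)" for h
  proof -
    have hK: "h \<in> K" "h = 0 \<or> P_root a h \<ge> 0" using that by (auto simp: val_ring_iff)
    obtain A B where h: "h = el A B" using hK(1) by (rule K_cases)
    have "ord_at.v_ge a 0 A \<and> ord_at.v_ge a 0 B"
    proof (cases "h = 0")
      case False
      have "odd (ord_at a F)" using a by (simp add: ord_at_F)
      then have "ord_at.v_ge a 0 (A ^ 2)" "ord_at.v_ge a 0 (B ^ 2 * F)"
        using ramified_ge_iff[OF valued_field_ord_at, of a A B 0] hK False h
        by (auto simp: P_root_def)
      moreover have "ord_at a (A ^ 2) = 2 * ord_at a A" if "A \<noteq> 0" using that by (simp add: ord_at.v_power)
      moreover have "ord_at a (B ^ 2 * F) = 2 * ord_at a B + 1" if "B \<noteq> 0"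
        using that a by (simp add: ord_at.v_power ord_at.v_mult ord_at_F)
      ultimately show ?thesis by (cases "A = 0"; cases "B = 0") (auto simp: ord_at.v_ge_def)
    qed (use h in auto)
    then obtain p q p' q' where pq: "A = to_fract p / to_fract q" "poly q a \<noteq> 0"
      "B = to_fract p' / to_fract q'" "poly q' a \<noteq> 0"
      using fract_regular by metis
    then have nz: "q \<noteq> 0" "q' \<noteq> 0" by auto
    then have "h * pel (q * q') 0 = pel (p * q') (p' * q)"
      unfolding h pq(1,3) by (simp add: el_mult)
    moreover have "pel (q * q') 0 \<noteq> 0" using nz by simp
    ultimately have hq: "h = pel (p * q') (p' * q) / pel (q * q') 0" by (intro eq_divide_imp)
    have ev: "ev a 0 (q * q') 0 \<noteq> 0" using pq by (simp add: ev_def)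
    show ?thesis unfolding hq by (rule local_ringI[OF _ ev]) (simp add: a)
  qed
  then show ?thesis
    using sub P_root_point[OF a] affine_point_iff[of a 0] a by (auto simp: nonsingular_at_def)
qed

lemma form_at_infinity: "form d G (0, 1, 0) = G 0 d"
proof -
  have "form d G (0, 1, 0) = (\<Sum>i\<le>d. \<Sum>j\<le>d-i. if i = 0 then (if j = d then G 0 d else 0) else 0)"
  proof -
    have "G i j * 0 ^ i * 1 ^ j * 0 ^ (d - i - j) = (if i = 0 then (if j = d then G 0 d else 0) else 0)"
      if "i \<le> d" "j \<le> d - i" for i j
      using that by (cases "i = 0"; cases "j = d") (simp_all add: power_0_left)
    then show ?thesis unfolding form_def by (auto intro!: sum.cong)
  qed
  also have "\<dots> = (\<Sum>i\<le>d. if i = 0 then G 0 d else 0)"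
    by (rule sum.cong) auto
  finally show ?thesis by simp
qed

interpretation inf: valued_field K P_inf
  by (rule point_valued_field[OF P_inf_point])

lemma gen_x_eq: "gen_x = xm 0"
  by (simp add: gen_x_def)

lemma form_gen_mem: "form_gen f d G \<in> K"
  using form_pel[of d G] by (metis el_mem)

text \<open>At infinity the term in \<open>y\<^sup>d\<close> of a form of degree \<open>d\<close> has a strictly larger pole than all
  other terms, because the pole of \<open>x\<close> is smaller than that of \<open>y\<close>.\<close>

lemma form_gen_at_infinity:
  "inf.v_ge (1 - int (degree f * d)) (form_gen f d G - const (G 0 d) * y ^ d)"
proof -
  let ?n = "degree f"
  let ?t = "\<lambda>i j. const (G i j) * gen_x ^ i * y ^ j"
  have "form_gen f d G - const (G 0 d) * y ^ d
      = (\<Sum>i\<le>d. \<Sum>j\<le>d-i. ?t i j) - (\<Sum>i\<le>d. \<Sum>j\<le>d-i. if i = 0 \<and> j = d then ?t i j else 0)"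
  proof -
    have "(\<Sum>i\<le>d. \<Sum>j\<le>d-i. if i = 0 \<and> j = d then ?t i j else 0) = (\<Sum>i\<le>d. if i = 0 then ?t 0 d else 0)"
      by (rule sum.cong) auto
    then show ?thesis unfolding form_gen_def form_affine by simp
  qed
  also have "\<dots> = (\<Sum>i\<le>d. \<Sum>j\<le>d-i. if i = 0 \<and> j = d then 0 else ?t i j)"
    unfolding sum_subtractf[symmetric] by (intro sum.cong) auto
  also have "inf.v_ge (1 - int (?n * d)) \<dots>"
  proof (intro inf.v_ge_sum conjI K.sum_mem)
    fix i j assume ij: "i \<in> {..d}" "j \<in> {..d-i}"
    have mem: "?t i j \<in> K" unfolding gen_x_eq by (intro K.mult_mem K.power_mem const_mem to_ac_mem y_mem)
    then show "(if i = 0 \<and> j = d then 0 else ?t i j) \<in> K"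
      "(if i = 0 \<and> j = d then 0 else ?t i j) \<in> K" by auto
    have "inf.v_ge (1 - int (?n * d)) (?t i j)" if ne: "\<not> (i = 0 \<and> j = d)"
    proof (cases "G i j = 0")
      case False
      have nz: "const (G i j) \<noteq> 0" "xm 0 ^ i \<noteq> 0" "y ^ j \<noteq> 0" using False by simp_all
      have "P_inf (?t i j) = - 2 * int i - int ?n * int j"
        using nz unfolding gen_x_eq
        by (simp add: inf.v_mult inf.v_power K.mult_mem K.power_mem point_const[OF P_inf_point] P_inf_to_ac P_inf_y)
      moreover have "2 * int i + int ?n * int j \<le> int (?n * d) - 1"
      proof (cases "i = 0")
        case True
        then have "int ?n * (int j + 1) \<le> int ?n * int d" using ij ne by (intro mult_left_mono) auto
        then show ?thesis using True degree_ge by (simp add: algebra_simps)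
      next
        case False
        have "int ?n * (int i + int j) \<le> int ?n * int d" using ij by (intro mult_left_mono) auto
        then have "int ?n * int i + int ?n * int j \<le> int (?n * d)"
          by (simp only: distrib_left of_nat_mult)
        moreover have "3 * int i \<le> int ?n * int i" using degree_ge by (intro mult_right_mono) auto
        moreover have "int i \<ge> 1" using False by simp
        ultimately show ?thesis by linarith
      qed
      ultimately show ?thesis by (simp add: inf.v_ge_def)
    qed simp
    then show "inf.v_ge (1 - int (?n * d)) (if i = 0 \<and> j = d then 0 else ?t i j)" by auto
  qed
  finally show ?thesis .
qed

lemma P_inf_form:
  shows "inf.v_ge (- int (degree f * d)) (form_gen f d G)"
    and "G 0 d = 0 \<Longrightarrow> inf.v_ge (1 - int (degree f * d)) (form_gen f d G)"
    and "G 0 d \<noteq> 0 \<Longrightarrow> form_gen f d G \<noteq> 0 \<and> P_inf (form_gen f d G) = - int (degree f * d)"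
proof -
  let ?N = "int (degree f * d)" and ?l = "const (G 0 d) * y ^ d"
  have mem: "?l \<in> K" "form_gen f d G - ?l \<in> K"
    using form_gen_mem by (auto intro!: K.mult_mem K.power_mem K.diff_mem)
  have v: "P_inf ?l = - ?N" if "G 0 d \<noteq> 0"
    using that by (simp add: inf.v_mult inf.v_power K.power_mem point_const[OF P_inf_point] P_inf_y)
  note D = form_gen_at_infinity[of d G]
  have "inf.v_ge (- ?N) ?l" using v by (cases "G 0 d = 0") (auto simp: inf.v_ge_def)
  then have "inf.v_ge (- ?N) (?l + (form_gen f d G - ?l))"
    by (intro inf.v_ge_add mem inf.v_ge_mono[OF D]) auto
  then show "inf.v_ge (- ?N) (form_gen f d G)" by simp
  show "inf.v_ge (1 - ?N) (form_gen f d G)" if "G 0 d = 0" using D that by simp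
  show "form_gen f d G \<noteq> 0 \<and> P_inf (form_gen f d G) = - ?N" if "G 0 d \<noteq> 0"
    using inf.v_add_dominant[OF mem] D v[OF that] that by (simp add: algebra_simps)
qed

text \<open>The quotient \<open>1 / y\<close> lies in the maximal ideal at \<open>[0:1:0]\<close>. A pole of \<open>y\<close> is a pole of \<open>f\<close>
  and thus of \<open>x\<close>, which leaves the point at infinity only.\<close>

lemma points_over_infinity: "points_over f (0, 1, 0) = {P_inf}"
proof (intro equalityI subsetI)
  fix v assume "v \<in> points_over f (0, 1, 0)"
  then have v: "v \<in> points f" and max: "local_max_ideal f (0, 1, 0) \<subseteq> val_max_ideal f v"
    by (auto simp: points_over_def)
  interpret valued_field K v using v by (rule point_valued_field)
  define G H :: "nat \<Rightarrow> nat \<Rightarrow> 'b" where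
    "G = (\<lambda>i j. if i = 0 \<and> j = 0 then 1 else 0)" and "H = (\<lambda>i j. if i = 0 \<and> j = 1 then 1 else 0)"
  have "form_gen f 1 G = 1" "form_gen f 1 H = y"
    by (simp_all add: form_gen_def form_affine G_def H_def)
  then have "1 / y = form_gen f 1 G / form_gen f 1 H" by simp
  moreover have "form 1 H (0, 1, 0) \<noteq> 0" "form 1 G (0, 1, 0) = 0"
    unfolding form_at_infinity by (simp_all add: G_def H_def)
  ultimately have "1 / y \<in> local_max_ideal f (0, 1, 0)"
    unfolding local_max_ideal_def by blast
  then have "v (1 / y) > 0" using max by (auto simp: val_max_ideal_iff)
  then have "v y < 0" using v_divide[of 1 y] by simp
  then have neg: "v (to_ac F) < 0" using point_y[OF v] by simp
  from v show "v \<in> {P_inf}"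
  proof (cases rule: point_cases)
    case 1
    then show ?thesis using P_inf_unique[OF v] by simp
  next
    case (2 a)
    have "ord_at a F \<ge> 0" by (simp add: ord_at_F)
    then have "v (to_ac F) \<ge> 0" using point_at_finite[OF v 2, of F] 2 by simp
    then show ?thesis using neg by simp
  qed
next
  fix v assume "v \<in> {P_inf}"
  then have v: "v = P_inf" by simp
  have curve: "(0, 1, 0) \<in> plane_curve f"
  proof -
    have "(\<Sum>i\<le>degree f. coeff f i * 0 ^ i * 0 ^ (degree f - i)) = 0"
      by (rule sum.neutral) (use degree_ge in \<open>auto simp: power_0_left\<close>)
    then show ?thesis using degree_ge by (simp add: plane_curve_def plane_eq_def power_0_left)
  qed
  have "form_gen f d G / form_gen f d H \<in> val_ring f v" if "form d H (0, 1, 0) \<noteq> 0" for d G H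
    using P_inf_form(1)[of d G] P_inf_form(3)[of H d] that form_gen_mem[of d G] form_gen_mem[of d H]
    by (cases "form_gen f d G = 0")
      (auto simp: v val_ring_iff inf.v_ge_def inf.v_divide K.divide_mem form_at_infinity)
  moreover have "form_gen f d G / form_gen f d H \<in> val_max_ideal f v"
    if "form d H (0, 1, 0) \<noteq> 0" "form d G (0, 1, 0) = 0" for d G H
    using P_inf_form(2)[of G d] P_inf_form(3)[of H d] that form_gen_mem[of d G] form_gen_mem[of d H]
    by (cases "form_gen f d G = 0")
      (auto simp: v val_max_ideal_iff inf.v_ge_def inf.v_divide K.divide_mem form_at_infinity)
  ultimately show "v \<in> points_over f (0, 1, 0)"
    using curve P_inf_point v by (auto simp: points_over_def local_ring_def local_max_ideal_def)
qed

lemma point_over_root: "poly f a = 0 \<Longrightarrow> point_over f (a, 0, 1) = P_root a"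
  by (simp add: point_over_def points_over_root)

lemma point_over_infinity: "point_over f (0, 1, 0) = P_inf"
  by (simp add: point_over_def points_over_infinity)


lemma cancel_leading_coeff:
  fixes p s :: "'b poly"
  assumes "degree p \<le> m" "degree s = m" "s \<noteq> 0"
  defines "r \<equiv> p - smult (coeff p m / coeff s m) s"
  shows "r = 0 \<or> degree r < m"
proof -
  have "coeff s m \<noteq> 0" using assms by auto
  then have "coeff r m = 0" by (simp add: r_def)
  moreover have "degree r \<le> m"
    unfolding r_def using assms by (intro degree_diff_le) (auto intro: order_trans[OF degree_smult_le])
  ultimately show ?thesis
    by (metis eq_zero_or_degree_less)
qed

lemma P_inf_pel_ge_iff:
  assumes "pel P Q \<noteq> 0"
  shows "n \<le> P_inf (pel P Q) \<longleftrightarrow> (P = 0 \<or> n \<le> - 2 * int (degree P)) \<and>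
    (Q = 0 \<or> n \<le> - 2 * int (degree Q) - int (degree f))"
proof -
  have "ord_inf (to_fract P ^ 2) = - 2 * int (degree P)" if "P \<noteq> 0"
    using that by (simp add: ord_inf.v_power ord_inf_to_fract)
  moreover have "ord_inf (to_fract Q ^ 2 * F) = - 2 * int (degree Q) - int (degree f)"
    if "Q \<noteq> 0"
    using that by (simp add: ord_inf.v_mult ord_inf.v_power ord_inf_to_fract)
  ultimately show ?thesis
    using ramified_ge_iff[OF valued_field_ord_inf odd_ord_inf_F, of "to_fract P" "to_fract Q" n] assms
    by (cases "P = 0"; cases "Q = 0") (auto simp: P_inf_def ord_inf.v_ge_def)
qed

text \<open>Whether the part without \<open>y\<close> or the part with \<open>y\<close> determines the order of the pole is seen
  from its parity. Two polynomial elements with the same pole are therefore dominated by the same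
  part, and the ratio of the leading coefficients is the residue of the quotient.\<close>

lemma P_inf_residue:
  assumes k: "field_subset k"
    and c: "\<And>i. coeff P i \<in> k" "\<And>i. coeff Q i \<in> k"
      "\<And>i. coeff S i \<in> k" "\<And>i. coeff T i \<in> k"
    and nz: "pel P Q \<noteq> 0" "pel S T \<noteq> 0" and eq: "P_inf (pel P Q) = P_inf (pel S T)"
  obtains a where "a \<in> k" "inf.v_ge (P_inf (pel S T) + 1) (pel P Q - const a * pel S T)"
proof -
  interpret k: field_subset k by fact
  let ?d = "\<lambda>p. int (degree p)"
  define N where "N = - P_inf (pel S T)"
  have PQ: "P = 0 \<or> 2 * ?d P \<le> N" "Q = 0 \<or> 2 * ?d Q + ?d f \<le> N"
    using P_inf_pel_ge_iff[OF nz(1), of "- N"] eq by (auto simp: N_def)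
  have ST: "S = 0 \<or> 2 * ?d S \<le> N" "T = 0 \<or> 2 * ?d T + ?d f \<le> N"
    using P_inf_pel_ge_iff[OF nz(2), of "- N"] eq by (auto simp: N_def)
  have lead: "S \<noteq> 0 \<and> 2 * ?d S = N \<or> T \<noteq> 0 \<and> 2 * ?d T + ?d f = N"
    using P_inf_pel_ge_iff[OF nz(2), of "- N + 1"] ST by (auto simp: N_def)
  have *: thesis if "a \<in> k" and less: "P - smult a S = 0 \<or> 2 * ?d (P - smult a S) < N"
    "Q - smult a T = 0 \<or> 2 * ?d (Q - smult a T) + ?d f < N" for a
  proof (rule \<open>\<And>a. a \<in> k \<Longrightarrow> inf.v_ge (P_inf (pel S T) + 1) (pel P Q - const a * pel S T) \<Longrightarrow> thesis\<close>[OF \<open>a \<in> k\<close>])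
    have "const a * pel S T = pel (smult a S) (smult a T)"
      by (simp add: const_el el_mult flip: to_fract_mult)
    then have eq: "pel P Q - const a * pel S T = pel (P - smult a S) (Q - smult a T)"
      by (simp add: el_diff)
    show "inf.v_ge (P_inf (pel S T) + 1) (pel P Q - const a * pel S T)"
    proof (cases "pel (P - smult a S) (Q - smult a T) = 0")
      case False
      then show ?thesis
        unfolding eq inf.v_ge_def using P_inf_pel_ge_iff[OF False, of "- N + 1"] less
        by (auto simp: N_def)
    qed (simp only: eq inf.v_ge_0)
  qed
  have f_odd: "odd (?d f)" using degree_odd by simp
  from lead show thesis
  proof
    assume S: "S \<noteq> 0 \<and> 2 * ?d S = N"
    define m where "m = degree S"
    define a where "a = coeff P m / coeff S m"
    have "degree P \<le> m" using PQ S by (auto simp: m_def)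
    then have P: "P - smult a S = 0 \<or> degree (P - smult a S) < m"
      unfolding a_def using S by (intro cancel_leading_coeff) (auto simp: m_def)
    have parity: "2 * x + ?d f \<noteq> N" for x using conjunct2[OF S] f_odd by presburger
    have "Q = 0 \<or> 2 * ?d Q + ?d f < N" "T = 0 \<or> 2 * ?d T + ?d f < N"
      using PQ ST parity by (meson le_neq_trans)+
    then have "Q - smult a T = 0 \<or> 2 * ?d (Q - smult a T) + ?d f < N"
      using degree_diff_le_max[of Q "smult a T"] degree_smult_le[of a T]
      by (cases "Q = 0"; cases "T = 0") auto
    then show thesis using P S c by (intro *[of a]) (auto simp: m_def a_def)
  next
    assume T: "T \<noteq> 0 \<and> 2 * ?d T + ?d f = N"
    define m where "m = degree T"
    define a where "a = coeff Q m / coeff T m"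
    have "degree Q \<le> m" using PQ T by (auto simp: m_def)
    then have Q: "Q - smult a T = 0 \<or> degree (Q - smult a T) < m"
      unfolding a_def using T by (intro cancel_leading_coeff) (auto simp: m_def)
    have parity: "2 * x \<noteq> N" for x using conjunct2[OF T] f_odd by presburger
    have "P = 0 \<or> 2 * ?d P < N" "S = 0 \<or> 2 * ?d S < N"
      using PQ ST parity by (meson le_neq_trans)+
    then have "P - smult a S = 0 \<or> 2 * ?d (P - smult a S) < N"
      using degree_diff_le_max[of P "smult a S"] degree_smult_le[of a S]
      by (cases "P = 0"; cases "S = 0") auto
    then show thesis using Q T c by (intro *[of a]) (auto simp: m_def a_def)
  qed
qed

lemma P_inf_rational:
  assumes k: "field_subset k" and fk: "\<And>i. coeff f i \<in> k"
  shows "rational_over k f P_inf"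
  unfolding rational_over_def
proof
  fix h assume "h \<in> val_ring f P_inf \<inter> function_field k f"
  then obtain d G H where h: "h \<in> K" "h = 0 \<or> P_inf h \<ge> 0" "h = form_gen f d G / form_gen f d H"
    "\<forall>i j. G i j \<in> k \<and> H i j \<in> k" "form_gen f d H \<noteq> 0"
    unfolding val_ring_iff function_field_def Int_iff mem_Collect_eq by blast
  interpret k: field_subset k by fact
  show "\<exists>a\<in>k. h - const a \<in> val_max_ideal f P_inf"
  proof (cases "h = 0 \<or> P_inf h > 0")
    case True
    then show ?thesis using h(1) by (intro bexI[of _ 0]) (auto simp: val_max_ideal_iff)
  next
    case False
    obtain P Q where PQ: "\<And>i. coeff P i \<in> k" "\<And>i. coeff Q i \<in> k"
      "form_gen f d G = pel P Q"
      by (rule reducible_overE[OF form_reduce[OF k fk, of G d]]) (use h(4) in auto)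
    obtain S T where ST: "\<And>i. coeff S i \<in> k" "\<And>i. coeff T i \<in> k"
      "form_gen f d H = pel S T"
      by (rule reducible_overE[OF form_reduce[OF k fk, of H d]]) (use h(4) in auto)
    have h': "h = pel P Q / pel S T" "pel S T \<noteq> 0" using h(3,5) unfolding PQ(3) ST(3) by auto
    then have "pel P Q \<noteq> 0" using False by auto
    moreover from this have "P_inf h = P_inf (pel P Q) - P_inf (pel S T)"
      unfolding h'(1) using h'(2) by (intro inf.v_divide el_mem)
    then have eq: "P_inf (pel P Q) = P_inf (pel S T)" using False h(2) by simp
    ultimately obtain a where a: "a \<in> k"
      "inf.v_ge (P_inf (pel S T) + 1) (pel P Q - const a * pel S T)"
      using P_inf_residue[OF k PQ(1,2) ST(1,2) _ h'(2)] by metis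
    have "h - const a = (pel P Q - const a * pel S T) / pel S T"
      using h' by (simp add: diff_divide_distrib)
    then have "h - const a \<in> val_max_ideal f P_inf"
      using a(2) h' h(1) by (auto simp: val_max_ideal_iff inf.v_ge_def inf.v_divide K.diff_mem K.mult_mem)
    then show ?thesis using a(1) by blast
  qed
qed

end

section \<open>Degrees of divisors\<close>

lemma divisor_degree_superset:
  assumes "finite S" "Poly_Mapping.keys D \<subseteq> S"
  shows "divisor_degree D = (\<Sum>P\<in>S. Poly_Mapping.lookup D P)"
  unfolding divisor_degree_def using assms by (intro sum.mono_neutral_left) (auto simp: in_keys_iff)

lemma divisor_degree_add: "divisor_degree (D + D') = divisor_degree D + divisor_degree D'"
proof -
  let ?S = "Poly_Mapping.keys D \<union> Poly_Mapping.keys D'"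
  have "Poly_Mapping.keys (D + D') \<subseteq> ?S" by (rule keys_add)
  then show ?thesis
    by (simp add: divisor_degree_superset[of ?S] lookup_add sum.distrib)
qed

lemma divisor_degree_cmul: "divisor_degree (frag_cmul n D) = n * divisor_degree D"
  using keys_cmul[of n D]
  by (simp add: divisor_degree_superset[of "Poly_Mapping.keys D"] sum_distrib_left)

lemma divisor_degree_0 [simp]: "divisor_degree 0 = 0"
  by (simp add: divisor_degree_def)

lemma divisor_degree_minus: "divisor_degree (- D) = - divisor_degree D"
  using divisor_degree_cmul[of "-1" D] by simp

lemma divisor_degree_diff: "divisor_degree (D - D') = divisor_degree D - divisor_degree D'"
  using divisor_degree_add[of D "- D'"] by (simp add: divisor_degree_minus)

lemma divisor_degree_frag_of [simp]: "divisor_degree (frag_of P) = 1"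
  by (simp add: divisor_degree_def)

lemma divisor_degree_sum: "divisor_degree (sum D I) = (\<Sum>i\<in>I. divisor_degree (D i))"
  by (induction I rule: infinite_finite_induct) (auto simp: divisor_degree_add)

lemma lookup_sum': "Poly_Mapping.lookup (sum D I) P = (\<Sum>i\<in>I. Poly_Mapping.lookup (D i) P)"
  for D :: "'i \<Rightarrow> 'p \<Rightarrow>\<^sub>0 int"
  by (induction I rule: infinite_finite_induct) (auto simp: lookup_add)

lemma keys_sum_subset:
  "(\<And>i. i \<in> I \<Longrightarrow> Poly_Mapping.keys (D i) \<subseteq> S) \<Longrightarrow> Poly_Mapping.keys (sum D I) \<subseteq> S"
  for D :: "'i \<Rightarrow> 'p \<Rightarrow>\<^sub>0 int"
  using sum_closed_free_Abelian_group[of I D S] by simp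

lemma keys_diff_subset:
  "Poly_Mapping.keys D \<subseteq> S \<Longrightarrow> Poly_Mapping.keys D' \<subseteq> S \<Longrightarrow> Poly_Mapping.keys (D - D') \<subseteq> S"
  for D :: "'p \<Rightarrow>\<^sub>0 int"
  using keys_diff[of D D'] by blast

lemma keys_cmul_subset: "Poly_Mapping.keys D \<subseteq> S \<Longrightarrow> Poly_Mapping.keys (frag_cmul n D) \<subseteq> S"
  using keys_cmul[of n D] by blast

context odd_hyperelliptic
begin

definition support :: "'b ambient \<Rightarrow> ('b ambient \<Rightarrow> int) set" where
  "support h = {P \<in> points f. P h \<noteq> 0}"

lemma support_sum_superset:
  assumes "finite S" "support h \<subseteq> S" "S \<subseteq> points f"
  shows "(\<Sum>P\<in>support h. P h) = (\<Sum>P\<in>S. P h)"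
  using assms by (intro sum.mono_neutral_left) (auto simp: support_def)

lemma point_xm_neg:
  assumes v: "v \<in> points f" and "v (xm a) < 0"
  shows "v = P_inf"
proof (rule P_inf_unique[OF v], rule ccontr)
  interpret valued_field K v using v by (rule point_valued_field)
  assume "\<not> v (xm 0) < 0"
  then have "v_ge 0 (xm 0)" "v_ge 0 (const a)" using point_const[OF v] by (auto simp: v_ge_def)
  then have "v_ge 0 (xm 0 - const a)" by (intro v_ge_diff to_ac_mem const_mem)
  moreover have "xm 0 - const a = xm a"
    by (simp add: const_def flip: to_ac_diff to_fract_diff)
  ultimately show False using assms(2) by (simp add: v_ge_def)
qed

lemma P_inf_xm: "P_inf (xm a) = - 2"
  by (simp add: P_inf_to_ac)

lemma P_root_neq_inf: "P_root a \<noteq> P_inf"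
proof
  assume "P_root a = P_inf"
  then have "P_root a (xm a) = P_inf (xm a)" by simp
  then show False by (simp add: P_root_to_ac P_inf_xm)
qed

lemma point_xm_pos_unique:
  assumes v: "v \<in> points f" and a: "v (xm a) > 0" and "b \<noteq> a"
  shows "v (xm b) = 0"
  using point_at_finite[OF v a, of "lin b"] \<open>b \<noteq> a\<close> by simp

lemma exists_point_over: "\<exists>P\<in>points f. P (xm a) > 0"
proof (cases "poly f a = 0")
  case True
  then show ?thesis using P_root_point[OF True] P_root_to_ac[of "lin a" a] by (intro bexI[of _ "P_root a"]) auto
next
  case False
  then obtain Q where "Q \<in> points f" "Q (xm a) = 1" by (rule points_over_nonroot)
  then show ?thesis by (intro bexI[of _ Q]) auto
qed

text \<open>The divisor of \<open>x - a\<close> has degree \<open>2 - 2 = 0\<close>, and such functions generate.\<close>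

lemma degree_rational_function:
  assumes "r \<noteq> 0"
  shows "finite (support (to_ac r)) \<and> (\<Sum>P\<in>support (to_ac r). P (to_ac r)) = 0"
  using assms
proof (induction r rule: fract_linear_induct)
  case (const c)
  have "support (to_ac (ratc c)) = {}" by (auto simp: support_def point_ratc)
  then show ?case by simp
next
  case (lin a)
  show ?case
  proof (cases "poly f a = 0")
    case True
    have "P \<in> support (xm a) \<longleftrightarrow> P = P_inf \<or> P = P_root a" for P
    proof
      assume "P \<in> support (xm a)"
      then have P: "P \<in> points f" "P (xm a) \<noteq> 0" by (auto simp: support_def)
      then show "P = P_inf \<or> P = P_root a"
        using point_xm_neg[of P a] P_root_unique[of P a] True by (cases "P (xm a) < 0") auto
    qed (auto simp: support_def P_inf_point P_root_point[OF True] P_inf_xm P_root_to_ac)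
    then have "support (xm a) = {P_inf, P_root a}" by blast
    moreover have "P_inf \<noteq> P_root a" using P_root_neq_inf[of a] by simp
    ultimately show ?thesis by (simp add: P_inf_xm P_root_to_ac)
  next
    case False
    obtain Q where Q: "Q \<in> points f" "Q \<circ> conj \<noteq> Q" "Q (xm a) = 1"
      "\<And>v. v \<in> points f \<Longrightarrow> v (xm a) > 0 \<Longrightarrow> v = Q \<or> v = Q \<circ> conj"
      by (rule points_over_nonroot[OF False]) (rule that)
    have Qc: "(Q \<circ> conj) (xm a) = 1" using Q(3) by simp
    have "P \<in> support (xm a) \<longleftrightarrow> P = P_inf \<or> P = Q \<or> P = Q \<circ> conj" for P
    proof
      assume "P \<in> support (xm a)"
      then have P: "P \<in> points f" "P (xm a) \<noteq> 0" by (auto simp: support_def)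
      then show "P = P_inf \<or> P = Q \<or> P = Q \<circ> conj"
        using point_xm_neg[of P a] Q(4)[of P] by (cases "P (xm a) < 0") auto
    next
      assume "P = P_inf \<or> P = Q \<or> P = Q \<circ> conj"
      then have "P \<in> points f" "P (xm a) \<noteq> 0"
        using P_inf_point Q(1) point_conj[OF Q(1)] P_inf_xm[of a] Q(3) Qc by auto
      then show "P \<in> support (xm a)" by (simp add: support_def)
    qed
    then have "support (xm a) = {P_inf, Q, Q \<circ> conj}" by blast
    moreover have "P_inf \<noteq> Q" "P_inf \<noteq> Q \<circ> conj" using P_inf_xm[of a] Q(3) Qc by auto
    ultimately show ?thesis using Q(2) Q(3) Qc by (simp add: P_inf_xm eq_commute[of Q])
  qed
next
  case (mult r s)
  let ?S = "support (to_ac r) \<union> support (to_ac s)"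
  have v: "P (to_ac (r * s)) = P (to_ac r) + P (to_ac s)" if "P \<in> points f" for P
    using valued_field.v_mult[OF point_restrict[OF that]] mult by simp
  have sub: "support (to_ac (r * s)) \<subseteq> ?S"
  proof
    fix P assume "P \<in> support (to_ac (r * s))"
    then show "P \<in> ?S" using v[of P] by (auto simp: support_def)
  qed
  have pts: "?S \<subseteq> points f" by (auto simp: support_def)
  have "(\<Sum>P\<in>support (to_ac (r * s)). P (to_ac (r * s))) = (\<Sum>P\<in>?S. P (to_ac r) + P (to_ac s))"
    using mult sub pts v by (subst support_sum_superset[of ?S]) (auto intro!: sum.cong)
  also have "\<dots> = (\<Sum>P\<in>?S. P (to_ac r)) + (\<Sum>P\<in>?S. P (to_ac s))"
    by (rule sum.distrib)
  also have "(\<Sum>P\<in>?S. P (to_ac r)) = (\<Sum>P\<in>support (to_ac r). P (to_ac r))"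
    using mult pts by (intro support_sum_superset[symmetric]) auto
  also have "(\<Sum>P\<in>?S. P (to_ac s)) = (\<Sum>P\<in>support (to_ac s). P (to_ac s))"
    using mult pts by (intro support_sum_superset[symmetric]) auto
  finally show ?case using mult sub finite_subset by auto
next
  case (inverse r)
  have v: "P (to_ac (inverse r)) = - P (to_ac r)" if "P \<in> points f" for P
    using valued_field.v_inverse[OF point_restrict[OF that]] inverse by simp
  have "P \<in> support (to_ac (inverse r)) \<longleftrightarrow> P \<in> support (to_ac r)" for P
    using v[of P] by (auto simp: support_def)
  then have "support (to_ac (inverse r)) = support (to_ac r)" by blast
  moreover have "(\<Sum>P\<in>support (to_ac r). P (to_ac (inverse r))) = - (\<Sum>P\<in>support (to_ac r). P (to_ac r))"
    unfolding sum_negf[symmetric] using v by (intro sum.cong) (auto simp: support_def)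
  ultimately show ?case using inverse by simp
qed

text \<open>Where \<open>A\<close>, \<open>B\<close>, \<open>f\<close> and the norm of \<open>h = A + B y\<close> all have order zero, \<open>h\<close> and its conjugate have
  no pole and their orders add up to zero. The exceptional points are those of four rational functions.\<close>

lemma finite_support:
  assumes "h \<in> K" "h \<noteq> 0"
  shows "finite (support h)"
proof -
  obtain A B where h: "h = el A B" using assms(1) by (rule K_cases)
  have fin: "finite (support (to_ac r))" for r
  proof (cases "r = 0")
    case True
    then have "support (to_ac r) = {}" by (auto simp: support_def point_outside)
    then show ?thesis by simp
  qed (use degree_rational_function in blast)
  have "support h \<subseteq> support (to_ac A) \<union> support (to_ac B) \<union> support (to_ac F) \<union> support (to_ac (norm h))"
  proof
    fix P assume "P \<in> support h"
    then have P: "P \<in> points f" "P h \<noteq> 0" by (auto simp: support_def)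
    interpret valued_field K P using P(1) by (rule point_valued_field)
    show "P \<in> support (to_ac A) \<union> support (to_ac B) \<union> support (to_ac F) \<union> support (to_ac (norm h))"
    proof (rule ccontr)
      assume "\<not> ?thesis"
      then have zero: "P (to_ac A) = 0" "P (to_ac B) = 0" "P (to_ac F) = 0" "P (to_ac (norm h)) = 0"
        using P(1) by (auto simp: support_def)
      then have "P y = 0" using point_y[OF P(1)] by simp
      then have ge: "v_ge 0 (to_ac A)" "v_ge 0 (to_ac B)" "v_ge 0 y" using zero by (auto simp: v_ge_def)
      then have By: "v_ge (0 + 0) (to_ac B * y)" by (intro v_ge_mult to_ac_mem y_mem)
      have "v_ge 0 (to_ac A + to_ac B * y)" "v_ge 0 (to_ac A - to_ac B * y)"
        using By ge by (auto intro!: v_ge_add v_ge_diff K.mult_mem)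
      then have "v_ge 0 h" "v_ge 0 (conj h)" unfolding h conj_el by (simp_all add: el_def)
      then have "P h \<ge> 0" "P (conj h) \<ge> 0" using assms by (auto simp: v_ge_def)
      then show False using point_norm[OF P(1) assms] zero P(2) by simp
    qed
  qed
  then show ?thesis using fin finite_subset by (metis finite_UnI)
qed

lemma conj_comp_conj [simp]: "P \<circ> conj \<circ> conj = P" for P :: "'b ambient \<Rightarrow> int"
  by (simp add: fun_eq_iff)

text \<open>A function and its conjugate have the same degree, and their product is a rational function.\<close>

lemma degree_function:
  assumes "h \<in> K" "h \<noteq> 0"
  shows "(\<Sum>P\<in>support h. P h) = 0"
proof -
  let ?S = "support h \<union> support (conj h)"
  have fin: "finite ?S" using assms by (auto intro: finite_support)
  have pts: "?S \<subseteq> points f" by (auto simp: support_def)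
  have closed: "P \<circ> conj \<in> ?S" if "P \<in> ?S" for P
    using that point_conj[of P] by (auto simp: support_def)
  have N: "norm h \<noteq> 0" using assms by simp
  have "(\<Sum>P\<in>?S. P (conj h)) = (\<Sum>P\<in>?S. P h)"
    by (rule sum.reindex_bij_witness[of _ "\<lambda>P. P \<circ> conj" "\<lambda>P. P \<circ> conj"]) (use closed in auto)
  then have "2 * (\<Sum>P\<in>?S. P h) = (\<Sum>P\<in>?S. P h + P (conj h))"
    by (simp add: sum.distrib)
  also have "\<dots> = (\<Sum>P\<in>?S. P (to_ac (norm h)))"
    using point_norm[OF _ assms] pts by (intro sum.cong) auto
  also have "\<dots> = (\<Sum>P\<in>support (to_ac (norm h)). P (to_ac (norm h)))"
  proof (intro support_sum_superset[symmetric] fin pts subsetI)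
    fix P assume "P \<in> support (to_ac (norm h))"
    then show "P \<in> ?S" using point_norm[of P h] assms by (auto simp: support_def)
  qed
  also have "\<dots> = 0" using degree_rational_function[OF N] by simp
  finally show ?thesis using fin pts by (simp add: support_sum_superset[of ?S])
qed


section \<open>Principal divisors\<close>

definition has_divisor :: "'b ambient \<Rightarrow> (('b ambient \<Rightarrow> int) \<Rightarrow>\<^sub>0 int) \<Rightarrow> bool" where
  "has_divisor h D \<longleftrightarrow> h \<in> K \<and> h \<noteq> 0 \<and> Poly_Mapping.keys D \<subseteq> points f \<and>
     (\<forall>P\<in>points f. Poly_Mapping.lookup D P = P h)"

lemma principal_iff: "D \<in> principal_divisors f \<longleftrightarrow> (\<exists>h. has_divisor h D)"
  by (auto simp: principal_divisors_def has_divisor_def function_field_eq)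

lemma has_divisor_exists:
  assumes "h \<in> K" "h \<noteq> 0"
  obtains D where "has_divisor h D"
proof -
  define D where "D = Abs_poly_mapping (\<lambda>P. if P \<in> points f then P h else 0)"
  have "{P. (if P \<in> points f then P h else 0) \<noteq> 0} = support h" by (auto simp: support_def)
  then have "finite {P. (if P \<in> points f then P h else 0) \<noteq> 0}" using finite_support[OF assms] by simp
  then have lookup: "Poly_Mapping.lookup D P = (if P \<in> points f then P h else 0)" for P
    unfolding D_def by (simp only: lookup_Abs_poly_mapping)
  have "P \<in> points f" if "P \<in> Poly_Mapping.keys D" for P
    using that lookup[of P] by (auto simp: in_keys_iff split: if_splits)
  then have "has_divisor h D" using assms lookup by (auto simp: has_divisor_def)
  then show ?thesis by (rule that)
qed

lemma has_divisor_degree: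
  assumes "has_divisor h D"
  shows "divisor_degree D = 0"
proof -
  have h: "h \<in> K" "h \<noteq> 0" and D: "Poly_Mapping.keys D \<subseteq> points f"
    "\<And>P. P \<in> points f \<Longrightarrow> Poly_Mapping.lookup D P = P h"
    using assms by (auto simp: has_divisor_def)
  have "Poly_Mapping.keys D = support h"
    using D by (auto simp: support_def in_keys_iff)
  then have "divisor_degree D = (\<Sum>P\<in>support h. P h)"
    unfolding divisor_degree_def using D(2) by (intro sum.cong) (auto simp: support_def)
  then show ?thesis using degree_function[OF h] by simp
qed

lemma has_divisor_mult: "has_divisor h D \<Longrightarrow> has_divisor h' D' \<Longrightarrow> has_divisor (h * h') (D + D')"
  using keys_add[of D D']
  by (auto simp: has_divisor_def lookup_add K.mult_mem valued_field.v_mult[OF point_valued_field])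

lemma has_divisor_inverse: "has_divisor h D \<Longrightarrow> has_divisor (inverse h) (- D)"
  by (auto simp: has_divisor_def K.inverse_mem valued_field.v_inverse[OF point_valued_field])

lemma has_divisor_power: "has_divisor h D \<Longrightarrow> has_divisor (h powi n) (frag_cmul n D)"
  using keys_cmul[of n D]
  by (auto simp: has_divisor_def K.power_int_mem valued_field.v_power_int[OF point_valued_field])

lemma has_divisor_1: "has_divisor 1 0"
  by (auto simp: has_divisor_def valued_field.v_one[OF point_valued_field])

lemma principal_0 [simp]: "0 \<in> principal_divisors f"
  using has_divisor_1 by (auto simp: principal_iff)

lemma principal_add:
  "D \<in> principal_divisors f \<Longrightarrow> D' \<in> principal_divisors f \<Longrightarrow> D + D' \<in> principal_divisors f"
  unfolding principal_iff by (blast intro: has_divisor_mult)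

lemma principal_minus: "D \<in> principal_divisors f \<Longrightarrow> - D \<in> principal_divisors f"
  unfolding principal_iff by (blast intro: has_divisor_inverse)

lemma principal_cmul: "D \<in> principal_divisors f \<Longrightarrow> frag_cmul n D \<in> principal_divisors f"
  unfolding principal_iff by (blast intro: has_divisor_power)

lemma principal_sum: "(\<And>i. i \<in> I \<Longrightarrow> D i \<in> principal_divisors f) \<Longrightarrow> sum D I \<in> principal_divisors f"
  by (induction I rule: infinite_finite_induct) (auto intro: principal_add)

lemma rational_no_poles_const:
  assumes "\<And>P. P \<in> points f \<Longrightarrow> P (to_ac r) \<ge> 0"
  shows "\<exists>c. r = ratc c"
proof (rule fract_const_if_ord_nonneg)
  fix a
  obtain P where P: "P \<in> points f" "P (xm a) > 0" using exists_point_over by blast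
  then show "ord_at.v_ge a 0 r"
    using point_at_finite[OF P, of r] assms[OF P(1)]
    by (cases "r = 0") (auto simp: ord_at.v_ge_def zero_le_mult_iff)
next
  show "ord_inf.v_ge 0 r"
    using P_inf_to_ac[of r] assms[OF P_inf_point] by (cases "r = 0") (auto simp: ord_inf.v_ge_def)
qed

text \<open>The trace \<open>2 A\<close> and the norm \<open>A\<^sup>2 - B\<^sup>2 f\<close> have no poles and are constant. So \<open>B\<^sup>2 f\<close> is constant,
  and \<open>B = 0\<close> because the order of \<open>f\<close> at infinity is odd.\<close>

lemma trivial_divisor_const:
  assumes h: "h \<in> K" "h \<noteq> 0" and triv: "\<And>P. P \<in> points f \<Longrightarrow> P h = 0"
  shows "\<exists>c. h = const c"
proof -
  obtain A B where el: "h = el A B" using h(1) by (rule K_cases)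
  have "P (to_ac (2 * A)) \<ge> 0" if P: "P \<in> points f" for P
  proof -
    interpret valued_field K P using P by (rule point_valued_field)
    have "P (conj h) = 0" using triv[OF point_conj[OF P]] by simp
    then have "v_ge 0 (h + conj h)" using triv[OF P] h by (intro v_ge_add) (auto simp: v_ge_def)
    moreover have "h + conj h = to_ac (2 * A)" unfolding el conj_el el_add by (simp add: to_ac_el)
    ultimately show ?thesis using point_outside[OF P, of 0] by (auto simp: v_ge_def)
  qed
  then obtain c where c: "2 * A = ratc c" using rational_no_poles_const by blast
  have "A = ratc (c / 2)"
  proof -
    have "ratc 2 * A = ratc c" using c by (simp only: ratc_2)
    also have "ratc c = ratc 2 * ratc (c / 2)" using two_neq_zero by (simp flip: to_fract_mult)
    finally show ?thesis using two_neq_zero by simp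
  qed
  have "P (to_ac (norm h)) \<ge> 0" if P: "P \<in> points f" for P
    using point_norm[OF P h] triv[OF P] triv[OF point_conj[OF P]] by simp
  then obtain d where d: "norm h = ratc d" using rational_no_poles_const by blast
  have "B ^ 2 * F = A ^ 2 - norm h" by (simp add: el)
  also have "\<dots> = ratc ((c / 2) ^ 2 - d)"
    unfolding d \<open>A = _\<close> by (simp add: power2_eq_square flip: to_fract_mult to_fract_diff)
  finally have BF: "B ^ 2 * F = ratc ((c / 2) ^ 2 - d)" .
  have "B = 0"
  proof (rule ccontr)
    assume "B \<noteq> 0"
    then have "ord_inf (B ^ 2 * F) = 2 * ord_inf B + ord_inf F" by (simp add: ord_inf.v_mult ord_inf.v_power)
    moreover have "B ^ 2 * F \<noteq> 0" using \<open>B \<noteq> 0\<close> by simp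
    then have "ord_inf (B ^ 2 * F) = 0" unfolding BF by (intro ord_inf_ratc) auto
    ultimately show False using odd_ord_inf_F by presburger
  qed
  then show ?thesis using el \<open>A = _\<close> by (intro exI[of _ "c / 2"]) (simp add: const_el)
qed


section \<open>The classes of the ramified points\<close>

definition roots :: "'b set" where "roots = {a. poly f a = 0}"

lemma finite_roots [simp]: "finite roots"
  unfolding roots_def by (intro poly_roots_finite f_neq_0)

definition base :: "'b \<Rightarrow> ('b ambient \<Rightarrow> int) \<Rightarrow>\<^sub>0 int" where
  "base a = frag_of (P_root a) - frag_of P_inf"

lemma P_root_eq_iff [simp]: "P_root a = P_root b \<longleftrightarrow> a = b"
proof
  assume "P_root a = P_root b"
  then have "P_root a (xm a) = P_root b (xm a)" by simp
  then show "a = b" by (simp add: P_root_to_ac split: if_splits)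
qed simp

lemma lookup_base:
  "Poly_Mapping.lookup (base a) P = (if P = P_root a then 1 else 0) - (if P = P_inf then 1 else 0)"
  by (auto simp: base_def lookup_minus)

lemma keys_base: "a \<in> roots \<Longrightarrow> Poly_Mapping.keys (base a) \<subseteq> points f"
  using P_root_point P_inf_point unfolding base_def roots_def
  by (intro keys_diff_subset) auto

lemma degree_base [simp]: "divisor_degree (base a) = 0"
  by (simp add: base_def divisor_degree_diff)

definition combination :: "('b \<Rightarrow> int) \<Rightarrow> ('b ambient \<Rightarrow> int) \<Rightarrow>\<^sub>0 int" where
  "combination x = (\<Sum>a\<in>roots. frag_cmul (x a) (base a))"

lemma keys_combination: "Poly_Mapping.keys (combination x) \<subseteq> points f"
  unfolding combination_def by (intro keys_sum_subset keys_cmul_subset keys_base)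

lemma degree_combination [simp]: "divisor_degree (combination x) = 0"
  by (simp add: combination_def divisor_degree_sum divisor_degree_cmul)

lemma lookup_combination:
  assumes "P \<noteq> P_inf"
  shows "Poly_Mapping.lookup (combination x) P = (\<Sum>a\<in>roots. if P = P_root a then x a else 0)"
  unfolding combination_def lookup_sum' lookup_frag_cmul lookup_base
  using assms by (intro sum.cong) auto

lemma lookup_combination_root: "a \<in> roots \<Longrightarrow> Poly_Mapping.lookup (combination x) (P_root a) = x a"
  by (simp add: lookup_combination P_root_neq_inf)

lemma lookup_combination_other:
  assumes "P \<noteq> P_inf" "\<And>a. a \<in> roots \<Longrightarrow> P \<noteq> P_root a"
  shows "Poly_Mapping.lookup (combination x) P = 0"
  unfolding lookup_combination[OF assms(1)] using assms(2) by (intro sum.neutral) auto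

lemma combination_add: "combination (\<lambda>a. x a + x' a) = combination x + combination x'"
  by (simp add: combination_def frag_cmul_distrib sum.distrib)

lemma combination_cmul: "combination (\<lambda>a. n * x a) = frag_cmul n (combination x)"
  by (simp add: combination_def frag_cmul_sum)

text \<open>The degree determines the coefficient at infinity from the others.\<close>

lemma divisor_eqI:
  fixes D D' :: "('b ambient \<Rightarrow> int) \<Rightarrow>\<^sub>0 int"
  assumes "Poly_Mapping.keys D \<subseteq> points f" "Poly_Mapping.keys D' \<subseteq> points f"
    and "divisor_degree D = divisor_degree D'"
    and eq: "\<And>P. P \<in> points f \<Longrightarrow> P \<noteq> P_inf \<Longrightarrow> Poly_Mapping.lookup D P = Poly_Mapping.lookup D' P"
  shows "D = D'"
proof -
  have "Poly_Mapping.lookup (D - D') P = 0" if "P \<noteq> P_inf" for P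
  proof (cases "P \<in> points f")
    case True
    then show ?thesis using eq that by (simp add: lookup_minus)
  next
    case False
    then have "P \<notin> Poly_Mapping.keys D" "P \<notin> Poly_Mapping.keys D'" using assms by auto
    then show ?thesis by (simp add: lookup_minus in_keys_iff)
  qed
  then have "Poly_Mapping.keys (D - D') \<subseteq> {P_inf}" by (auto simp: in_keys_iff)
  then have "divisor_degree (D - D') = Poly_Mapping.lookup (D - D') P_inf"
    by (subst divisor_degree_superset[of "{P_inf}"]) auto
  then have "Poly_Mapping.lookup (D - D') P_inf = 0" using assms by (simp add: divisor_degree_diff)
  then have "Poly_Mapping.lookup (D - D') P = 0" for P
    using \<open>\<And>P. P \<noteq> P_inf \<Longrightarrow> Poly_Mapping.lookup (D - D') P = 0\<close> by (cases "P = P_inf") auto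
  then have "D - D' = 0" by (intro poly_mapping_eqI) simp
  then show ?thesis by simp
qed

lemma has_divisorI:
  assumes "h \<in> K" "h \<noteq> 0" "Poly_Mapping.keys D \<subseteq> points f" "divisor_degree D = 0"
    and "\<And>P. P \<in> points f \<Longrightarrow> P \<noteq> P_inf \<Longrightarrow> Poly_Mapping.lookup D P = P h"
  shows "has_divisor h D"
proof -
  obtain D' where D': "has_divisor h D'" using assms(1,2) by (rule has_divisor_exists)
  have "D = D'"
    by (rule divisor_eqI) (use assms D' has_divisor_degree[OF D'] in \<open>auto simp: has_divisor_def\<close>)
  then show ?thesis using D' by simp
qed

lemma finite_point_cases:
  assumes P: "P \<in> points f" "P \<noteq> P_inf"
  obtains (root) a where "a \<in> roots" "P = P_root a" | (nonroot) a where "poly f a \<noteq> 0" "P (xm a) = 1"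
proof -
  from P(1) show ?thesis
  proof (cases rule: point_cases)
    case 1
    then show ?thesis using P_inf_unique P by blast
  next
    case (2 a)
    show ?thesis
    proof (cases "poly f a = 0")
      case True
      then show ?thesis using root[of a] P_root_unique[OF P(1) 2] by (simp add: roots_def)
    next
      case False
      obtain Q where "Q (xm a) = 1" "P = Q \<or> P = Q \<circ> conj"
        using points_over_nonroot[OF False] P(1) 2 by metis
      then have "P (xm a) = 1" by auto
      then show ?thesis using nonroot False by blast
    qed
  qed
qed

lemma P_root_xm: "P_root a (xm b) = (if a = b then 2 else 0)"
  by (simp add: P_root_to_ac)

lemma has_divisor_xm_root:
  assumes a: "a \<in> roots"
  shows "has_divisor (xm a) (frag_cmul 2 (base a))"
proof (rule has_divisorI)
  fix P assume P: "P \<in> points f" "P \<noteq> P_inf"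
  then show "Poly_Mapping.lookup (frag_cmul 2 (base a)) P = P (xm a)"
  proof (cases rule: finite_point_cases)
    case (root b)
    then show ?thesis using P by (auto simp: lookup_base P_root_xm)
  next
    case (nonroot b)
    then have ab: "a \<noteq> b" using a by (auto simp: roots_def)
    moreover have "P \<noteq> P_root a" using nonroot(2) ab by (auto simp: P_root_xm)
    ultimately show ?thesis
      using P nonroot(2) point_xm_pos_unique[OF P(1), of b a] by (simp add: lookup_base)
  qed
qed (use a in \<open>auto simp: divisor_degree_cmul intro!: keys_cmul_subset keys_base\<close>)

lemma principal_2_base: "a \<in> roots \<Longrightarrow> frag_cmul 2 (base a) \<in> principal_divisors f"
  using has_divisor_xm_root principal_iff by blast

lemma has_divisor_y: "has_divisor y (combination (\<lambda>a. 1))"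
proof (rule has_divisorI)
  fix P assume P: "P \<in> points f" "P \<noteq> P_inf"
  then show "Poly_Mapping.lookup (combination (\<lambda>a. 1)) P = P y"
  proof (cases rule: finite_point_cases)
    case (root b)
    then show ?thesis using P_root_y[of b] by (simp add: lookup_combination_root) (simp add: roots_def)
  next
    case (nonroot b)
    have "P \<noteq> P_root a" if "a \<in> roots" for a
      using nonroot that by (auto simp: P_root_xm roots_def split: if_splits)
    then have "Poly_Mapping.lookup (combination (\<lambda>a. 1)) P = 0"
      using P by (intro lookup_combination_other)
    moreover have "P (to_ac F) = 0"
      using point_at_finite[OF P(1), of b F] nonroot by (simp add: ord_at_F)
    ultimately show ?thesis using point_y[OF P(1)] by simp
  qed
qed (auto simp: keys_combination)

lemma principal_combination_1: "combination (\<lambda>a. 1) \<in> principal_divisors f"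
  using has_divisor_y principal_iff by blast

text \<open>The only relations: a function whose divisor is supported on the ramified points is a constant
  multiple of its conjugate, hence a rational function or \<open>y\<close> times a rational function, and its
  orders at the finite ramified points are all even or all odd.\<close>

lemma combination_parity:
  assumes "combination x \<in> principal_divisors f"
  shows "(\<forall>a\<in>roots. even (x a)) \<or> (\<forall>a\<in>roots. odd (x a))"
proof -
  obtain h where "has_divisor h (combination x)" using assms by (auto simp: principal_iff)
  then have h: "h \<in> K" "h \<noteq> 0" and ord: "\<And>P. P \<in> points f \<Longrightarrow> Poly_Mapping.lookup (combination x) P = P h"
    by (auto simp: has_divisor_def)
  have inv: "P (conj h) = P h" if P: "P \<in> points f" for P
  proof (cases "P \<circ> conj = P")
    case True
    then show ?thesis by (metis comp_apply)
  next
    case False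
    then have "P \<noteq> P_inf" "P \<circ> conj \<noteq> P_inf" "P \<noteq> P_root a" "P \<circ> conj \<noteq> P_root a" for a
      using P_inf_conj P_root_conj by (metis conj_comp_conj)+
    then have "Poly_Mapping.lookup (combination x) P = 0" "Poly_Mapping.lookup (combination x) (P \<circ> conj) = 0"
      by (intro lookup_combination_other; blast)+
    then show ?thesis using ord[OF P] ord[OF point_conj[OF P]] by simp
  qed
  have "conj h / h \<in> K" "conj h / h \<noteq> 0" using h by auto
  moreover have "P (conj h / h) = 0" if P: "P \<in> points f" for P
    using valued_field.v_divide[OF point_valued_field[OF P], of "conj h" h] h inv[OF P] by simp
  ultimately obtain c where "conj h / h = const c" using trivial_divisor_const by blast
  then have c: "conj h = const c * h" using h by (simp add: divide_eq_eq)
  obtain A B where el: "h = el A B" using h(1) by (rule K_cases)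
  have AB: "A = ratc c * A" "- B = ratc c * B"
    using c unfolding el conj_el by (simp_all add: const_el el_mult)
  have "A = 0 \<or> B = 0"
  proof (rule ccontr)
    assume "\<not> (A = 0 \<or> B = 0)"
    then have "ratc c = 1" "ratc c = - 1" using AB by (simp_all add: eq_commute[of "- B"])
    then have c: "ratc c - ratc c = 1 - (- 1)" by (simp only:)
    have "ratc (2 :: 'b) = 1 - (- 1)" by (simp add: ratc_2)
    also have "\<dots> = 0" unfolding c[symmetric] by simp
    finally have "ratc (2 :: 'b) = 0" .
    then show False using two_neq_zero by simp
  qed
  then consider "A \<noteq> 0" "B = 0" | "A = 0" "B \<noteq> 0" using h el by auto
  then show ?thesis
  proof cases
    case 1
    have "x a = 2 * ord_at a A" if "a \<in> roots" for a
    proof -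
      have "x a = P_root a h" using ord[of "P_root a"] that P_root_point
        by (simp add: lookup_combination_root) (simp add: roots_def)
      then show ?thesis using 1 by (simp add: el P_root_to_ac flip: to_ac_el)
    qed
    then show ?thesis by simp
  next
    case 2
    have "x a = 2 * ord_at a B + 1" if a: "a \<in> roots" for a
    proof -
      have P: "P_root a \<in> points f" using a P_root_point by (simp add: roots_def)
      have "x a = P_root a h" using ord[OF P] a by (simp add: lookup_combination_root)
      moreover have "h = to_ac B * y" using 2 by (simp add: el el_def)
      ultimately show ?thesis
        using 2 a P_root_y[of a] valued_field.v_mult[OF point_valued_field[OF P], of "to_ac B" y]
        by (simp add: P_root_to_ac roots_def)
    qed
    then show ?thesis by simp
  qed
qed

text \<open>A divisor that is invariant under the involution is a combination of ramified points and of
  orbits of two points; the latter are equivalent to multiples of the point at infinity.\<close>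

lemma invariant_divisor_class:
  assumes keys: "Poly_Mapping.keys D \<subseteq> points f" and deg: "divisor_degree D = 0"
    and inv: "\<And>P. P \<in> points f \<Longrightarrow> Poly_Mapping.lookup D (P \<circ> conj) = Poly_Mapping.lookup D P"
  shows "\<exists>x. D - combination x \<in> principal_divisors f"
proof -
  define x where "x a = Poly_Mapping.lookup D (P_root a)" for a
  define Q where "Q a = (SOME P. P \<in> points f \<and> P (xm a) > 0)" for a
  define S where "S = {a. poly f a \<noteq> 0 \<and> (\<exists>P\<in>Poly_Mapping.keys D. P (xm a) > 0)}"
  define r where "r = (\<Prod>a\<in>S. lin a powi Poly_Mapping.lookup D (Q a))"
  have Q: "Q a \<in> points f" "Q a (xm a) > 0" for a
  proof -
    have "\<exists>P. P \<in> points f \<and> P (xm a) > 0" using exists_point_over by blast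
    from someI_ex[OF this] show "Q a \<in> points f" "Q a (xm a) > 0" by (auto simp: Q_def)
  qed
  have "finite S"
  proof (rule finite_subset)
    show "S \<subseteq> (\<lambda>P. THE a. P (xm a) > 0) ` Poly_Mapping.keys D"
    proof
      fix a assume "a \<in> S"
      then obtain P where P: "P \<in> Poly_Mapping.keys D" "P (xm a) > 0" by (auto simp: S_def)
      have "(THE a. P (xm a) > 0) = a"
      proof (rule the_equality)
        fix b assume "P (xm b) > 0"
        then show "b = a" using P keys point_xm_pos_unique[of P a b] by (cases "b = a") auto
      qed (rule P)
      then show "a \<in> (\<lambda>P. THE a. P (xm a) > 0) ` Poly_Mapping.keys D"
        using P(1) by (intro image_eqI[where x = P]) simp_all
    qed
  qed simp
  have r: "r \<noteq> 0" using \<open>finite S\<close> by (simp add: r_def)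
  have Pr: "P (to_ac r) = (\<Sum>a\<in>S. Poly_Mapping.lookup D (Q a) * P (xm a))" if P: "P \<in> points f" for P
  proof -
    interpret rat: valued_field UNIV "\<lambda>r. P (to_ac r)" using P by (rule point_restrict)
    show ?thesis unfolding r_def by (subst rat.v_prod) (auto simp: rat.v_power_int)
  qed
  have "has_divisor (to_ac r) (D - combination x)"
  proof (rule has_divisorI)
    fix P assume P: "P \<in> points f" "P \<noteq> P_inf"
    then show "Poly_Mapping.lookup (D - combination x) P = P (to_ac r)"
    proof (cases rule: finite_point_cases)
      case (root a)
      have "P (to_ac r) = 0"
        unfolding Pr[OF P(1)] using root by (intro sum.neutral) (auto simp: P_root_xm S_def roots_def)
      then show ?thesis using root by (simp add: lookup_minus lookup_combination_root x_def)
    next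
      case (nonroot b)
      have "P \<noteq> P_root a" if "a \<in> roots" for a
        using nonroot that by (auto simp: P_root_xm roots_def split: if_splits)
      then have comb: "Poly_Mapping.lookup (combination x) P = 0"
        using P by (intro lookup_combination_other)
      have "P (to_ac r) = (\<Sum>a\<in>S. if a = b then Poly_Mapping.lookup D (Q b) else 0)"
        unfolding Pr[OF P(1)] using nonroot(2) point_xm_pos_unique[OF P(1), of b]
        by (intro sum.cong) auto
      then have Prb: "P (to_ac r) = (if b \<in> S then Poly_Mapping.lookup D (Q b) else 0)"
        using \<open>finite S\<close> by simp
      have "Poly_Mapping.lookup D P = (if b \<in> S then Poly_Mapping.lookup D (Q b) else 0)"
      proof (cases "b \<in> S")
        case True
        obtain R where R: "R \<in> points f" "P = R \<or> P = R \<circ> conj" "Q b = R \<or> Q b = R \<circ> conj"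
          using points_over_nonroot[OF nonroot(1)] P(1) nonroot(2) Q[of b] by (metis zero_less_one)
        then have "Poly_Mapping.lookup D P = Poly_Mapping.lookup D R" "Poly_Mapping.lookup D (Q b) = Poly_Mapping.lookup D R"
          using inv[OF R(1)] by auto
        then show ?thesis using True by simp
      next
        case False
        then have "P \<notin> Poly_Mapping.keys D" using nonroot by (auto simp: S_def)
        then show ?thesis using False by (simp add: in_keys_iff)
      qed
      then show ?thesis using comb Prb by (simp add: lookup_minus)
    qed
  next
    show "Poly_Mapping.keys (D - combination x) \<subseteq> points f"
      using keys keys_combination by (rule keys_diff_subset)
  qed (use r deg in \<open>auto simp: divisor_degree_diff\<close>)
  then show ?thesis using principal_iff by blast
qed

text \<open>If \<open>2D = div h\<close>, the norm of \<open>h\<close> has even order everywhere and is a square \<open>r\<^sup>2\<close>. Then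
  \<open>h / r\<close> has norm one, and Hilbert's Theorem 90 writes it as \<open>u / \<sigma>(u)\<close> for the involution
  \<open>\<sigma>\<close>. This makes \<open>D - div u\<close> invariant under \<open>\<sigma>\<close>.\<close>

lemma two_torsion_divisor_class:
  assumes keys: "Poly_Mapping.keys D \<subseteq> points f" and deg: "divisor_degree D = 0"
    and tors: "frag_cmul 2 D \<in> principal_divisors f"
  shows "\<exists>x. D - combination x \<in> principal_divisors f"
proof -
  obtain h where "has_divisor h (frag_cmul 2 D)" using tors by (auto simp: principal_iff)
  then have h: "h \<in> K" "h \<noteq> 0" and ord: "\<And>P. P \<in> points f \<Longrightarrow> 2 * Poly_Mapping.lookup D P = P h"
    by (auto simp: has_divisor_def)
  have N0: "norm h \<noteq> 0" using h by simp
  have PN: "P (to_ac (norm h)) = 2 * (Poly_Mapping.lookup D P + Poly_Mapping.lookup D (P \<circ> conj))"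
    if P: "P \<in> points f" for P
    using point_norm[OF P h] ord[OF P] ord[OF point_conj[OF P]] by simp
  have "even (ord_at a (norm h))" for a
  proof (cases "poly f a = 0")
    case True
    show ?thesis
      using PN[OF P_root_point[OF True]] N0 by (simp add: P_root_to_ac P_root_conj)
  next
    case False
    obtain R where R: "R \<in> points f" "R (xm a) = 1" using points_over_nonroot[OF False] by metis
    then have "R (to_ac (norm h)) = ord_at a (norm h)" using point_at_finite[OF R(1), of a "norm h"] N0 by simp
    then have "ord_at a (norm h) = 2 * (Poly_Mapping.lookup D R + Poly_Mapping.lookup D (R \<circ> conj))"
      using PN[OF R(1)] by simp
    then show ?thesis by (metis dvd_triv_left)
  qed
  then obtain r where r: "norm h = r ^ 2" using fract_square_if_even_orders N0 by blast
  have r0: "r \<noteq> 0" using N0 r by auto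
  have Pr: "P (to_ac r) = Poly_Mapping.lookup D P + Poly_Mapping.lookup D (P \<circ> conj)" if P: "P \<in> points f" for P
    using PN[OF P] valued_field.v_power[OF point_restrict[OF P], of r 2] r0 unfolding r by simp
  define w where "w = h / to_ac r"
  have w: "w \<in> K" "w \<noteq> 0" using h r0 by (auto simp: w_def)
  have hw: "h = w * to_ac r" using r0 by (simp add: w_def)
  have "w * conj w * to_ac r ^ 2 = h * conj h"
    using w(1) unfolding hw by (simp add: conj_mult power2_eq_square)
  then have "w * conj w = 1" using mult_conj[OF h(1)] r r0 by simp
  \<comment> \<open>For \<open>w = - 1\<close> the usual solution \<open>1 + w\<close> vanishes, but \<open>\<sigma>(y) = - y\<close>.\<close>
  obtain u where u: "u \<in> K" "u \<noteq> 0" "w * conj u = u"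
  proof (cases "w = - 1")
    case True
    then show ?thesis using that[of y] by simp
  next
    case False
    have "1 + w \<noteq> 0" using False by (metis add.commute eq_neg_iff_add_eq_0)
    moreover have "w * conj (1 + w) = 1 + w"
      using w(1) \<open>w * conj w = 1\<close> by (simp add: conj_add distrib_left add.commute)
    ultimately show ?thesis using that[of "1 + w"] w(1) by auto
  qed
  obtain U where U: "has_divisor u U" using u(1,2) by (rule has_divisor_exists)
  have invariant: "Poly_Mapping.lookup (D - U) (P \<circ> conj) = Poly_Mapping.lookup (D - U) P" if P: "P \<in> points f" for P
  proof -
    interpret valued_field K P using P by (rule point_valued_field)
    have "P w + P (conj u) = P u" using v_mult[of w "conj u"] w u by simp
    moreover have "P h = P w + P (to_ac r)" using w r0 unfolding hw by (simp add: v_mult)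
    moreover have "Poly_Mapping.lookup U P = P u" "Poly_Mapping.lookup U (P \<circ> conj) = P (conj u)"
      using U P point_conj[OF P] by (auto simp: has_divisor_def)
    ultimately show ?thesis using ord[OF P] Pr[OF P] by (simp add: lookup_minus)
  qed
  have "Poly_Mapping.keys U \<subseteq> points f" using U by (simp add: has_divisor_def)
  then obtain x where x: "D - U - combination x \<in> principal_divisors f"
    using invariant_divisor_class[of "D - U"] keys deg has_divisor_degree[OF U] invariant
    by (auto simp: divisor_degree_diff keys_diff_subset)
  have "U \<in> principal_divisors f" using U principal_iff by blast
  then have "(D - U - combination x) + U \<in> principal_divisors f" using x by (rule principal_add[rotated])
  then show ?thesis by (auto simp: algebra_simps)
qed

section \<open>The two-torsion of the Jacobian\<close>

lemma divisors0_carrier: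
  "D \<in> carrier (divisors0 f) \<longleftrightarrow> Poly_Mapping.keys D \<subseteq> points f \<and> divisor_degree D = 0"
  by (simp add: divisors0_def)

lemma divisors0_simps [simp]:
  "D \<otimes>\<^bsub>divisors0 f\<^esub> D' = D + D'" "\<one>\<^bsub>divisors0 f\<^esub> = 0"
  by (simp_all add: divisors0_def)

lemma keys_add_subset:
  "Poly_Mapping.keys D \<subseteq> S \<Longrightarrow> Poly_Mapping.keys D' \<subseteq> S \<Longrightarrow> Poly_Mapping.keys (D + D') \<subseteq> S"
  for D :: "'p \<Rightarrow>\<^sub>0 int"
  using keys_add[of D D'] by blast

lemma comm_group_divisors0: "comm_group (divisors0 f)"
proof (rule comm_groupI)
  fix D assume "D \<in> carrier (divisors0 f)"
  then show "\<exists>D'\<in>carrier (divisors0 f). D' \<otimes>\<^bsub>divisors0 f\<^esub> D = \<one>\<^bsub>divisors0 f\<^esub>"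
    by (intro bexI[of _ "- D"]) (auto simp: divisors0_carrier divisor_degree_minus)
qed (auto simp: divisors0_carrier divisor_degree_add keys_add_subset add.assoc add.commute
    intro: keys_add_subset[THEN subsetD])

sublocale divs: comm_group "divisors0 f"
  by (rule comm_group_divisors0)

lemma divisors0_inv: "D \<in> carrier (divisors0 f) \<Longrightarrow> inv\<^bsub>divisors0 f\<^esub> D = - D"
  by (rule divs.inv_equality) (auto simp: divisors0_carrier divisor_degree_minus)

lemma principal_divisors0: "D \<in> principal_divisors f \<Longrightarrow> D \<in> carrier (divisors0 f)"
  using has_divisor_degree by (auto simp: principal_iff divisors0_carrier has_divisor_def)

lemma subgroup_principal: "subgroup (principal_divisors f) (divisors0 f)"
  by (rule divs.subgroupI)
    (auto simp: principal_divisors0 divisors0_inv principal_minus principal_add intro: principal_0)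

sublocale jac: comm_group "jacobian f"
  unfolding jacobian_def using subgroup_principal by (rule divs.abelian_FactGroup)

abbreviation cls where "cls \<equiv> divisor_class f"

sublocale cls: group_hom "divisors0 f" "jacobian f" cls
proof -
  have "principal_divisors f \<lhd> divisors0 f"
    using subgroup_principal by (rule divs.subgroup_imp_normal)
  then have "(\<lambda>D. cls D) \<in> hom (divisors0 f) (jacobian f)"
    unfolding jacobian_def divisor_class_def by (rule normal.r_coset_hom_Mod)
  then show "group_hom (divisors0 f) (jacobian f) cls"
    by (simp add: group_hom_def group_hom_axioms_def divs.is_group jac.is_group)
qed

lemma carrier_jacobian: "carrier (jacobian f) = cls ` carrier (divisors0 f)"
  by (simp add: jacobian_def carrier_FactGroup divisor_class_def)

lemma cls_eq_one_iff:
  assumes "D \<in> carrier (divisors0 f)"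
  shows "cls D = \<one>\<^bsub>jacobian f\<^esub> \<longleftrightarrow> D \<in> principal_divisors f"
  using divs.coset_join1[OF _ assms subgroup_principal] divs.coset_join2[OF assms subgroup_principal]
  by (auto simp: jacobian_def divisor_class_def)

lemma divisors0_diff:
  "D \<in> carrier (divisors0 f) \<Longrightarrow> D' \<in> carrier (divisors0 f) \<Longrightarrow> D - D' \<in> carrier (divisors0 f)"
  by (auto simp: divisors0_carrier divisor_degree_diff dest: subsetD[OF keys_diff])

lemma divisors0_cmul: "D \<in> carrier (divisors0 f) \<Longrightarrow> frag_cmul n D \<in> carrier (divisors0 f)"
  using keys_cmul[of n D] by (auto simp: divisors0_carrier divisor_degree_cmul)

lemma cls_add:
  "D \<in> carrier (divisors0 f) \<Longrightarrow> D' \<in> carrier (divisors0 f) \<Longrightarrow> cls (D + D') = cls D \<otimes>\<^bsub>jacobian f\<^esub> cls D'"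
  using cls.hom_mult by simp

lemma cls_eq_iff:
  assumes "D \<in> carrier (divisors0 f)" "D' \<in> carrier (divisors0 f)"
  shows "cls D = cls D' \<longleftrightarrow> D - D' \<in> principal_divisors f"
proof -
  have "cls D = cls (D - D') \<otimes>\<^bsub>jacobian f\<^esub> cls D'"
    using cls_add[OF divisors0_diff[OF assms] assms(2)] by simp
  then have "cls D = cls D' \<longleftrightarrow> cls (D - D') = \<one>\<^bsub>jacobian f\<^esub>"
    using assms divisors0_diff[OF assms] cls.hom_closed by (metis jac.r_cancel_one')
  then show ?thesis using cls_eq_one_iff[OF divisors0_diff[OF assms]] by simp
qed

lemma two_torsion_iff:
  assumes "D \<in> carrier (divisors0 f)"
  shows "cls D \<in> two_torsion (jacobian f) \<longleftrightarrow> frag_cmul 2 D \<in> principal_divisors f"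
proof -
  have "frag_cmul 2 D = D + D" using frag_cmul_distrib[of 1 1 D] by simp
  moreover have "cls D [^]\<^bsub>jacobian f\<^esub> (2::nat) = cls D \<otimes>\<^bsub>jacobian f\<^esub> cls D"
    using cls.hom_closed[OF assms] by (simp add: numeral_2_eq_2)
  ultimately have "cls D [^]\<^bsub>jacobian f\<^esub> (2::nat) = cls (frag_cmul 2 D)"
    using cls_add assms by simp
  then show ?thesis
    using cls.hom_closed[OF assms] cls_eq_one_iff[OF divisors0_cmul[OF assms]] by (simp add: two_torsion_def)
qed

lemma subgroup_two_torsion: "subgroup (two_torsion (jacobian f)) (jacobian f)"
proof (rule jac.subgroupI)
  show "two_torsion (jacobian f) \<noteq> {}"
    using jac.nat_pow_one[of 2] by (auto simp: two_torsion_def)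
qed (auto simp: two_torsion_def jac.pow_mult_distrib jac.m_comm jac.nat_pow_inv)

lemma base_divisors0: "a \<in> roots \<Longrightarrow> base a \<in> carrier (divisors0 f)"
  using keys_base by (simp add: divisors0_carrier)

lemma combination_divisors0: "combination x \<in> carrier (divisors0 f)"
  using keys_combination by (simp add: divisors0_carrier)

lemma root_class_eq: "a \<in> roots \<Longrightarrow> root_class f a = cls (base a)"
  by (simp add: root_class_def point_over_root point_over_infinity base_def roots_def)

lemma combination_diff: "combination (\<lambda>a. x a - x' a) = combination x - combination x'"
  by (simp add: combination_def frag_cmul_diff_distrib sum_subtractf)

lemma principal_combination_even: "combination (\<lambda>a. 2 * x a) \<in> principal_divisors f"
proof -
  have "frag_cmul (x a) (frag_cmul 2 (base a)) \<in> principal_divisors f" if "a \<in> roots" for a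
    using principal_cmul[OF principal_2_base[OF that]] .
  then show ?thesis unfolding combination_def by (intro principal_sum) (simp add: mult.commute)
qed

lemma combination_2_principal: "frag_cmul 2 (combination x) \<in> principal_divisors f"
  using principal_combination_even[of x] by (simp add: combination_cmul)

text \<open>The divisor of \<open>y\<close> eliminates one coefficient, and the others matter only modulo two.\<close>

lemma combination_normal_form:
  obtains z where "\<And>a. z a \<in> {0, 1}" "z b = 0" "combination x - combination z \<in> principal_divisors f"
proof -
  define z where "z a = (x a - x b) mod 2" for a
  have "combination x - combination z = combination (\<lambda>a. x b * 1 + 2 * ((x a - x b) div 2))"
    unfolding combination_diff[symmetric] z_def
    by (rule arg_cong[of _ _ combination]) (simp add: fun_eq_iff minus_mod_eq_mult_div[symmetric])
  also have "\<dots> = frag_cmul (x b) (combination (\<lambda>a. 1)) + combination (\<lambda>a. 2 * ((x a - x b) div 2))"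
    by (simp only: combination_add combination_cmul)
  finally have "combination x - combination z \<in> principal_divisors f"
    using principal_add[OF principal_cmul[OF principal_combination_1] principal_combination_even] by metis
  moreover have "z a \<in> {0, 1}" for a unfolding z_def by (simp; presburger)
  moreover have "z b = 0" by (simp add: z_def)
  ultimately show ?thesis by (rule that[rotated 2])
qed

lemma two_torsion_normal_form:
  assumes "c \<in> two_torsion (jacobian f)"
  obtains z where "\<And>a. z a \<in> {0, 1}" "z b = 0" "c = cls (combination z)"
proof -
  have "c \<in> carrier (jacobian f)" using assms by (simp add: two_torsion_def)
  then obtain D where D: "D \<in> carrier (divisors0 f)" "c = cls D" by (auto simp: carrier_jacobian)
  then have "frag_cmul 2 D \<in> principal_divisors f" using assms two_torsion_iff by blast
  then obtain x where x: "D - combination x \<in> principal_divisors f"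
    using two_torsion_divisor_class D(1) by (auto simp: divisors0_carrier)
  obtain z where z: "\<And>a. z a \<in> {0, 1}" "z b = 0" "combination x - combination z \<in> principal_divisors f"
    using combination_normal_form by metis
  have "cls D = cls (combination x)" using cls_eq_iff[OF D(1) combination_divisors0] x by blast
  also have "\<dots> = cls (combination z)"
    using cls_eq_iff[OF combination_divisors0 combination_divisors0] z(3) by blast
  finally show ?thesis using that z D by metis
qed

text \<open>A relation \<open>P\<^sub>a - P\<^sub>b = div h\<close> has odd coefficients at \<open>a\<close> and \<open>b\<close> and the even coefficient \<open>0\<close>
  at a third root.\<close>

lemma inj_on_root_class:
  assumes "card roots \<ge> 3"
  shows "inj_on (root_class f) roots"
proof
  fix a b assume ab: "a \<in> roots" "b \<in> roots" and eq: "root_class f a = root_class f b"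
  show "a = b"
  proof (rule ccontr)
    assume "a \<noteq> b"
    have "card {a, b} < card roots" using assms \<open>a \<noteq> b\<close> by simp
    then have "\<not> roots \<subseteq> {a, b}" by (meson card_mono finite.emptyI finite.insertI not_le)
    then obtain c where c: "c \<in> roots" "c \<noteq> a" "c \<noteq> b" by blast
    define x :: "'b \<Rightarrow> int" where "x t = (if t = a then 1 else 0) - (if t = b then 1 else 0)" for t
    have "combination x = base a - base b"
    proof -
      have delta: "combination (\<lambda>t. if t = s then 1 else 0) = base s" if "s \<in> roots" for s
      proof -
        have "combination (\<lambda>t. if t = s then 1 else 0) = (\<Sum>t\<in>roots. if t = s then base s else 0)"
          unfolding combination_def by (intro sum.cong) auto
        then show ?thesis using that by simp
      qed
      show ?thesis unfolding x_def combination_diff using delta ab by simp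
    qed
    then have "combination x \<in> principal_divisors f"
      using eq ab cls_eq_iff[OF base_divisors0 base_divisors0] by (simp add: root_class_eq)
    then have "(\<forall>t\<in>roots. even (x t)) \<or> (\<forall>t\<in>roots. odd (x t))" by (rule combination_parity)
    moreover have "odd (x a)" "even (x c)" using \<open>a \<noteq> b\<close> c by (simp_all add: x_def)
    ultimately show False using ab c by blast
  qed
qed

lemma generate_root_classes: "generate (jacobian f) (root_class f ` roots) = two_torsion (jacobian f)"
proof
  have "root_class f a \<in> two_torsion (jacobian f)" if "a \<in> roots" for a
    using that two_torsion_iff[OF base_divisors0] principal_2_base by (simp add: root_class_eq)
  then show "generate (jacobian f) (root_class f ` roots) \<subseteq> two_torsion (jacobian f)"
    by (intro jac.generate_subgroup_incl subgroup_two_torsion) blast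
  show "two_torsion (jacobian f) \<subseteq> generate (jacobian f) (root_class f ` roots)"
  proof
    fix c assume "c \<in> two_torsion (jacobian f)"
    then obtain z where z: "\<And>a. z a \<in> {0, 1}" "c = cls (combination z)"
      using two_torsion_normal_form[of c undefined] by metis
    have "cls (\<Sum>a\<in>A. frag_cmul (z a) (base a)) \<in> generate (jacobian f) (root_class f ` roots)
        \<and> (\<Sum>a\<in>A. frag_cmul (z a) (base a)) \<in> carrier (divisors0 f)"
      if "finite A" "A \<subseteq> roots" for A
      using that
    proof (induction A rule: finite_induct)
      case empty
      then show ?case
        using cls_eq_one_iff[of 0] generate.one[of "jacobian f"] by (auto simp: divisors0_carrier)
    next
      case (insert a A)
      let ?D = "frag_cmul (z a) (base a)" and ?E = "\<Sum>a\<in>A. frag_cmul (z a) (base a)"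
      have a: "a \<in> roots" using insert by simp
      have D: "?D \<in> carrier (divisors0 f)" using divisors0_cmul[OF base_divisors0[OF a]] .
      have "cls ?D \<in> generate (jacobian f) (root_class f ` roots)"
      proof (cases "z a = 0")
        case True
        then show ?thesis
          using cls_eq_one_iff[of 0] generate.one[of "jacobian f"] by (auto simp: divisors0_carrier)
      next
        case False
        then have "z a = 1" using z(1)[of a] by simp
        then show ?thesis using a by (auto intro!: generate.incl simp: root_class_eq[symmetric])
      qed
      moreover have "?D + ?E \<in> carrier (divisors0 f)" using D insert divs.m_closed[of ?D ?E] by simp
      moreover have "cls (?D + ?E) = cls ?D \<otimes>\<^bsub>jacobian f\<^esub> cls ?E" using D insert by (intro cls_add) auto
      ultimately show ?case using insert by (simp add: generate.eng)
    qed
    then show "c \<in> generate (jacobian f) (root_class f ` roots)"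
      using z(2) by (simp add: combination_def)
  qed
qed

text \<open>The divisor of \<open>y\<close> expresses the class of the last finite ramified point by the others. There is
  no further relation: the last coefficient is \<open>0\<close> here, so a relation has even coefficients only.\<close>

lemma two_torsion_iso:
  assumes e: "bij_betw e {1..Suc m} roots"
  shows "(jacobian f)\<lparr>carrier := two_torsion (jacobian f)\<rparr> \<cong> sum_group {1..m} (\<lambda>_. integer_mod_group 2)"
proof -
  let ?I = "{1..m}" and ?J = "(jacobian f)\<lparr>carrier := two_torsion (jacobian f)\<rparr>"
  let ?S = "sum_group ?I (\<lambda>_. integer_mod_group 2)"
  \<comment> \<open>coefficients on all roots, with \<open>0\<close> at the last one\<close>
  define ext where "ext s a = (if a = e (Suc m) then 0 else s (inv_into {1..Suc m} e a))"
    for s :: "nat \<Rightarrow> int" and a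
  have inj: "inj_on e {1..Suc m}" and img: "e ` {1..Suc m} = roots"
    using e by (auto simp: bij_betw_def)
  have ext_e: "ext s (e i) = s i" if "i \<in> ?I" for s i
  proof -
    have "e i \<noteq> e (Suc m)" using that inj_onD[OF inj, of i "Suc m"] by auto
    then show ?thesis using that inj by (simp add: ext_def)
  qed
  have ext_last: "ext s (e (Suc m)) = 0" for s by (simp add: ext_def)
  have roots_cases: "a = e (Suc m) \<or> (\<exists>i\<in>?I. a = e i)" if "a \<in> roots" for a
  proof -
    obtain i where i: "i \<in> {1..Suc m}" "a = e i" using \<open>a \<in> roots\<close> unfolding img[symmetric] by blast
    then have "i = Suc m \<or> i \<in> ?I" by auto
    then show ?thesis using i by blast
  qed
  have comb_cong: "combination x = combination x'" if "\<And>a. a \<in> roots \<Longrightarrow> x a = x' a" for x x'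
    unfolding combination_def by (rule sum.cong) (use that in auto)
  have carS: "carrier ?S = (\<Pi>\<^sub>E i\<in>?I. {0..<2})"
    by (subst carrier_sum_group) (auto simp: carrier_integer_mod_group)
  define \<psi> where "\<psi> s = cls (combination (ext s))" for s
  have mem: "\<psi> s \<in> two_torsion (jacobian f)" for s
    unfolding \<psi>_def using two_torsion_iff[OF combination_divisors0] combination_2_principal by blast
  have mult: "\<psi> (s \<otimes>\<^bsub>?S\<^esub> t) = \<psi> s \<otimes>\<^bsub>jacobian f\<^esub> \<psi> t" for s t
  proof -
    let ?st = "s \<otimes>\<^bsub>?S\<^esub> t"
    let ?k = "\<lambda>a. - ((ext s a + ext t a) div 2)"
    have "combination (ext ?st) - (combination (ext s) + combination (ext t))
        = combination (\<lambda>a. ext ?st a - (ext s a + ext t a))"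
      by (simp only: combination_diff combination_add)
    also have "\<dots> = combination (\<lambda>a. 2 * ?k a)"
    proof (rule comb_cong)
      fix a assume "a \<in> roots"
      then consider "a = e (Suc m)" | i where "i \<in> ?I" "a = e i" using roots_cases by blast
      then show "ext ?st a - (ext s a + ext t a) = 2 * ?k a"
      proof cases
        case 1
        then show ?thesis by (simp add: ext_last)
      next
        case 2
        then have "ext ?st a = (ext s a + ext t a) mod 2" by (simp add: ext_e)
        then show ?thesis by (simp add: minus_mult_div_eq_mod[symmetric])
      qed
    qed
    finally have "combination (ext ?st) - (combination (ext s) + combination (ext t)) \<in> principal_divisors f"
      using principal_combination_even by metis
    moreover have "combination (ext s) + combination (ext t) \<in> carrier (divisors0 f)"
      using divs.m_closed[OF combination_divisors0 combination_divisors0] by simp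
    ultimately have "cls (combination (ext ?st)) = cls (combination (ext s) + combination (ext t))"
      using cls_eq_iff[OF combination_divisors0] by blast
    then show ?thesis unfolding \<psi>_def using cls_add[OF combination_divisors0 combination_divisors0] by simp
  qed
  have groups: "Group.group ?S" "Group.group ?J"
    using subgroup.subgroup_is_group[OF subgroup_two_torsion jac.is_group] by auto
  have hom: "group_hom ?S ?J \<psi>"
    using groups mem mult by (auto simp: group_hom_def group_hom_axioms_def hom_def simp del: mult_sum_group)
  have "\<psi> \<in> iso ?S ?J"
    unfolding group_hom.iso_iff[OF hom]
  proof (intro conjI ballI impI subsetI)
    fix c assume "c \<in> carrier ?J"
    then have "c \<in> two_torsion (jacobian f)" by simp
    then obtain z where z: "\<And>a. z a \<in> {0, 1}" "z (e (Suc m)) = 0" "c = cls (combination z)"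
      using two_torsion_normal_form[of c "e (Suc m)"] by metis
    define s where "s = (\<lambda>i\<in>?I. z (e i))"
    have "combination (ext s) = combination z"
    proof (rule comb_cong)
      fix a assume "a \<in> roots"
      then show "ext s a = z a" using roots_cases[of a] z(2) by (auto simp: ext_last ext_e s_def)
    qed
    then have "c = \<psi> s" using z(3) by (simp add: \<psi>_def)
    moreover have "s \<in> carrier ?S"
    proof -
      have "z (e i) \<in> {0..<2}" for i using z(1)[of "e i"] by auto
      then show ?thesis unfolding carS s_def by auto
    qed
    ultimately show "c \<in> \<psi> ` carrier ?S" by blast
  next
    fix s assume s: "s \<in> carrier ?S" and "\<psi> s = \<one>\<^bsub>?J\<^esub>"
    then have "combination (ext s) \<in> principal_divisors f"
      using cls_eq_one_iff[OF combination_divisors0] by (simp add: \<psi>_def)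
    then have "(\<forall>a\<in>roots. even (ext s a)) \<or> (\<forall>a\<in>roots. odd (ext s a))" by (rule combination_parity)
    moreover have "e (Suc m) \<in> roots" using img by auto
    ultimately have "\<forall>a\<in>roots. even (ext s a)" using ext_last[of s] by fastforce
    then have ev: "even (s i)" if "i \<in> ?I" for i
    proof -
      have "e i \<in> roots" unfolding img[symmetric] by (rule imageI) (use that in auto)
      then have "even (ext s (e i))" using \<open>\<forall>a\<in>roots. even (ext s a)\<close> by blast
      then show ?thesis using ext_e[OF that] by simp
    qed
    have "s i = 0" if "i \<in> ?I" for i
    proof -
      have "0 \<le> s i" "s i < 2" using s that unfolding carS by auto
      then show ?thesis using ev[OF that] by presburger
    qed
    moreover have "s \<in> extensional ?I" using s unfolding carS by (simp add: PiE_def)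
    ultimately show "s = \<one>\<^bsub>?S\<^esub>" by (auto simp: fun_eq_iff extensional_def)
  qed
  then show ?thesis using group.iso_sym[OF groups(1)] is_isoI by blast
qed

end


section \<open>Separability\<close>

text \<open>If the derivative vanishes, only exponents divisible by the characteristic \<open>p\<close> occur. As all
  coefficients are \<open>p\<close>-th powers, \<open>f\<close> is then the \<open>p\<close>-th power of a polynomial.\<close>

lemma pderiv_neq_0_if_perfect:
  fixes f :: "'a::field poly"
  assumes perfect: "perfect_field TYPE('a)" and irr: "irreducible f" and deg: "degree f > 0"
  shows "pderiv f \<noteq> 0"
proof
  assume "pderiv f = 0"
  then have zero: "of_nat i = (0 :: 'a) \<or> coeff f i = 0" if "i > 0" for i
    using that coeff_pderiv[of f "i - 1"] by simp
  define p where "p = CHAR('a)"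
  have "of_nat (degree f) = (0 :: 'a)" using zero[OF deg] deg by auto
  then have "p > 0" unfolding p_def CHAR_pos_iff using deg by blast
  then have prime: "prime p" unfolding p_def by (rule prime_CHAR_semidom)
  have coeff0: "coeff f i = 0" if "\<not> p dvd i" for i
    using that zero[of i] unfolding of_nat_eq_0_iff_char_dvd by (cases "i = 0") (auto simp: p_def)
  have surj: "surj (\<lambda>x::'a. x ^ p)" using perfect \<open>p > 0\<close> by (auto simp: perfect_field_def p_def)
  define r :: "'a \<Rightarrow> 'a" where "r = inv_into UNIV (\<lambda>x. x ^ p)"
  have r: "r c ^ p = c" for c unfolding r_def using surj_f_inv_f[OF surj, of c] .
  define n where "n = degree f"
  define h where "h = (\<Sum>j\<le>n. Polynomial.monom (r (coeff f (p * j))) j)"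
  have "h ^ p = (\<Sum>j\<le>n. Polynomial.monom (r (coeff f (p * j))) j ^ p)"
    unfolding h_def using prime by (intro freshmans_dream_sum) (auto simp: p_def)
  also have "\<dots> = (\<Sum>j\<le>n. Polynomial.monom (coeff f (p * j)) (p * j))"
    by (simp add: monom_power r mult.commute)
  also have "\<dots> = f"
  proof (rule poly_eqI)
    fix i
    show "coeff (\<Sum>j\<le>n. Polynomial.monom (coeff f (p * j)) (p * j)) i = coeff f i"
    proof (cases "p dvd i")
      case False
      then show ?thesis by (auto simp: coeff_sum coeff0 intro!: sum.neutral)
    next
      case True
      then obtain j where j: "i = p * j" by blast
      have "coeff (\<Sum>j\<le>n. Polynomial.monom (coeff f (p * j)) (p * j)) i
          = (\<Sum>k\<le>n. if k = j then coeff f i else 0)"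
        unfolding coeff_sum j using \<open>p > 0\<close> by (intro sum.cong) auto
      moreover have "coeff f i = 0" if "\<not> j \<le> n"
      proof (rule coeff_eq_0)
        have "j \<le> p * j" using \<open>p > 0\<close> by simp
        then show "degree f < i" using that unfolding j n_def by linarith
      qed
      ultimately show ?thesis by auto
    qed
  qed
  finally have "irreducible (h ^ p)" using irr by simp
  then have "p = 1" by simp
  then show False using prime by simp
qed

locale field_embedding =
  fixes \<iota> :: "'a::field \<Rightarrow> 'b::field"
  assumes hom_add: "\<iota> (a + b) = \<iota> a + \<iota> b" and hom_mult: "\<iota> (a * b) = \<iota> a * \<iota> b"
    and hom_1 [simp]: "\<iota> 1 = 1"
begin

lemma hom_0 [simp]: "\<iota> 0 = 0"
  using hom_add[of 0 0] by (metis add.right_neutral add_left_cancel)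

lemma hom_diff: "\<iota> (a - b) = \<iota> a - \<iota> b"
  using hom_add[of "a - b" b] by simp

lemma hom_inverse: "\<iota> (inverse a) = inverse (\<iota> a)"
proof (cases "a = 0")
  case False
  then have "\<iota> a * \<iota> (inverse a) = 1" by (simp flip: hom_mult)
  then show ?thesis by (metis inverse_unique)
qed simp

lemma hom_eq_0_iff [simp]: "\<iota> a = 0 \<longleftrightarrow> a = 0"
proof
  assume "\<iota> a = 0"
  then have "\<iota> (a * inverse a) = 0" by (simp add: hom_mult)
  then show "a = 0" by (cases "a = 0") auto
qed simp

lemma hom_of_nat: "\<iota> (of_nat n) = of_nat n"
  by (induction n) (simp_all add: hom_add)

lemma range_field_subset: "field_subset (range \<iota>)"
proof
  show "1 \<in> range \<iota>" by (metis hom_1 rangeI)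
qed (auto simp flip: hom_diff hom_mult hom_inverse)

lemma map_poly_add: "map_poly \<iota> (p + q) = map_poly \<iota> p + map_poly \<iota> q"
  by (rule poly_eqI) (simp add: coeff_map_poly hom_add)

lemma map_poly_mult: "map_poly \<iota> (p * q) = map_poly \<iota> p * map_poly \<iota> q"
  by (induction p) (simp_all add: map_poly_pCons map_poly_add map_poly_smult hom_mult)

lemma map_poly_pderiv: "map_poly \<iota> (pderiv p) = pderiv (map_poly \<iota> p)"
  by (rule poly_eqI) (simp add: coeff_map_poly coeff_pderiv hom_mult hom_add hom_of_nat)

text \<open>A polynomial of minimal degree among those vanishing at a root divides \<open>f\<close>, so that \<open>f\<close>
  itself has minimal degree. The derivative therefore does not vanish at the root.\<close>

lemma simple_roots_if_perfect:
  assumes perfect: "perfect_field TYPE('a)" and irr: "irreducible f" and deg: "degree f > 0"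
    and root: "poly (map_poly \<iota> f) a = 0"
  shows "Polynomial.order a (map_poly \<iota> f) = 1"
proof (rule ccontr)
  let ?f = "map_poly \<iota> f"
  have f0: "f \<noteq> 0" using deg by auto
  then have mf0: "?f \<noteq> 0" by (simp add: map_poly_eq_0_iff)
  assume "Polynomial.order a ?f \<noteq> 1"
  moreover have "Polynomial.order a ?f \<noteq> 0" using root mf0 order_root[of ?f a] by simp
  ultimately have "2 \<le> Polynomial.order a ?f" by linarith
  then have "[:- a, 1:] ^ 2 dvd ?f" using order_1 power_le_dvd by blast
  then obtain s where "?f = [:- a, 1:] ^ 2 * s" by (elim dvdE)
  then have s: "?f = [:- a, 1:] * ([:- a, 1:] * s)" by (simp only: power2_eq_square mult.assoc)
  have "poly (pderiv ?f) a = 0"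
    unfolding s by (simp add: pderiv_mult pderiv_pCons del: mult_pCons_left)
  then have root': "poly (map_poly \<iota> (pderiv f)) a = 0" by (simp add: map_poly_pderiv)
  define V where "V = {q. q \<noteq> 0 \<and> poly (map_poly \<iota> q) a = 0}"
  have "f \<in> V" "pderiv f \<in> V"
    using f0 root root' pderiv_neq_0_if_perfect[OF perfect irr deg] by (auto simp: V_def)
  obtain q where q: "q \<in> V" and least: "\<And>q'. q' \<in> V \<Longrightarrow> degree q \<le> degree q'"
    using ex_has_least_nat[of "\<lambda>q. q \<in> V" f degree] \<open>f \<in> V\<close> by auto
  have "map_poly \<iota> f = map_poly \<iota> (f div q) * map_poly \<iota> q + map_poly \<iota> (f mod q)"
    by (simp flip: map_poly_add map_poly_mult)
  from arg_cong[OF this, of "\<lambda>p. poly p a"] have "poly (map_poly \<iota> (f mod q)) a = 0"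
    using root q by (simp add: V_def)
  then have "f mod q = 0"
    using least[of "f mod q"] degree_mod_less[of q f] q by (force simp: V_def)
  then obtain k where k: "f = q * k" by (metis mod_eq_0_iff_dvd dvdE)
  then consider "q dvd 1" | "k dvd 1" using irr irreducibleD by blast
  then show False
  proof cases
    case 1
    then obtain c where "q = [:c:]" by (auto elim: is_unit_polyE)
    then show False using q by (auto simp: V_def map_poly_pCons)
  next
    case 2
    have "k \<noteq> 0" using k f0 by auto
    then have "degree k = 0" using 2 is_unit_iff_degree[of k] by blast
    then have "degree f = degree q"
      using k q \<open>k \<noteq> 0\<close> by (simp add: degree_mult_eq V_def)
    moreover have "degree (pderiv f) \<le> degree f - 1"
      by (rule degree_le) (auto simp: coeff_pderiv coeff_eq_0)
    ultimately show False using least[OF \<open>pderiv f \<in> V\<close>] deg by linarith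
  qed
qed

end

lemma order_prod_linear:
  fixes e :: "'i \<Rightarrow> 'b::field"
  assumes "finite I"
  shows "Polynomial.order a (\<Prod>i\<in>I. [:- e i, 1:]) = card {i \<in> I. e i = a}"
  using assms
proof (induction I rule: finite_induct)
  case empty
  then show ?case by (simp add: order_0I)
next
  case (insert i I)
  have nz: "(\<Prod>i\<in>I. [:- e i, 1:]) \<noteq> 0" using insert by simp
  have lin: "Polynomial.order a [:- e i, 1:] = (if e i = a then 1 else 0)"
    using order_power_n_n[of a 1] by (auto simp: order_0I)
  have "Polynomial.order a (\<Prod>i\<in>insert i I. [:- e i, 1:]) = Polynomial.order a [:- e i, 1:] + card {i \<in> I. e i = a}"
    using insert nz by (simp add: order_mult del: mult_pCons_left)
  moreover have "{j \<in> insert i I. e j = a} = (if e i = a then insert i {j \<in> I. e j = a} else {j \<in> I. e j = a})"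
    by auto
  ultimately show ?case using insert lin by simp
qed


section \<open>The theorem\<close>

theorem theorem2p1:
  fixes \<iota> :: "'a::field \<Rightarrow> 'b::alg_closed_field"
    and f :: "'a poly" and g :: nat and fb :: "'b poly" and e :: "nat \<Rightarrow> 'b"
  assumes "perfect_field TYPE('a)"
    and "CHAR('a) \<noteq> 2"
    and "is_algebraic_closure \<iota>"
    and "g \<ge> 1"
    and "irreducible f" and "lead_coeff f = 1" and "degree f = 2 * g + 1"
    and "fb = map_poly \<iota> f"
    and "fb = (\<Prod>i\<in>{1..2*g+1}. [:- e i, 1:])"
  shows
    "(\<forall>i\<in>{1..2*g+1}. nonsingular_at fb (e i, 0, 1) \<and>
        (\<exists>!P. P \<in> points_over fb (e i, 0, 1))) \<and>
     (\<exists>!P. P \<in> points_over fb (0, 1, 0)) \<and>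
     rational_over (range \<iota>) fb (point_over fb (0, 1, 0)) \<and>
     root_class fb ` (e ` {1..2*g+1}) \<subseteq> carrier (jacobian fb) \<and>
     inj_on (root_class fb) (e ` {1..2*g+1}) \<and>
     generate (jacobian fb) (root_class fb ` (e ` {1..2*g+1}))
       = two_torsion (jacobian fb) \<and>
     (jacobian fb)\<lparr>carrier := two_torsion (jacobian fb)\<rparr>
       \<cong> sum_group {1..2*g} (\<lambda>_. integer_mod_group 2)"
proof -
  interpret emb: field_embedding \<iota>
    using assms(3) by unfold_locales (auto simp: is_algebraic_closure_def)
  have deg: "degree fb = 2 * g + 1"
    using assms(7,8) by (simp add: degree_map_poly)
  have coeff: "coeff fb i = \<iota> (coeff f i)" for i
    using assms(8) by (simp add: coeff_map_poly)
  have simple: "Polynomial.order a fb = 1" if "poly fb a = 0" for a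
    using emb.simple_roots_if_perfect[OF assms(1,5)] that assms(7,8) by simp
  interpret odd_hyperelliptic fb
  proof
    have "\<not> CHAR('a) dvd 2"
    proof
      assume "CHAR('a) dvd 2"
      then have "CHAR('a) = 1 \<or> CHAR('a) = 2" by (metis prime_nat_iff two_is_prime_nat)
      then show False using assms(2) by (simp add: CHAR_not_1')
    qed
    then have "(of_nat 2 :: 'a) \<noteq> 0" by (simp only: of_nat_eq_0_iff_char_dvd not_False_eq_True)
    then have "\<iota> (of_nat 2) \<noteq> 0" by (simp only: emb.hom_eq_0_iff not_False_eq_True)
    then show "(2 :: 'b) \<noteq> 0" unfolding emb.hom_of_nat by simp
    show "lead_coeff fb = 1" using assms(6,7) deg coeff by simp
  qed (use deg assms(4) simple in auto)
  let ?I = "{1..2*g+1}"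
  have order: "Polynomial.order a fb = card {i \<in> ?I. e i = a}" for a
    unfolding assms(9) by (rule order_prod_linear) simp
  have root_iff: "a \<in> roots \<longleftrightarrow> a \<in> e ` ?I" for a
  proof -
    have "a \<in> roots \<longleftrightarrow> card {i \<in> ?I. e i = a} \<noteq> 0"
      using order_root[of fb a] by (simp add: roots_def order)
    also have "\<dots> \<longleftrightarrow> a \<in> e ` ?I" by auto
    finally show ?thesis .
  qed
  then have img: "e ` ?I = roots" by blast
  have inj: "inj_on e ?I"
  proof
    fix i j assume ij: "i \<in> ?I" "j \<in> ?I" "e i = e j"
    then have "e i \<in> roots" using img by blast
    then have "card {k \<in> ?I. e k = e i} = 1" using simple[of "e i"] order[of "e i"] by (simp add: roots_def)
    then obtain k where "{k \<in> ?I. e k = e i} = {k}" by (auto simp: card_1_singleton_iff)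
    then show "i = j" using ij by (metis (mono_tags, lifting) mem_Collect_eq singletonD)
  qed
  have bij: "bij_betw e {1..Suc (2 * g)} roots" using inj img by (simp add: bij_betw_def)
  have card: "card roots \<ge> 3" using card_image[OF inj] img assms(4) by simp
  have zero: "poly fb (e i) = 0" if "i \<in> ?I" for i using img that by (auto simp: roots_def)
  have "rational_over (range \<iota>) fb (point_over fb (0, 1, 0))"
    unfolding point_over_infinity by (rule P_inf_rational[OF emb.range_field_subset]) (simp add: coeff)
  moreover have "root_class fb ` roots \<subseteq> carrier (jacobian fb)"
    using base_divisors0 cls.hom_closed by (auto simp: root_class_eq)
  ultimately show ?thesis
    unfolding img
    using nonsingular_root[OF zero] points_over_root[OF zero] points_over_infinity inj_on_root_class[OF card]
      generate_root_classes two_torsion_iso[OF bij]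
    by auto
qed

end
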